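(* Let $\phi,\psi\in L^2(\mathbb R)$ with $\overline\phi,\psi\in H_2^+(\mathbb R)$, and consider the Friedrichs model with data $\phi,\psi$. If $B\in\mathbb C$ and $B\neq-\pi i$, then $\mathrm{def}(\mathcal S_B)=0$, where $\mathrm{def}(\mathcal S_B)=\dim(\mathcal S_B^\perp)$. Similar results hold for $\widetilde{\mathcal S}_B$ by taking adjoints.
   Context: $H_2^{+}(\mathbb R)$: Hardy space of boundary values on $\mathbb R$ of functions in the Hardy class $H^2$ of the upper half-plane. $\langle f,g\rangle=\int_{\mathbb R}f\overline g\,dx$. Friedrichs model with data $\phi,\psi\in L^2(\mathbb R)$: the operator $(Af)(x)=xf(x)+\langle f,\phi\rangle\psi(x)$ on $\{f\in L^2(\mathbb R): xf\in L^2(\mathbb R),\ \lim_{R\to\infty}\int_{-R}^R f\,dx \text{ exists and is } 0\}$, and $\widetilde A$, given on the same domain by the same expression with $\phi$ and $\psi$ exchanged. Let $\mathcal D=\{f\in L^2(\mathbb R):\exists c_f\in\mathbb C,\ xf(x)-c_f\mathbf 1\in L^2(\mathbb R)\}$; $c_f$ is uniquely determined. Both adjoints have domain $\mathcal D$, with $(\widetilde A^*f)(x)=xf(x)-c_f+\langle f,\phi\rangle\psi(x)$ and $(A^*f)(x)=xf(x)-c_f+\langle f,\psi\rangle\phi(x)$. On $\mathcal D$ put $\Gamma_1u=\lim_{R\to\infty}\int_{-R}^Ru\,dx$, $\Gamma_2u=c_u$. For $B\in\mathbb C$, $A_B$ is the restriction of $\widetilde A^*$ to $\{u\in\mathcal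 D:\Gamma_1u=B\Gamma_2u\}$; its resolvent set $\rho(A_B)$ is assumed non-empty. For $\lambda\in\rho(A_B)$ the solution operator $S_{\lambda,B}:\mathbb C\to\ker(\widetilde A^*-\lambda)$ is defined by $(\widetilde A^*-\lambda)S_{\lambda,B}f=0$, $(\Gamma_1-B\Gamma_2)S_{\lambda,B}f=f$. Fix $\mu_0\in\rho(A_B)$ and set $\mathcal S_B=\mathrm{Span}_{\delta\in\rho(A_B)}(A_B-\delta)^{-1}\mathrm{Ran}(S_{\mu_0,B})$; its closure is called the detectable subspace. The spaces $\widetilde{\mathcal S}$ are the analogous spaces for the adjoint side: $\widetilde A_{C}$ is the restriction of $A^*$ to $\{v\in\mathcal D:\Gamma_1v=C\,\Gamma_2v\}$, $\widetilde S_{\lambda,C}$ is defined for $\lambda\in\rho(\widetilde A_C)$ by $(A^*-\lambda)\widetilde S_{\lambda,C}f=0$, $(\Gamma_1-C\,\Gamma_2)\widetilde S_{\lambda,C}f=f$, and, for a fixed $\widetilde\mu\in\rho(\widetilde A_C)$, $\widetilde{\mathcal S}_C=\mathrm{Span}_{\delta\in\rho(\widetilde A_C)}(\widetilde A_C-\delta)^{-1}\mathrm{Ran}(\widetilde S_{\widetilde\mu,C})$. The space on the adjoint side that corresponds to $\mathcal S_B$ is the one with $C=B^*=\overline B$.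
   Formalization: For B = πi it is additionally assumed that φ and ψ are both non-zero; without this the claim is false, since then the closure of S_B is H_2^+ (and H_2^- on the adjoint side) and the defect is infinite. *)

theory Defs
  imports "HOL-Analysis.Analysis"
begin

section \<open>The complex Hilbert space of square-integrable functions on the real line\<close>

definition square_integrable :: "(real \<Rightarrow> complex) set" where
  "square_integrable =
     {f. f \<in> borel_measurable lborel \<and> integrable lborel (\<lambda>x. (cmod (f x))\<^sup>2)}"

lemma square_integrable_mult:
  assumes "f \<in> square_integrable" "g \<in> square_integrable"
  shows "integrable lborel (\<lambda>x. f x * g x)"
proof (rule Bochner_Integration.integrable_bound)
  show "integrable lborel (\<lambda>x. (cmod (f x))\<^sup>2 + (cmod (g x))\<^sup>2)"
    using assms by (auto simp: square_integrable_def)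
  show "(\<lambda>x. f x * g x) \<in> borel_measurable lborel"
    using assms by (auto simp: square_integrable_def)
  show "AE x in lborel. norm (f x * g x) \<le> norm ((cmod (f x))\<^sup>2 + (cmod (g x))\<^sup>2)"
  proof (rule AE_I2)
    fix x
    have "0 \<le> (cmod (f x) - cmod (g x))\<^sup>2" by simp
    then have "2 * (cmod (f x) * cmod (g x)) \<le> (cmod (f x))\<^sup>2 + (cmod (g x))\<^sup>2"
      by (simp add: power2_diff)
    moreover have "0 \<le> cmod (f x) * cmod (g x)" by simp
    ultimately show "norm (f x * g x) \<le> norm ((cmod (f x))\<^sup>2 + (cmod (g x))\<^sup>2)"
      unfolding norm_mult real_norm_def by linarith
  qed
qed

lemma square_integrable_cnj:
  "f \<in> square_integrable \<Longrightarrow> (\<lambda>x. cnj (f x)) \<in> square_integrable"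
  unfolding square_integrable_def
  using measurable_compose[of f lborel borel cnj borel]
  by (simp add: borel_measurable_continuous_onI continuous_on_cnj)

lemma square_integrable_scale:
  "f \<in> square_integrable \<Longrightarrow> (\<lambda>x. a * f x) \<in> square_integrable"
  by (auto simp: square_integrable_def norm_mult power_mult_distrib)

lemma square_integrable_add:
  assumes "f \<in> square_integrable" "g \<in> square_integrable"
  shows "(\<lambda>x. f x + g x) \<in> square_integrable"
proof -
  have "integrable lborel (\<lambda>x. (cmod (f x + g x))\<^sup>2)"
  proof (rule Bochner_Integration.integrable_bound)
    show "integrable lborel (\<lambda>x. 2 * ((cmod (f x))\<^sup>2 + (cmod (g x))\<^sup>2))"
      using assms by (auto simp: square_integrable_def)
    show "(\<lambda>x. (cmod (f x + g x))\<^sup>2) \<in> borel_measurable lborel"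
      using assms by (auto simp: square_integrable_def)
    show "AE x in lborel. norm ((cmod (f x + g x))\<^sup>2) \<le> norm (2 * ((cmod (f x))\<^sup>2 + (cmod (g x))\<^sup>2))"
    proof (rule AE_I2)
      fix x
      have "(cmod (f x + g x))\<^sup>2 \<le> (cmod (f x) + cmod (g x))\<^sup>2"
        by (intro power_mono norm_triangle_ineq) auto
      moreover have "0 \<le> (cmod (f x) - cmod (g x))\<^sup>2" by simp
      ultimately have "(cmod (f x + g x))\<^sup>2 \<le> 2 * ((cmod (f x))\<^sup>2 + (cmod (g x))\<^sup>2)"
        by (simp add: power2_diff power2_sum)
      then show "norm ((cmod (f x + g x))\<^sup>2) \<le> norm (2 * ((cmod (f x))\<^sup>2 + (cmod (g x))\<^sup>2))"
        by simp
    qed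
  qed
  then show ?thesis using assms by (auto simp: square_integrable_def)
qed

lemma square_integrable_uminus:
  "f \<in> square_integrable \<Longrightarrow> (\<lambda>x. - f x) \<in> square_integrable"
  by (auto simp: square_integrable_def)

lemma square_integrable_diff:
  "f \<in> square_integrable \<Longrightarrow> g \<in> square_integrable \<Longrightarrow> (\<lambda>x. f x - g x) \<in> square_integrable"
  using square_integrable_add[OF _ square_integrable_uminus, of f g] by simp

definition ae_eq :: "(real \<Rightarrow> complex) \<Rightarrow> (real \<Rightarrow> complex) \<Rightarrow> bool" where
  "ae_eq f g \<longleftrightarrow> f \<in> square_integrable \<and> g \<in> square_integrable \<and> (AE x in lborel. f x = g x)"

quotient_type L2 = "real \<Rightarrow> complex" / partial: ae_eq
proof (rule part_equivpI)
  show "\<exists>f. ae_eq f f"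
    by (rule exI[of _ "\<lambda>_. 0"]) (simp add: ae_eq_def square_integrable_def)
  show "symp ae_eq" by (simp add: symp_def ae_eq_def eq_commute)
  show "transp ae_eq"
  proof (rule transpI)
    fix f g h assume "ae_eq f g" "ae_eq g h"
    moreover from this have "AE x in lborel. f x = g x" "AE x in lborel. g x = h x"
      by (auto simp: ae_eq_def)
    then have "AE x in lborel. f x = h x" by eventually_elim simp
    ultimately show "ae_eq f h" by (simp add: ae_eq_def)
  qed
qed

lemma ae_eqI: "f \<in> square_integrable \<Longrightarrow> (\<And>x. f x = g x) \<Longrightarrow> ae_eq f g"
  by (subgoal_tac "f = g") (auto simp: ae_eq_def)

lemma ae_eqD: "ae_eq f g \<Longrightarrow> f \<in> square_integrable"
  by (simp add: ae_eq_def)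

lemma ae_eq_map2:
  assumes "ae_eq f f'" "ae_eq g g'"
    and "\<And>f g. f \<in> square_integrable \<Longrightarrow> g \<in> square_integrable \<Longrightarrow>
           (\<lambda>x. h (f x) (g x)) \<in> square_integrable"
  shows "ae_eq (\<lambda>x. h (f x) (g x)) (\<lambda>x. h (f' x) (g' x))"
proof -
  have "AE x in lborel. f x = f' x" "AE x in lborel. g x = g' x"
    using assms(1,2) by (simp_all add: ae_eq_def)
  then have "AE x in lborel. h (f x) (g x) = h (f' x) (g' x)" by eventually_elim simp
  then show ?thesis using assms by (simp add: ae_eq_def)
qed

lemmas square_integrable_intros = ae_eqD square_integrable_add square_integrable_diff
  square_integrable_uminus square_integrable_scale

instantiation L2 :: real_vector
begin

lift_definition zero_L2 :: L2 is "\<lambda>_. 0"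
  by (simp add: ae_eq_def square_integrable_def)

lift_definition plus_L2 :: "L2 \<Rightarrow> L2 \<Rightarrow> L2" is "\<lambda>f g x. f x + g x"
  by (erule (1) ae_eq_map2) (rule square_integrable_add)

lift_definition uminus_L2 :: "L2 \<Rightarrow> L2" is "\<lambda>f x. - f x"
  by (simp add: ae_eq_def square_integrable_uminus)

lift_definition minus_L2 :: "L2 \<Rightarrow> L2 \<Rightarrow> L2" is "\<lambda>f g x. f x - g x"
  by (erule (1) ae_eq_map2) (rule square_integrable_diff)

lift_definition scaleR_L2 :: "real \<Rightarrow> L2 \<Rightarrow> L2" is "\<lambda>r f x. complex_of_real r * f x"
  by (simp add: ae_eq_def square_integrable_scale)

instance
proof
  fix f g h :: L2 and a b :: real
  show "f + g + h = f + (g + h)"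
    by transfer (rule ae_eqI, (rule square_integrable_intros(2-) | erule ae_eqD)+, simp)
  show "f + g = g + f"
    by transfer (rule ae_eqI, (rule square_integrable_intros(2-) | erule ae_eqD)+, simp)
  show "0 + f = f"
    by transfer (simp add: ae_eq_def)
  show "- f + f = 0"
    by transfer (simp add: ae_eq_def square_integrable_def)
  show "f - g = f + - g"
    by transfer (rule ae_eqI, (rule square_integrable_intros(2-) | erule ae_eqD)+, simp)
  show "a *\<^sub>R (f + g) = a *\<^sub>R f + a *\<^sub>R g"
    by transfer
      (rule ae_eqI, (rule square_integrable_intros(2-) | erule ae_eqD)+, simp add: distrib_left)
  show "(a + b) *\<^sub>R f = a *\<^sub>R f + b *\<^sub>R f"
    by transfer
      (rule ae_eqI, (rule square_integrable_intros(2-) | erule ae_eqD)+, simp add: distrib_right)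
  show "a *\<^sub>R b *\<^sub>R f = (a * b) *\<^sub>R f"
    by transfer
      (rule ae_eqI, (rule square_integrable_intros(2-) | erule ae_eqD)+, simp)
  show "1 *\<^sub>R f = f"
    by transfer (simp add: ae_eq_def)
qed

end

lift_definition scaleC :: "complex \<Rightarrow> L2 \<Rightarrow> L2" (infixr \<open>*\<^sub>C\<close> 75) is "\<lambda>a f x. a * f x"
  by (simp add: ae_eq_def square_integrable_scale)

lift_definition cnj_L2 :: "L2 \<Rightarrow> L2" is "\<lambda>f x. cnj (f x)"
  by (simp add: ae_eq_def square_integrable_cnj)

interpretation L2: vector_space scaleC
proof
  fix f g :: L2 and a b :: complex
  show "a *\<^sub>C (f + g) = a *\<^sub>C f + a *\<^sub>C g"
    by transfer
      (rule ae_eqI, (rule square_integrable_intros(2-) | erule ae_eqD)+, simp add: distrib_left)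
  show "(a + b) *\<^sub>C f = a *\<^sub>C f + b *\<^sub>C f"
    by transfer
      (rule ae_eqI, (rule square_integrable_intros(2-) | erule ae_eqD)+, simp add: distrib_right)
  show "a *\<^sub>C b *\<^sub>C f = (a * b) *\<^sub>C f"
    by transfer
      (rule ae_eqI, (rule square_integrable_intros(2-) | erule ae_eqD)+, simp)
  show "1 *\<^sub>C f = f"
    by transfer (simp add: ae_eq_def)
qed

lift_definition cinner :: "L2 \<Rightarrow> L2 \<Rightarrow> complex" is "\<lambda>f g. LINT x|lborel. f x * cnj (g x)"
proof -
  fix f f' g g' assume "ae_eq f f'" "ae_eq g g'"
  then have f: "f \<in> square_integrable" "f' \<in> square_integrable" "AE x in lborel. f x = f' x"
    and g: "g \<in> square_integrable" "g' \<in> square_integrable" "AE x in lborel. g x = g' x"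
    by (auto simp: ae_eq_def)
  have m: "(\<lambda>x. f x * cnj (g x)) \<in> borel_measurable lborel"
    by (rule borel_measurable_integrable[OF square_integrable_mult[OF f(1) square_integrable_cnj[OF g(1)]]])
  have m': "(\<lambda>x. f' x * cnj (g' x)) \<in> borel_measurable lborel"
    by (rule borel_measurable_integrable[OF square_integrable_mult[OF f(2) square_integrable_cnj[OF g(2)]]])
  have "AE x in lborel. f x * cnj (g x) = f' x * cnj (g' x)"
    using f(3) g(3) by eventually_elim simp
  then show "(LINT x|lborel. f x * cnj (g x)) = (LINT x|lborel. f' x * cnj (g' x))"
    using m m' by (intro integral_cong_AE)
qed

instantiation L2 :: real_inner
begin

definition inner_L2 :: "L2 \<Rightarrow> L2 \<Rightarrow> real" where
  "inner_L2 f g = Re (cinner f g)"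

definition norm_L2 :: "L2 \<Rightarrow> real" where
  "norm_L2 f = sqrt (inner f f)"

definition sgn_L2 :: "L2 \<Rightarrow> L2" where
  "sgn_L2 f = f /\<^sub>R norm f"

definition dist_L2 :: "L2 \<Rightarrow> L2 \<Rightarrow> real" where
  "dist_L2 f g = norm (f - g)"

definition uniformity_L2 :: "(L2 \<times> L2) filter" where
  "uniformity_L2 = (INF e\<in>{0<..}. principal {(f, g). dist f g < e})"

definition open_L2 :: "L2 set \<Rightarrow> bool" where
  "open_L2 U \<longleftrightarrow> (\<forall>f\<in>U. eventually (\<lambda>(f', g). f' = f \<longrightarrow> g \<in> U) uniformity)"

instance
proof
  fix f g h :: L2 and r :: real and U :: "L2 set"
  show "sgn f = inverse (norm f) *\<^sub>R f" by (simp add: sgn_L2_def)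
  show "dist f g = norm (f - g)" by (simp add: dist_L2_def)
  show "uniformity = (INF e\<in>{0<..}. principal {(x, y :: L2). dist x y < e})"
    by (simp add: uniformity_L2_def)
  show "open U \<longleftrightarrow> (\<forall>x\<in>U. eventually (\<lambda>(x', y). x' = x \<longrightarrow> y \<in> U) uniformity)"
    by (simp add: open_L2_def)
  have "cinner f g = cnj (cinner g f)"
    by transfer (simp add: mult.commute flip: Bochner_Integration.integral_cnj)
  then show "inner f g = inner g f" by (simp add: inner_L2_def)
  have "cinner (f + g) h = cinner f h + cinner g h"
    by transfer
      (simp add: ae_eq_def distrib_right square_integrable_mult square_integrable_cnj)
  then show "inner (f + g) h = inner f h + inner g h" by (simp add: inner_L2_def)
  have "cinner (r *\<^sub>R f) g = complex_of_real r * cinner f g"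
    by transfer (simp add: ae_eq_def mult.assoc)
  then show "inner (r *\<^sub>R f) g = r * inner f g" by (simp add: inner_L2_def)
  have *: "cinner f f = complex_of_real (LINT x|lborel. (cmod (rep_L2 f x))\<^sup>2)"
    unfolding cinner.rep_eq integral_complex_of_real[symmetric]
    by (rule Bochner_Integration.integral_cong) (simp_all flip: complex_norm_square)
  then show "0 \<le> inner f f" by (simp add: inner_L2_def)
  have sq: "rep_L2 f \<in> square_integrable"
    using Quotient3_rep_reflp[OF Quotient3_L2, of f] by (simp add: ae_eq_def)
  have "inner f f = 0 \<longleftrightarrow> (AE x in lborel. (cmod (rep_L2 f x))\<^sup>2 = 0)"
    using sq unfolding inner_L2_def *
    by (simp add: square_integrable_def integral_nonneg_eq_0_iff_AE)
  also have "\<dots> \<longleftrightarrow> ae_eq (rep_L2 f) (\<lambda>_. 0)"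
    using sq by (simp add: ae_eq_def square_integrable_def)
  also have "\<dots> \<longleftrightarrow> f = 0"
    using Quotient3_rel[OF Quotient3_L2, of "rep_L2 f" "\<lambda>_. 0"] sq
    by (simp add: zero_L2_def Quotient3_abs_rep[OF Quotient3_L2])
      (simp add: ae_eq_def square_integrable_def)
  finally show "inner f f = 0 \<longleftrightarrow> f = 0" .
  show "norm f = sqrt (inner f f)" by (simp add: norm_L2_def)
qed

end

text \<open>
  The library's \<open>dim\<close> is a natural number and returns 0 for spaces of infinite dimension,
  hence an extended dimension.
\<close>
definition edim :: "L2 set \<Rightarrow> enat" where
  "edim V = (SUP b\<in>{b. b \<subseteq> V \<and> finite b \<and> \<not> L2.dependent b}. enat (card b))"

definition orth :: "L2 set \<Rightarrow> L2 set" where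
  "orth S = {g. \<forall>s\<in>S. cinner g s = 0}"

definition defect :: "L2 set \<Rightarrow> enat" where
  "defect S = edim (orth S)"


section \<open>The Hardy space of the upper half-plane\<close>

definition hardy_class :: "(complex \<Rightarrow> complex) set" where
  "hardy_class = {F. F holomorphic_on {z. Im z > 0} \<and>
     (\<exists>C. \<forall>y>0. (\<lambda>x. F (Complex x y)) \<in> square_integrable \<and>
                (LINT x|lborel. (cmod (F (Complex x y)))\<^sup>2) \<le> C)}"

definition hardy_space :: "L2 set" where
  "hardy_space = {h. \<exists>F\<in>hardy_class.
     AE x in lborel. ((\<lambda>y. F (Complex x y)) \<longlongrightarrow> rep_L2 h x) (at_right 0)}"


section \<open>Operators as graphs\<close>

text \<open>
  An unbounded operator is represented by its graph, the set of all pairs of an element of the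
  domain and its image. The adjoint of a densely defined operator is again a graph.
\<close>
type_synonym operator = "(L2 \<times> L2) set"

definition adjoint_op :: "operator \<Rightarrow> operator" where
  "adjoint_op T = {(u, v). \<forall>(f, g)\<in>T. cinner g u = cinner f v}"

definition resolvent_set :: "operator \<Rightarrow> complex set" where
  "resolvent_set T = {l. (\<forall>s. \<exists>!u. (u, s + l *\<^sub>C u) \<in> T) \<and>
     (\<exists>K. \<forall>s u. (u, s + l *\<^sub>C u) \<in> T \<longrightarrow> norm u \<le> K * norm s)}"

text \<open>\<open>(T - l)\<^sup>-\<^sup>1 s\<close>, for \<open>l\<close> in the resolvent set\<close>
definition resolvent :: "operator \<Rightarrow> complex \<Rightarrow> L2 \<Rightarrow> L2" where
  "resolvent T l s = (THE u. (u, s + l *\<^sub>C u) \<in> T)"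


section \<open>The Friedrichs model\<close>

definition sym_integral :: "L2 \<Rightarrow> real \<Rightarrow> complex" where
  "sym_integral u R = (LINT x:{-R..R}|lborel. rep_L2 u x)"

definition friedrichs_dom :: "L2 set" where
  "friedrichs_dom = {f. (\<lambda>x. of_real x * rep_L2 f x) \<in> square_integrable \<and>
                        (sym_integral f \<longlongrightarrow> 0) at_top}"

definition friedrichs :: "L2 \<Rightarrow> L2 \<Rightarrow> operator" where
  "friedrichs \<phi> \<psi> =
     {(f, abs_L2 (\<lambda>x. of_real x * rep_L2 f x) + cinner f \<phi> *\<^sub>C \<psi>) | f. f \<in> friedrichs_dom}"

text \<open>
  The adjoint of the Friedrichs operator with \<open>\<phi>\<close> and \<open>\<psi>\<close> exchanged. The operator on the
  adjoint side, that is the adjoint of \<open>friedrichs \<phi> \<psi>\<close> itself, is \<open>max_op \<psi> \<phi>\<close>.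
\<close>
definition max_op :: "L2 \<Rightarrow> L2 \<Rightarrow> operator" where
  "max_op \<phi> \<psi> = adjoint_op (friedrichs \<psi> \<phi>)"

definition max_dom :: "L2 set" where
  "max_dom = {f. \<exists>c. (\<lambda>x. of_real x * rep_L2 f x - c) \<in> square_integrable}"

text \<open>The boundary maps are meaningful on \<open>max_dom\<close> only.\<close>
definition \<Gamma>\<^sub>1 :: "L2 \<Rightarrow> complex" where
  "\<Gamma>\<^sub>1 u = Lim at_top (sym_integral u)"

definition \<Gamma>\<^sub>2 :: "L2 \<Rightarrow> complex" where
  "\<Gamma>\<^sub>2 u = (THE c. (\<lambda>x. of_real x * rep_L2 u x - c) \<in> square_integrable)"

definition A_op :: "L2 \<Rightarrow> L2 \<Rightarrow> complex \<Rightarrow> operator" where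
  "A_op \<phi> \<psi> B = {(u, v) \<in> max_op \<phi> \<psi>. u \<in> max_dom \<and> \<Gamma>\<^sub>1 u = B * \<Gamma>\<^sub>2 u}"

definition solution_op :: "L2 \<Rightarrow> L2 \<Rightarrow> complex \<Rightarrow> complex \<Rightarrow> complex \<Rightarrow> L2" where
  "solution_op \<phi> \<psi> B l f =
     (THE u. u \<in> max_dom \<and> (u, l *\<^sub>C u) \<in> max_op \<phi> \<psi> \<and> \<Gamma>\<^sub>1 u - B * \<Gamma>\<^sub>2 u = f)"

text \<open>The space \<open>\<S>\<^sub>B\<close>, formed with the base point \<open>m\<close> in the resolvent set\<close>
definition S_space :: "L2 \<Rightarrow> L2 \<Rightarrow> complex \<Rightarrow> complex \<Rightarrow> L2 set" where
  "S_space \<phi> \<psi> B m =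
     L2.span (\<Union>d\<in>resolvent_set (A_op \<phi> \<psi> B).
                resolvent (A_op \<phi> \<psi> B) d ` range (solution_op \<phi> \<psi> B m))"

definition A_adj_op :: "L2 \<Rightarrow> L2 \<Rightarrow> complex \<Rightarrow> operator" where
  "A_adj_op \<phi> \<psi> C = A_op \<psi> \<phi> C"

definition S_adj_space :: "L2 \<Rightarrow> L2 \<Rightarrow> complex \<Rightarrow> complex \<Rightarrow> L2 set" where
  "S_adj_space \<phi> \<psi> C m = S_space \<psi> \<phi> C m"

end

theory Submission
  imports Defs "HOL-Complex_Analysis.Complex_Analysis" "HOL-Probability.Sinc_Integral"
    "HOL-Real_Asymp.Real_Asymp"
begin

text \<open>
  For non-real \<open>l\<close> the equation \<open>(A\<^sub>B - l) u = s\<close> is a two by two linear system for the constants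
  \<open>\<langle>u, \<phi>\<rangle>\<close> and \<open>c\<^sub>u\<close>. When its determinant does not vanish, \<open>l\<close> lies in the resolvent set, and the
  kernel of \<open>max_op - l\<close> is spanned by \<open>w\<^sub>l = ((1 + p) - q \<psi>) / (x - l)\<close> with
  \<open>p = \<langle>\<psi> / (x - l), \<phi>\<rangle>\<close> and \<open>q = \<langle>1 / (x - l), \<phi>\<rangle>\<close>. If \<open>g\<close> is orthogonal to \<open>\<S>\<^sub>B\<close>, the resolvent
  identity makes \<open>\<langle>w\<^sub>l, g\<rangle>\<close> divided by the determinant independent of \<open>l\<close>. In the lower half-plane the
  Hardy conditions give \<open>p = q = 0\<close>, the determinant is the constant \<open>B + \<pi> \<i>\<close>, and letting \<open>l\<close> tend
  to \<open>-\<i> \<infinity>\<close> shows that \<open>\<langle>w\<^sub>l, g\<rangle> = 0\<close> for all \<open>l\<close>. So the conjugate of \<open>g\<close> is annihilated by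
  \<open>1 / (x - l)\<close> for all \<open>l\<close> in the lower half-plane, and the Cauchy transform is multiplicative on
  such functions. In the upper half-plane \<open>\<langle>w\<^sub>l, g\<rangle> = 0\<close> then forces the Cauchy transform of the
  conjugate of \<open>g\<close> to vanish wherever the determinant does not, hence everywhere, and \<open>g = 0\<close>.
  The adjoint side is the same argument with the half-planes exchanged.
\<close>

section \<open>Square-integrable functions\<close>

text \<open>The constants \<open>\<pi> \<i>\<close> and \<open>- \<pi> \<i>\<close> are the values
  of \<open>\<Gamma>\<^sub>1\<close> on \<open>1 / (x - l)\<close> in the two half-planes, while
  \<open>\<Gamma>\<^sub>2\<close> is \<open>1\<close> there. Where \<open>p = q = 0\<close>, this
  function spans the kernel of \<open>max_op - l\<close> and is an eigenfunction of
  \<open>A_B\<close> exactly when \<open>B\<close> is that constant. The obstacle is that a product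
  of two Hardy functions is only integrable, so \<open>p\<close> is the transform of a function to
  which the norm bounds and holomorphy for square-integrable functions do not apply.
  Multiplicativity removes it: with \<open>r\<close> the transform of \<open>\<psi>\<close>, in the
  upper half-plane \<open>p = q r / (2 \<pi> \<i>)\<close>. It is also the reason for the final
  cancellation: for the transform \<open>G\<close> of the conjugate of \<open>g\<close>, the kernel
  identity reads \<open>(1 + p) G = q (r G / (2 \<pi> \<i>)) = p G\<close>, so \<open>G = 0\<close>.
  Hardy functions enter through almost everywhere vertical limits and a bound on the norms along
  horizontal lines. These already give weak convergence of the levels, and since
  \<open>1 / (x - l)\<close> is square-integrable this suffices for Cauchy's formula on the real
  line.\<close>

lemma rep_L2_square_integrable [simp]: "rep_L2 u \<in> square_integrable"
  using Quotient3_rep_reflp[OF Quotient3_L2, of u] by (simp add: ae_eq_def)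

lemma rep_abs_L2:
  assumes "f \<in> square_integrable"
  shows "AE x in lborel. rep_L2 (abs_L2 f) x = f x"
proof -
  have "ae_eq f f" using assms by (simp add: ae_eq_def)
  then have "ae_eq (rep_L2 (abs_L2 f)) f"
    by (rule Quotient3_rep_abs[OF Quotient3_L2])
  then show ?thesis by (simp add: ae_eq_def)
qed

lemma L2_eqI:
  assumes "AE x in lborel. rep_L2 u x = rep_L2 v x"
  shows "u = v"
proof -
  have "ae_eq (rep_L2 u) (rep_L2 v)"
    using assms by (simp add: ae_eq_def)
  then show ?thesis
    using Quotient3_rel_rep[OF Quotient3_L2] by blast
qed

lemma abs_L2_eqI:
  assumes "f \<in> square_integrable" "AE x in lborel. f x = rep_L2 u x"
  shows "abs_L2 f = u"
  using rep_abs_L2[OF assms(1)] assms(2) by (intro L2_eqI) auto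

lemma rep_add: "AE x in lborel. rep_L2 (u + v) x = rep_L2 u x + rep_L2 v x"
  using rep_abs_L2[of "\<lambda>x. rep_L2 u x + rep_L2 v x"]
  by (simp add: plus_L2_def square_integrable_add)

lemma rep_diff: "AE x in lborel. rep_L2 (u - v) x = rep_L2 u x - rep_L2 v x"
  using rep_abs_L2[of "\<lambda>x. rep_L2 u x - rep_L2 v x"]
  by (simp add: minus_L2_def square_integrable_diff)

lemma rep_scale: "AE x in lborel. rep_L2 (a *\<^sub>C u) x = a * rep_L2 u x"
  using rep_abs_L2[of "\<lambda>x. a * rep_L2 u x"]
  by (simp add: scaleC_def square_integrable_scale)

lemma rep_zero: "AE x in lborel. rep_L2 0 x = 0"
  using rep_abs_L2[of "\<lambda>x. 0"]
  by (simp add: zero_L2_def square_integrable_def)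

lemma rep_cnj: "AE x in lborel. rep_L2 (cnj_L2 u) x = cnj (rep_L2 u x)"
  using rep_abs_L2[of "\<lambda>x. cnj (rep_L2 u x)"]
  by (simp add: cnj_L2_def square_integrable_cnj)

lemma square_integrable_measurable [measurable_dest]:
  "f \<in> square_integrable \<Longrightarrow> f \<in> borel_measurable borel"
  by (simp add: square_integrable_def)

lemma square_integrable_norm_sq:
  "f \<in> square_integrable \<Longrightarrow> integrable lborel (\<lambda>x. (cmod (f x))\<^sup>2)"
  by (simp add: square_integrable_def)

lemma square_integrableI_bound:
  assumes "g \<in> square_integrable" "f \<in> borel_measurable borel"
    and "AE x in lborel. cmod (f x) \<le> K * cmod (g x)"
  shows "f \<in> square_integrable"
proof -
  have "integrable lborel (\<lambda>x. (cmod (f x))\<^sup>2)"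
  proof (rule Bochner_Integration.integrable_bound)
    show "integrable lborel (\<lambda>x. K\<^sup>2 * (cmod (g x))\<^sup>2)"
      using assms(1) by (simp add: square_integrable_def)
    show "AE x in lborel. norm ((cmod (f x))\<^sup>2) \<le> norm (K\<^sup>2 * (cmod (g x))\<^sup>2)"
      using assms(3)
    proof eventually_elim
      case (elim x)
      then have "(cmod (f x))\<^sup>2 \<le> (K * cmod (g x))\<^sup>2" by (intro power_mono) auto
      then show ?case by (simp add: power_mult_distrib)
    qed
  qed (use assms(2) in measurable)
  with assms(2) show ?thesis by (simp add: square_integrable_def)
qed

lemma square_integrable_cong_AE:
  assumes "g \<in> square_integrable" "f \<in> borel_measurable borel" "AE x in lborel. f x = g x"
  shows "f \<in> square_integrable"
  using assms(3) by (intro square_integrableI_bound[OF assms(1,2), of 1]) auto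

lemma square_integrable_norm: "f \<in> square_integrable \<Longrightarrow> (\<lambda>x. of_real (cmod (f x))) \<in> square_integrable"
  by (auto intro!: square_integrableI_bound[of f _ 1])

lemma square_integrable_indicator:
  "f \<in> square_integrable \<Longrightarrow> A \<in> sets borel \<Longrightarrow> (\<lambda>x. indicator A x * f x) \<in> square_integrable"
  by (rule square_integrableI_bound[of f _ 1]) (auto simp: indicator_def)

section \<open>The Hermitian form and the Cauchy-Schwarz inequality\<close>

lemma cinner_commute: "cinner f g = cnj (cinner g f)"
  by transfer (simp add: mult.commute flip: Bochner_Integration.integral_cnj)

lemma cinner_add_left: "cinner (f + g) h = cinner f h + cinner g h"
  by transfer (simp add: ae_eq_def distrib_right square_integrable_mult square_integrable_cnj)

lemma cinner_scale_left: "cinner (a *\<^sub>C f) g = a * cinner f g"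
  by transfer (simp add: mult.assoc)

lemma cinner_add_right: "cinner f (g + h) = cinner f g + cinner f h"
proof -
  have "cinner f (g + h) = cnj (cinner (g + h) f)" by (rule cinner_commute)
  also have "\<dots> = cnj (cinner g f) + cnj (cinner h f)" by (simp add: cinner_add_left)
  finally show ?thesis by (simp flip: cinner_commute)
qed

lemma cinner_scale_right: "cinner f (a *\<^sub>C g) = cnj a * cinner f g"
proof -
  have "cinner f (a *\<^sub>C g) = cnj (cinner (a *\<^sub>C g) f)" by (rule cinner_commute)
  also have "\<dots> = cnj a * cnj (cinner g f)" by (simp add: cinner_scale_left)
  finally show ?thesis by (simp flip: cinner_commute)
qed

lemma diff_eq_add_scale: "f - g = f + (-1) *\<^sub>C g"
  by (simp add: L2.scale_minus_left)

lemma cinner_diff_left: "cinner (f - g) h = cinner f h - cinner g h"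
  by (simp only: diff_eq_add_scale cinner_add_left cinner_scale_left) simp

lemma cinner_diff_right: "cinner f (g - h) = cinner f g - cinner f h"
  by (simp only: diff_eq_add_scale cinner_add_right cinner_scale_right) simp

lemmas cinner_simps = cinner_add_left cinner_add_right cinner_diff_left cinner_diff_right
  cinner_scale_left cinner_scale_right

lemma cinner_abs:
  assumes "f \<in> square_integrable" "g \<in> square_integrable"
  shows "cinner (abs_L2 f) (abs_L2 g) = (LINT x|lborel. f x * cnj (g x))"
proof -
  have "ae_eq f f" "ae_eq g g" using assms by (auto simp: ae_eq_def)
  then show ?thesis by (rule cinner.abs_eq)
qed

lemma abs_rep_L2 [simp]: "abs_L2 (rep_L2 u) = u"
  by (rule Quotient3_abs_rep[OF Quotient3_L2])

lemma cinner_norm: "cinner f f = of_real ((norm f)\<^sup>2)"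
proof -
  have "cinner f f = cnj (cinner f f)" by (rule cinner_commute)
  then have "Im (cinner f f) = 0"
    by (metis complex_cnj_cancel_iff Reals_cnj_iff complex_is_Real_iff)
  moreover have "(norm f)\<^sup>2 = Re (cinner f f)"
    by (simp add: power2_norm_eq_inner inner_L2_def)
  ultimately show ?thesis by (simp add: complex_eq_iff)
qed

lemma norm_scaleC: "norm (a *\<^sub>C f) = cmod a * norm f"
proof -
  have "of_real ((norm (a *\<^sub>C f))\<^sup>2) = (of_real ((cmod a * norm f)\<^sup>2) :: complex)"
    by (simp add: cinner_norm[symmetric] cinner_simps complex_norm_square power_mult_distrib
        mult.assoc del: of_real_power)
  then have "(norm (a *\<^sub>C f))\<^sup>2 = (cmod a * norm f)\<^sup>2" by (simp only: of_real_eq_iff)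
  then show ?thesis by (simp add: power2_eq_iff_nonneg)
qed

text \<open>\<open>inner\<close> is only the real part of \<open>cinner\<close>, so the real
  Cauchy-Schwarz inequality is applied after rotating \<open>f\<close> by a unimodular factor that
  makes the pairing real and non-negative.\<close>

lemma cinner_bound: "cmod (cinner f g) \<le> norm f * norm g"
proof (cases "cinner f g = 0")
  case False
  define a where "a = cnj (cinner f g) / of_real (cmod (cinner f g))"
  have a: "cmod a = 1" using False by (simp add: a_def norm_divide)
  have "cinner (a *\<^sub>C f) g = of_real (cmod (cinner f g))"
    using False complex_norm_square[of "cinner f g"]
    by (simp add: cinner_simps a_def field_simps power2_eq_square)
  then have "cmod (cinner f g) = inner (a *\<^sub>C f) g" by (simp add: inner_L2_def)
  also have "\<dots> \<le> norm (a *\<^sub>C f) * norm g" by (rule norm_cauchy_schwarz)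
  finally show ?thesis by (simp add: norm_scaleC a)
qed simp

lemma norm_abs_L2:
  assumes "f \<in> square_integrable"
  shows "norm (abs_L2 f) = sqrt (LINT x|lborel. (cmod (f x))\<^sup>2)"
proof -
  have "of_real ((norm (abs_L2 f))\<^sup>2) = (LINT x|lborel. f x * cnj (f x))"
    by (simp add: cinner_norm[symmetric] cinner_abs[OF assms assms] del: of_real_power)
  also have "\<dots> = of_real (LINT x|lborel. (cmod (f x))\<^sup>2)"
    unfolding integral_complex_of_real[symmetric]
    by (rule Bochner_Integration.integral_cong) (simp_all flip: complex_norm_square)
  finally have "(norm (abs_L2 f))\<^sup>2 = (LINT x|lborel. (cmod (f x))\<^sup>2)" by (simp only: of_real_eq_iff)
  then show ?thesis by (metis norm_ge_zero real_sqrt_unique)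
qed

lemma Cauchy_Schwarz_LINT:
  assumes "f \<in> square_integrable" "g \<in> square_integrable"
  shows "cmod (LINT x|lborel. f x * g x) \<le>
    sqrt (LINT x|lborel. (cmod (f x))\<^sup>2) * sqrt (LINT x|lborel. (cmod (g x))\<^sup>2)"
  using cinner_bound[of "abs_L2 f" "abs_L2 (\<lambda>x. cnj (g x))"]
  by (simp add: cinner_abs norm_abs_L2 assms square_integrable_cnj)

lemma Cauchy_Schwarz_LINT_norm:
  assumes "f \<in> square_integrable" "g \<in> square_integrable"
  shows "(LINT x|lborel. cmod (f x * g x)) \<le>
    sqrt (LINT x|lborel. (cmod (f x))\<^sup>2) * sqrt (LINT x|lborel. (cmod (g x))\<^sup>2)"
proof -
  have "(LINT x|lborel. of_real (cmod (f x)) * of_real (cmod (g x))) =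
      complex_of_real (LINT x|lborel. cmod (f x * g x))"
    unfolding integral_complex_of_real[symmetric]
    by (rule Bochner_Integration.integral_cong) (simp_all add: norm_mult)
  with Cauchy_Schwarz_LINT[OF assms[THEN square_integrable_norm]] show ?thesis
    by (simp add: integral_nonneg_AE)
qed

section \<open>Integrals over bounded intervals\<close>

lemma square_integrable_indicator_Icc:
  "(\<lambda>x. indicator {a..b} x :: complex) \<in> square_integrable"
proof -
  have "(\<lambda>x. (cmod (indicator {a..b} x :: complex))\<^sup>2) = (indicator {a..b} :: real \<Rightarrow> real)"
    by (auto simp: indicator_def fun_eq_iff)
  moreover have "integrable lborel (indicator {a..b} :: real \<Rightarrow> real)"
    by (rule integrable_real_indicator) (auto simp: emeasure_lborel_Icc_eq)
  ultimately show ?thesis by (simp add: square_integrable_def)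
qed

lemma set_LINT_symmetric_tendsto:
  fixes f :: "real \<Rightarrow> complex"
  assumes "integrable lborel f"
  shows "((\<lambda>R. LINT x:{-R..R}|lborel. f x) \<longlongrightarrow> (LINT x|lborel. f x)) at_top"
  unfolding set_lebesgue_integral_def
proof (rule integral_dominated_convergence_at_top[where w="\<lambda>x. norm (f x)"])
  show "AE x in lborel. ((\<lambda>R. indicator {-R..R} x *\<^sub>R f x) \<longlongrightarrow> f x) at_top"
  proof (rule AE_I2)
    fix x
    have "eventually (\<lambda>R. indicator {-R..R} x *\<^sub>R f x = f x) at_top"
      using eventually_ge_at_top[of "\<bar>x\<bar>"] by eventually_elim (auto simp: indicator_def)
    then show "((\<lambda>R. indicator {-R..R} x *\<^sub>R f x) \<longlongrightarrow> f x) at_top"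
      by (rule tendsto_eventually)
  qed
  show "\<forall>\<^sub>F R in at_top. AE x in lborel. norm (indicator {-R..R} x *\<^sub>R f x) \<le> norm (f x)"
    by (auto simp: indicator_def)
qed (use assms in auto)

text \<open>Compact intervals (with the empty one) form an intersection-stable generator of the
  Borel sets, so a Dynkin induction carries the vanishing to all Borel sets. Complements need the
  integral over the whole line to vanish, hence \<open>tot\<close>.\<close>

lemma integral_interval_zero_imp_AE_zero:
  fixes f :: "real \<Rightarrow> complex"
  assumes f: "integrable lborel f"
    and z: "\<And>a b. a \<le> b \<Longrightarrow> (LINT x:{a..b}|lborel. f x) = 0"
  shows "AE x in lborel. f x = 0"
proof -
  have tot: "(LINT x|lborel. f x) = 0"
  proof (rule tendsto_unique[OF trivial_limit_at_top_linorder set_LINT_symmetric_tendsto[OF f]])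
    have "\<forall>\<^sub>F R in at_top. (LINT x:{-R..R}|lborel. f x) = 0"
      using eventually_ge_at_top[of 0] by eventually_elim (simp add: z)
    then show "((\<lambda>R. LINT x:{-R..R}|lborel. f x) \<longlongrightarrow> 0) at_top"
      by (rule tendsto_eventually)
  qed
  have fs: "set_integrable lborel A f" if "A \<in> sets borel" for A
    unfolding set_integrable_def using that f by (intro integrable_mult_indicator) auto
  have "(LINT x:A|lborel. f x) = 0" if "A \<in> sets borel" for A
  proof -
    let ?G = "range (\<lambda>(a, b). {a..b::real})"
    have gen: "sets borel = sigma_sets UNIV ?G"
      unfolding borel_eq_atLeastAtMost by simp
    have "A \<in> sigma_sets UNIV ?G" using that gen by simp
    show ?thesis
      using _ _ \<open>A \<in> sigma_sets UNIV ?G\<close>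
    proof (rule sigma_sets_induct_disjoint)
      show "Int_stable ?G"
        by (auto simp: Int_stable_def)
      show "?G \<subseteq> Pow UNIV" by simp
      show "(LINT x:A|lborel. f x) = 0" if "A \<in> ?G" for A
      proof -
        from that obtain a b where "A = {a..b}" by auto
        then show ?thesis using z[of a b] by (cases "a \<le> b") (auto simp: set_lebesgue_integral_def)
      qed
      show "(LINT x:{}|lborel. f x) = 0" by (simp add: set_lebesgue_integral_def)
      show "(LINT x:UNIV - A|lborel. f x) = 0"
        if "A \<in> sigma_sets UNIV ?G" "(LINT x:A|lborel. f x) = 0" for A
      proof -
        have "A \<in> sets borel" using that gen by simp
        then have "(LINT x:A \<union> (UNIV - A)|lborel. f x) = (LINT x:A|lborel. f x) + (LINT x:UNIV - A|lborel. f x)"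
          by (intro set_integral_Un fs) auto
        then show ?thesis using that tot by (simp add: set_lebesgue_integral_def)
      qed
      show "(LINT x:\<Union>(range A)|lborel. f x) = 0"
        if "disjoint_family A" "range A \<subseteq> sigma_sets UNIV ?G" "\<And>i. (LINT x:A i|lborel. f x) = 0"
        for A :: "nat \<Rightarrow> real set"
      proof -
        have "A i \<in> sets borel" for i using that(2) gen by auto
        then have "(LINT x:\<Union>(range A)|lborel. f x) = (\<Sum>i. LINT x:A i|lborel. f x)"
          by (intro lebesgue_integral_countable_add fs)
            (use that(1) in \<open>auto simp: disjoint_family_on_def\<close>)
        then show ?thesis using that(3) by simp
      qed
    qed
  qed
  then show ?thesis by (intro sigma_finite_measure.density_zero[OF sigma_finite_lborel f]) auto
qed

section \<open>The Cauchy transform\<close>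

lemma has_bochner_integral_inverse_quadratic:
  fixes a b :: real
  assumes "b \<noteq> 0"
  shows "has_bochner_integral lborel (\<lambda>x. 1 / ((x - a)\<^sup>2 + b\<^sup>2)) (pi / \<bar>b\<bar>)"
proof -
  have "integrable lborel (\<lambda>x::real. inverse (1 + x\<^sup>2))"
    using integrable_inverse_1_plus_square by (simp add: set_integrable_def)
  moreover have "(LINT x|lborel. inverse (1 + x\<^sup>2)) = pi"
    using LBINT_inverse_1_plus_square
    by (simp add: interval_lebesgue_integral_def set_lebesgue_integral_def)
  ultimately have "has_bochner_integral lborel (\<lambda>x::real. inverse (1 + x\<^sup>2)) pi"
    by (simp add: has_bochner_integral_iff)
  then have "has_bochner_integral lborel (\<lambda>x. (1 / b\<^sup>2) * inverse (1 + x\<^sup>2)) ((1 / b\<^sup>2) * pi)"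
    by (rule has_bochner_integral_mult_right)
  also have "(\<lambda>x. (1 / b\<^sup>2) * inverse (1 + x\<^sup>2)) = (\<lambda>x. 1 / ((a + b * x - a)\<^sup>2 + b\<^sup>2))"
    by (simp add: fun_eq_iff field_simps power_mult_distrib)
  also have "(1 / b\<^sup>2) * pi = (pi / \<bar>b\<bar>) /\<^sub>R \<bar>b\<bar>"
    by (simp add: field_simps power2_eq_square)
  finally show ?thesis
    using lborel_has_bochner_integral_real_affine_iff[OF assms, of "\<lambda>x. 1 / ((x - a)\<^sup>2 + b\<^sup>2)" _ a]
    by blast
qed

section \<open>The kernel \<open>1 / (x - l)\<close> and its principal-value integral\<close>

definition kern :: "complex \<Rightarrow> real \<Rightarrow> complex" where
  "kern l x = 1 / (of_real x - l)"

lemma kern_denom_nonzero: "Im l \<noteq> 0 \<Longrightarrow> of_real x - l \<noteq> 0"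
  by (auto simp: complex_eq_iff)

lemma kern_measurable [measurable]: "kern l \<in> borel_measurable borel"
  unfolding kern_def by measurable

lemma cmod_kern_sq: "(cmod (kern l x))\<^sup>2 = 1 / ((x - Re l)\<^sup>2 + (Im l)\<^sup>2)"
  by (simp add: kern_def norm_divide power_divide cmod_power2)

lemma kern_cnj: "kern (cnj l) x = cnj (kern l x)"
  by (simp add: kern_def)

lemma cmod_kern_le: "Im l \<noteq> 0 \<Longrightarrow> cmod (kern l x) \<le> 1 / \<bar>Im l\<bar>"
  using abs_Im_le_cmod[of "of_real x - l"]
  by (simp add: kern_def norm_divide divide_simps)

lemma kern_LINT:
  assumes "Im l \<noteq> 0"
  shows "integrable lborel (\<lambda>x. (cmod (kern l x))\<^sup>2)"
    and "(LINT x|lborel. (cmod (kern l x))\<^sup>2) = pi / \<bar>Im l\<bar>"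
  using has_bochner_integral_inverse_quadratic[OF assms, of "Re l"]
  by (simp_all add: cmod_kern_sq has_bochner_integral_iff)

lemma kern_square_integrable [intro]: "Im l \<noteq> 0 \<Longrightarrow> kern l \<in> square_integrable"
  by (simp add: square_integrable_def kern_LINT)

lemma mult_kern_square_integrable [intro]:
  assumes "f \<in> square_integrable" "Im l \<noteq> 0"
  shows "(\<lambda>x. f x * kern l x) \<in> square_integrable"
proof (rule square_integrableI_bound[OF assms(1)])
  show "(\<lambda>x. f x * kern l x) \<in> borel_measurable borel" using assms(1) by measurable
  have "cmod (f x * kern l x) \<le> 1 / \<bar>Im l\<bar> * cmod (f x)" for x
    using mult_right_mono[OF cmod_kern_le[OF assms(2)], of "cmod (f x)" x]
    by (simp add: norm_mult mult.commute)
  then show "AE x in lborel. cmod (f x * kern l x) \<le> 1 / \<bar>Im l\<bar> * cmod (f x)" by simp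
qed

lemma mult_kern_integrable [intro]:
  "f \<in> square_integrable \<Longrightarrow> Im l \<noteq> 0 \<Longrightarrow> integrable lborel (\<lambda>x. f x * kern l x)"
  by (intro square_integrable_mult kern_square_integrable)

lemma kern_diff:
  assumes "Im l \<noteq> 0" "Im m \<noteq> 0"
  shows "kern l x - kern m x = (l - m) * (kern l x * kern m x)"
  using kern_denom_nonzero[OF assms(1), of x] kern_denom_nonzero[OF assms(2), of x]
  by (simp add: kern_def field_simps)

text \<open>Up to a constant, \<open>P\<close> is a branch of the logarithm of \<open>x - l\<close>,
  written with the real \<open>ln\<close> and \<open>arctan\<close> so that no branch cut
  interferes.\<close>

lemma kern_set_LINT:
  assumes "Im l \<noteq> 0" "0 \<le> R"
  defines "P \<equiv> \<lambda>x. of_real (ln ((x - Re l)\<^sup>2 + (Im l)\<^sup>2) / 2) + \<i> * of_real (arctan ((x - Re l) / Im l))"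
  shows "(LINT x:{-R..R}|lborel. kern l x) = P R - P (- R)"
    and "set_integrable lborel {-R..R} (kern l)"
proof -
  have pos: "(x - Re l)\<^sup>2 + (Im l)\<^sup>2 > 0" for x
    using assms(1) by (simp add: add_nonneg_pos)
  have "has_bochner_integral lborel (\<lambda>x. indicator {-R..R} x *\<^sub>R kern l x) (P R - P (- R))"
  proof (rule has_bochner_integral_FTC_Icc)
    show "- R \<le> R" using assms by simp
    fix x
    have 1: "((\<lambda>x. ln ((x - Re l)\<^sup>2 + (Im l)\<^sup>2) / 2) has_real_derivative
        (x - Re l) / ((x - Re l)\<^sup>2 + (Im l)\<^sup>2)) (at x within {-R..R})"
      using pos[of x] by (auto intro!: derivative_eq_intros simp: divide_simps) (simp_all add: algebra_simps)
    have 2: "((\<lambda>x. arctan ((x - Re l) / Im l)) has_real_derivative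
        Im l / ((x - Re l)\<^sup>2 + (Im l)\<^sup>2)) (at x within {-R..R})"
      using pos[of x] assms(1)
      by (auto intro!: derivative_eq_intros simp: field_simps power2_eq_square)
    have "kern l x = (of_real (x - Re l) + \<i> * of_real (Im l)) / of_real ((x - Re l)\<^sup>2 + (Im l)\<^sup>2)"
    proof -
      have "complex_of_real ((x - Re l)\<^sup>2 + (Im l)\<^sup>2) =
          (of_real x - l) * (of_real (x - Re l) + \<i> * of_real (Im l))"
        by (simp add: complex_eq_iff power2_eq_square algebra_simps)
      moreover have "complex_of_real ((x - Re l)\<^sup>2 + (Im l)\<^sup>2) \<noteq> 0"
        using pos[of x] by (simp only: of_real_eq_0_iff)
      ultimately show ?thesis
        using kern_denom_nonzero[OF assms(1), of x] unfolding kern_def by (auto simp: field_simps)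
    qed
    then show "(P has_vector_derivative kern l x) (at x within {-R..R})"
      unfolding P_def
      using has_vector_derivative_add[OF
          has_vector_derivative_of_real[OF 1]
          has_vector_derivative_mult_right[OF
            has_vector_derivative_of_real[OF 2], of \<i>]]
      by (simp add: add_divide_distrib)
  next
    show "continuous_on {-R..R} (kern l)"
      unfolding kern_def by (intro continuous_intros) (use kern_denom_nonzero[OF assms(1)] in auto)
  qed
  then show "(LINT x:{-R..R}|lborel. kern l x) = P R - P (- R)" "set_integrable lborel {-R..R} (kern l)"
    by (simp_all add: has_bochner_integral_iff set_lebesgue_integral_def set_integrable_def)
qed

text \<open>The logarithms at the two ends cancel because the interval is symmetric; what remains is
  the half turn of the argument of \<open>x - l\<close>, whose direction depends on the half-plane
  of \<open>l\<close>.\<close>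

lemma kern_symmetric_tendsto:
  assumes "Im l \<noteq> 0"
  shows "((\<lambda>R. LINT x:{-R..R}|lborel. kern l x) \<longlongrightarrow> of_real (sgn (Im l) * pi) * \<i>) at_top"
proof -
  define a b where "a = Re l" and "b = Im l"
  have 1: "((\<lambda>R. ln ((R - a)\<^sup>2 + b\<^sup>2) / 2 - ln ((- R - a)\<^sup>2 + b\<^sup>2) / 2) \<longlongrightarrow> 0) at_top"
    by real_asymp
  have 2: "((\<lambda>R. arctan ((R - a) / b) - arctan ((- R - a) / b)) \<longlongrightarrow> sgn b * pi) at_top"
  proof (cases "b > 0")
    case True
    have "((\<lambda>R. arctan ((R - a) / b) - arctan ((- R - a) / b)) \<longlongrightarrow> pi) at_top"
      using True by real_asymp
    then show ?thesis using True by simp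
  next
    case False
    then have "b < 0" using assms b_def by simp
    then have "((\<lambda>R. arctan ((R - a) / b) - arctan ((- R - a) / b)) \<longlongrightarrow> - pi) at_top"
      by real_asymp
    then show ?thesis using \<open>b < 0\<close> by simp
  qed
  have "((\<lambda>R. of_real (ln ((R - a)\<^sup>2 + b\<^sup>2) / 2 - ln ((- R - a)\<^sup>2 + b\<^sup>2) / 2)
      + \<i> * of_real (arctan ((R - a) / b) - arctan ((- R - a) / b)))
      \<longlongrightarrow> of_real 0 + \<i> * of_real (sgn b * pi)) at_top"
    by (intro tendsto_intros 1 2)
  then show ?thesis
  proof (rule tendsto_cong[THEN iffD1, rotated, THEN tendsto_eq_rhs])
    show "\<forall>\<^sub>F R in at_top. of_real (ln ((R - a)\<^sup>2 + b\<^sup>2) / 2 - ln ((- R - a)\<^sup>2 + b\<^sup>2) / 2)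
      + \<i> * of_real (arctan ((R - a) / b) - arctan ((- R - a) / b)) = (LINT x:{-R..R}|lborel. kern l x)"
      using eventually_ge_at_top[of 0]
      by eventually_elim (simp add: kern_set_LINT[OF assms] a_def b_def algebra_simps)
  qed (simp add: b_def mult.commute)
qed

text \<open>By partial fractions \<open>l - m\<close> times the product is the difference of the
  kernels. That difference is absolutely integrable while each kernel has only a principal value, so
  the two principal values are subtracted.\<close>

lemma LINT_kern_mult_kern:
  assumes "Im l \<noteq> 0" "Im m \<noteq> 0"
  shows "(l - m) * (LINT x|lborel. kern l x * kern m x) =
    of_real ((sgn (Im l) - sgn (Im m)) * pi) * \<i>"
proof -
  have "integrable lborel (\<lambda>x. (l - m) * (kern l x * kern m x))"
    using assms by (intro integrable_mult_right square_integrable_mult) auto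
  then have i: "integrable lborel (\<lambda>x. kern l x - kern m x)"
    by (simp add: kern_diff assms)
  have "((\<lambda>R. LINT x:{-R..R}|lborel. kern l x - kern m x) \<longlongrightarrow> (LINT x|lborel. kern l x - kern m x)) at_top"
    by (rule set_LINT_symmetric_tendsto[OF i])
  moreover have "((\<lambda>R. LINT x:{-R..R}|lborel. kern l x - kern m x)
      \<longlongrightarrow> of_real (sgn (Im l) * pi) * \<i> - of_real (sgn (Im m) * pi) * \<i>) at_top"
  proof (rule tendsto_cong[THEN iffD1])
    show "((\<lambda>R. (LINT x:{-R..R}|lborel. kern l x) - (LINT x:{-R..R}|lborel. kern m x))
      \<longlongrightarrow> of_real (sgn (Im l) * pi) * \<i> - of_real (sgn (Im m) * pi) * \<i>) at_top"
      by (intro tendsto_diff kern_symmetric_tendsto assms)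
    show "\<forall>\<^sub>F R in at_top. (LINT x:{-R..R}|lborel. kern l x) - (LINT x:{-R..R}|lborel. kern m x)
        = (LINT x:{-R..R}|lborel. kern l x - kern m x)"
      using eventually_ge_at_top[of 0]
      by eventually_elim (simp add: set_integral_diff kern_set_LINT assms)
  qed
  ultimately have "(LINT x|lborel. kern l x - kern m x) =
      of_real (sgn (Im l) * pi) * \<i> - of_real (sgn (Im m) * pi) * \<i>"
    using tendsto_unique trivial_limit_at_top_linorder by blast
  moreover have "(LINT x|lborel. kern l x - kern m x) = (l - m) * (LINT x|lborel. kern l x * kern m x)"
    by (simp add: kern_diff assms)
  ultimately show ?thesis by (simp add: algebra_simps)
qed

text \<open>There is no factor \<open>1 / (2 \<pi> \<i>)\<close>, so boundary values of a Hardy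
  function are sent to \<open>2 \<pi> \<i>\<close> times that function. The argument is a plain
  function, since products of two square-integrable functions are transformed as well.\<close>

definition cauchy :: "(real \<Rightarrow> complex) \<Rightarrow> complex \<Rightarrow> complex" where
  "cauchy f l = (LINT x|lborel. f x * kern l x)"

lemma cauchy_cong_AE:
  assumes "f \<in> square_integrable" "g \<in> square_integrable" "AE x in lborel. f x = g x"
  shows "cauchy f l = cauchy g l"
  unfolding cauchy_def using assms
  by (intro integral_cong_AE) (auto simp: square_integrable_measurable)

lemma cauchy_cnj: "cauchy (\<lambda>x. cnj (f x)) l = cnj (cauchy f (cnj l))"
proof -
  have "cauchy (\<lambda>x. cnj (f x)) l = (LINT x|lborel. cnj (f x * kern (cnj l) x))"
    unfolding cauchy_def by (rule Bochner_Integration.integral_cong) (simp_all add: kern_cnj)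
  also have "\<dots> = cnj (cauchy f (cnj l))"
    unfolding cauchy_def by (rule Bochner_Integration.integral_cnj)
  finally show ?thesis .
qed

lemma cauchy_bound:
  assumes "f \<in> square_integrable" "Im l \<noteq> 0"
  shows "cmod (cauchy f l) \<le> norm (abs_L2 f) * sqrt (pi / \<bar>Im l\<bar>)"
  using Cauchy_Schwarz_LINT[OF assms(1) kern_square_integrable[OF assms(2)]]
  by (simp add: cauchy_def kern_LINT assms norm_abs_L2)

lemma cauchy_mult_kern:
  assumes f: "f \<in> square_integrable" and l: "Im l \<noteq> 0" "Im m \<noteq> 0"
  shows "(l - m) * cauchy (\<lambda>x. f x * kern l x) m = cauchy f l - cauchy f m"
proof -
  have "cauchy f l - cauchy f m = (LINT x|lborel. f x * kern l x - f x * kern m x)"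
    unfolding cauchy_def using f l by (intro Bochner_Integration.integral_diff[symmetric]) auto
  also have "\<dots> = (LINT x|lborel. (l - m) * (f x * kern l x * kern m x))"
    by (rule Bochner_Integration.integral_cong) (simp_all add: kern_diff[OF l] algebra_simps flip: right_diff_distrib)
  also have "\<dots> = (l - m) * cauchy (\<lambda>x. f x * kern l x) m"
    by (simp add: cauchy_def)
  finally show ?thesis by simp
qed

text \<open>By partial fractions the difference quotient at \<open>m\<close> is exactly the
  transform of \<open>f x * kern l x\<close> at \<open>m\<close>. So only continuity of that
  transform at \<open>l\<close> is required, and the same identity used once more gives a Lipschitz
  bound.\<close>

lemma cauchy_has_field_derivative:
  assumes f: "f \<in> square_integrable" and l: "Im l \<noteq> 0"
  shows "(cauchy f has_field_derivative cauchy (\<lambda>x. f x * kern l x) l) (at l)"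
proof -
  let ?g = "\<lambda>x. f x * kern l x"
  have g: "?g \<in> square_integrable" using f l by blast
  \<comment> \<open>Keeps \<open>m\<close> away from the real axis, so that the norm of
    \<open>kern m\<close> stays bounded.\<close>
  have ev: "\<forall>\<^sub>F m in at l. m \<noteq> l \<and> \<bar>Im l\<bar> / 2 < \<bar>Im m\<bar>"
  proof -
    have "((\<lambda>m. \<bar>Im m\<bar>) \<longlongrightarrow> \<bar>Im l\<bar>) (at l)" by (intro tendsto_intros)
    moreover have "\<bar>Im l\<bar> / 2 < \<bar>Im l\<bar>" using l by simp
    ultimately have "\<forall>\<^sub>F m in at l. \<bar>Im l\<bar> / 2 < \<bar>Im m\<bar>" by (rule order_tendstoD)
    then show ?thesis using eventually_neq_at_within[of l l UNIV] by eventually_elim simp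
  qed
  have bd: "\<forall>\<^sub>F m in at l. cmod (cauchy ?g m - cauchy ?g l) \<le>
      cmod (m - l) * (norm (abs_L2 (\<lambda>x. ?g x * kern l x)) * sqrt (pi / (\<bar>Im l\<bar> / 2)))"
    using ev
  proof eventually_elim
    case (elim m)
    have m: "Im m \<noteq> 0" using elim l by auto
    have gk: "(\<lambda>x. ?g x * kern l x) \<in> square_integrable" using g l by (rule mult_kern_square_integrable)
    have "cauchy ?g m - cauchy ?g l = (m - l) * cauchy (\<lambda>x. ?g x * kern l x) m"
      using cauchy_mult_kern[OF g l m] by (simp add: algebra_simps)
    moreover have "cmod (cauchy (\<lambda>x. ?g x * kern l x) m) \<le>
        norm (abs_L2 (\<lambda>x. ?g x * kern l x)) * sqrt (pi / \<bar>Im m\<bar>)"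
      by (rule cauchy_bound[OF gk m])
    moreover have "sqrt (pi / \<bar>Im m\<bar>) \<le> sqrt (pi / (\<bar>Im l\<bar> / 2))"
      using elim l by (intro real_sqrt_le_mono divide_left_mono) auto
    ultimately show ?case
      by (auto simp: norm_mult intro!: mult_left_mono elim!: order_trans)
  qed
  have "(cauchy ?g \<longlongrightarrow> cauchy ?g l) (at l)"
  proof (rule LIM_zero_cancel, rule Lim_null_comparison[OF bd])
    show "((\<lambda>m. cmod (m - l) * (norm (abs_L2 (\<lambda>x. ?g x * kern l x)) * sqrt (pi / (\<bar>Im l\<bar> / 2)))) \<longlongrightarrow> 0) (at l)"
      by (auto intro!: tendsto_eq_intros)
  qed
  then have "((\<lambda>m. (cauchy f m - cauchy f l) / (m - l)) \<longlongrightarrow> cauchy ?g l) (at l)"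
  proof (rule tendsto_cong[THEN iffD1, rotated])
    show "\<forall>\<^sub>F m in at l. cauchy ?g m = (cauchy f m - cauchy f l) / (m - l)"
      using ev
    proof eventually_elim
      case (elim m)
      then have "Im m \<noteq> 0" using l by auto
      with cauchy_mult_kern[OF f l this] elim show ?case
        by (simp add: field_simps)
    qed
  qed
  then show ?thesis by (simp add: has_field_derivative_iff)
qed

lemma cauchy_holomorphic:
  assumes "f \<in> square_integrable" "\<And>z. z \<in> S \<Longrightarrow> Im z \<noteq> 0"
  shows "cauchy f holomorphic_on S"
  using cauchy_has_field_derivative[OF assms(1)] assms(2)
  by (auto simp: holomorphic_on_def field_differentiable_def intro: has_field_derivative_at_within)

section \<open>Boundary values of Hardy functions\<close>

lemma norm_abs_L2_sq: "f \<in> square_integrable \<Longrightarrow> (norm (abs_L2 f))\<^sup>2 = (LINT x|lborel. (cmod (f x))\<^sup>2)"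
  by (simp add: norm_abs_L2 integral_nonneg_AE)

text \<open>The levels of a Hardy function have bounded norms and converge almost everywhere, but
  come with no common majorant. Off the exhausting sets, Cauchy-Schwarz leaves the bound
  \<open>M\<close> times the norm of a remainder of \<open>g\<close>, and that remainder tends to
  zero.\<close>

lemma weakly_convergent_of_bounded_AE:
  assumes F: "\<And>n. F n \<in> square_integrable" "\<And>n. norm (abs_L2 (F n)) \<le> C"
    and h: "h \<in> square_integrable" and g: "g \<in> square_integrable"
    and lim: "AE x in lborel. (\<lambda>n. F n x) \<longlonglongrightarrow> h x"
  shows "(\<lambda>n::nat. LINT x|lborel. F n x * g x) \<longlonglongrightarrow> (LINT x|lborel. h x * g x)"
proof -
  note [measurable] = F(1)[THEN square_integrable_measurable] h[THEN square_integrable_measurable]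
    g[THEN square_integrable_measurable]
  define D where "D n x = F n x - h x" for n x
  have D: "D n \<in> square_integrable" for n
    unfolding D_def by (intro square_integrable_diff F h)
  have [measurable]: "D n \<in> borel_measurable borel" for n
    using D by (rule square_integrable_measurable)
  have Dlim: "AE x in lborel. (\<lambda>n. D n x) \<longlonglongrightarrow> 0"
    using lim by eventually_elim (simp add: D_def LIM_zero)
  define M where "M = C + norm (abs_L2 h)"
  have DM: "norm (abs_L2 (D n)) \<le> M" for n
  proof -
    have "abs_L2 (D n) = abs_L2 (F n) - abs_L2 h"
    proof (rule abs_L2_eqI[OF D])
      show "AE x in lborel. D n x = rep_L2 (abs_L2 (F n) - abs_L2 h) x"
        using rep_diff[of "abs_L2 (F n)" "abs_L2 h"] rep_abs_L2[OF F(1)[of n]] rep_abs_L2[OF h]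
        by eventually_elim (simp add: D_def)
    qed
    then show ?thesis
      using norm_triangle_ineq4[of "abs_L2 (F n)" "abs_L2 h"] F(2)[of n] by (simp add: M_def)
  qed
  have M0: "0 \<le> M" using DM[of 0] norm_ge_zero order_trans by blast
  \<comment> \<open>\<open>\<bar>g\<bar>\<close> itself serves as the dominating function for \<open>D n\<close>, on sets exhausting the line\<close>
  define E where "E N = {x. \<forall>n\<ge>N. cmod (D n x) \<le> cmod (g x)}" for N
  have E [measurable]: "E N \<in> sets borel" for N
    unfolding E_def by measurable
  define G where "G N x = indicator (- E N) x * g x" for N x
  have G: "G N \<in> square_integrable" for N
    unfolding G_def by (intro square_integrable_indicator g) auto
  have Glim: "(\<lambda>N. norm (abs_L2 (G N))) \<longlonglongrightarrow> 0"
  proof -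
    have "(\<lambda>N. LINT x|lborel. (cmod (G N x))\<^sup>2) \<longlonglongrightarrow> (LINT x::real|lborel. 0::real)"
    proof (rule Bochner_Integration.integral_dominated_convergence)
      show "integrable lborel (\<lambda>x. (cmod (g x))\<^sup>2)" by (rule square_integrable_norm_sq[OF g])
      show "AE x in lborel. (\<lambda>N. (cmod (G N x))\<^sup>2) \<longlonglongrightarrow> 0"
        using Dlim
      proof eventually_elim
        case (elim x)
        have "\<exists>N0. \<forall>N\<ge>N0. G N x = 0"
        \<comment> \<open>A zero of \<open>g\<close> may lie outside every \<open>E N\<close>, but
          \<open>G N\<close> vanishes there anyway.\<close>
        proof (cases "g x = 0")
          case False
          then have "0 < cmod (g x)" by simp
          with elim obtain N0 where N0: "\<And>n. n \<ge> N0 \<Longrightarrow> cmod (D n x) < cmod (g x)"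
            by (metis LIMSEQ_iff diff_zero)
          have "x \<in> E N" if "N \<ge> N0" for N
            unfolding E_def using N0 that by (auto intro!: less_imp_le)
          then have "\<forall>N\<ge>N0. G N x = 0" by (simp add: G_def)
          then show ?thesis by blast
        qed (simp add: G_def)
        then show ?case
          by (intro tendsto_eventually) (auto simp: eventually_sequentially)
      qed
      show "AE x in lborel. norm ((cmod (G N x))\<^sup>2) \<le> (cmod (g x))\<^sup>2" for N
        by (rule AE_I2) (auto simp: G_def indicator_def)
      show "(\<lambda>x. (cmod (G N x))\<^sup>2) \<in> borel_measurable lborel" for N
        using G[of N] by measurable
    qed auto
    then have "(\<lambda>N. sqrt (LINT x|lborel. (cmod (G N x))\<^sup>2)) \<longlonglongrightarrow> sqrt 0"
      by (intro tendsto_real_sqrt) simp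
    then show ?thesis by (simp add: norm_abs_L2[OF G])
  qed
  have inner: "(\<lambda>n. LINT x|lborel. D n x * (indicator (E N) x * g x)) \<longlonglongrightarrow> 0" for N
  proof -
    \<comment> \<open>On \<open>E N\<close> the domination holds only from index \<open>N\<close>
      on, hence the shift.\<close>
    have "(\<lambda>n. LINT x|lborel. D (n + N) x * (indicator (E N) x * g x)) \<longlonglongrightarrow> (LINT x::real|lborel. (0::complex))"
    proof (rule Bochner_Integration.integral_dominated_convergence)
      show "integrable lborel (\<lambda>x. (cmod (g x))\<^sup>2)" by (rule square_integrable_norm_sq[OF g])
      show "AE x in lborel. (\<lambda>n. D (n + N) x * (indicator (E N) x * g x)) \<longlonglongrightarrow> 0"
        using Dlim
      proof eventually_elim
        case (elim x)
        then have "(\<lambda>n. D (n + N) x) \<longlonglongrightarrow> 0" by (rule LIMSEQ_ignore_initial_segment)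
        then show ?case by (rule tendsto_mult_left_zero)
      qed
      show "AE x in lborel. norm (D (n + N) x * (indicator (E N) x * g x)) \<le> (cmod (g x))\<^sup>2" for n
        by (rule AE_I2) (auto simp: E_def indicator_def norm_mult power2_eq_square intro!: mult_right_mono)
    qed measurable
    then show ?thesis by (simp add: LIMSEQ_offset)
  qed
  have "(\<lambda>n. LINT x|lborel. D n x * g x) \<longlonglongrightarrow> 0"
  proof (rule LIMSEQ_I)
    fix r :: real assume "0 < r"
    have "(\<lambda>N. M * norm (abs_L2 (G N))) \<longlonglongrightarrow> M * 0" by (intro tendsto_intros Glim)
    with \<open>0 < r\<close> have "\<forall>\<^sub>F N in sequentially. M * norm (abs_L2 (G N)) < r / 2"
      by (intro order_tendstoD) auto
    then obtain N where N: "M * norm (abs_L2 (G N)) < r / 2"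
      using eventually_happens' sequentially_bot by blast
    obtain n0 where n0: "\<And>n. n \<ge> n0 \<Longrightarrow> cmod (LINT x|lborel. D n x * (indicator (E N) x * g x)) < r / 2"
      using LIMSEQ_D[OF inner[of N], of "r / 2"] \<open>0 < r\<close> by auto
    have "cmod (LINT x|lborel. D n x * g x) < r" if "n \<ge> n0" for n
    proof -
      have "(LINT x|lborel. D n x * g x) =
          (LINT x|lborel. D n x * (indicator (E N) x * g x) + D n x * G N x)"
        by (rule Bochner_Integration.integral_cong) (auto simp: G_def indicator_def)
      also have "\<dots> = (LINT x|lborel. D n x * (indicator (E N) x * g x)) + (LINT x|lborel. D n x * G N x)"
        by (intro Bochner_Integration.integral_add square_integrable_mult D G square_integrable_indicator g E)
      finally have "cmod (LINT x|lborel. D n x * g x) \<le>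
          cmod (LINT x|lborel. D n x * (indicator (E N) x * g x)) + cmod (LINT x|lborel. D n x * G N x)"
        by (simp add: norm_triangle_ineq)
      moreover have "cmod (LINT x|lborel. D n x * G N x) \<le> M * norm (abs_L2 (G N))"
        using Cauchy_Schwarz_LINT[OF D[of n] G[of N]] mult_right_mono[OF DM[of n], of "norm (abs_L2 (G N))"]
        by (simp add: norm_abs_L2[OF D] norm_abs_L2[OF G] integral_nonneg_AE)
      ultimately show ?thesis using n0[OF that] N by linarith
    qed
    then show "\<exists>n0. \<forall>n\<ge>n0. norm ((LINT x|lborel. D n x * g x) - 0) < r" by auto
  qed
  moreover have "(LINT x|lborel. D n x * g x) = (LINT x|lborel. F n x * g x) - (LINT x|lborel. h x * g x)" for n
    unfolding D_def left_diff_distrib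
    by (intro Bochner_Integration.integral_diff square_integrable_mult F h g)
  ultimately show ?thesis by (simp add: LIM_zero_iff)
qed

section \<open>Contour integrals over rectangles as Lebesgue integrals\<close>

lemma has_contour_integral_linepath_same_Im_iff:
  assumes "Im z = c" "Im z' = c" "Re z = a" "Re z' = b" "a < b"
  shows "(f has_contour_integral I) (linepath z z') \<longleftrightarrow> ((\<lambda>x. f (Complex x c)) has_integral I) {a..b}"
proof -
  have "linepath z z' = (+) (Complex 0 c) \<circ> linepath (of_real a) (of_real b)"
    using assms by (auto simp: fun_eq_iff linepath_def complex_eq_iff algebra_simps)
  then have "(f has_contour_integral I) (linepath z z') \<longleftrightarrow>
      ((\<lambda>x. f (x + Complex 0 c)) has_contour_integral I) (linepath (of_real a) (of_real b))"
    by (simp only: has_contour_integral_translate)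
  also have "\<dots> \<longleftrightarrow> ((\<lambda>x. f (Complex x c)) has_integral I) {a..b}"
    using assms by (subst has_contour_integral_linepath_Reals_iff) (auto simp: Complex_eq)
  finally show ?thesis .
qed

lemma contour_integral_rectpath_eq:
  assumes f: "continuous_on (path_image (rectpath (Complex a c) (Complex b d))) f" and ab: "a < b" "c < d"
    and I: "(f has_contour_integral I) (rectpath (Complex a c) (Complex b d))"
  shows "I = (LINT x:{a..b}|lborel. f (Complex x c)) - (LINT x:{a..b}|lborel. f (Complex x d))
    + \<i> * ((LINT s:{c..d}|lborel. f (Complex b s)) - (LINT s:{c..d}|lborel. f (Complex a s)))"
proof -
  note cont = f[unfolded path_image_rectpath[of "Complex a c" "Complex b d", simplified, OF less_imp_le[OF ab(1)] less_imp_le[OF ab(2)]]]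
  have h: "((\<lambda>x. f (Complex x y)) has_integral (LINT x:{a..b}|lborel. f (Complex x y))) {a..b}"
    if "y = c \<or> y = d" for y
  proof -
    have "continuous_on {a..b} (\<lambda>x. f (Complex x y))"
      by (rule continuous_on_compose2[OF cont])
        (use that in \<open>auto simp: Complex_eq intro!: continuous_intros\<close>)
    then have "set_integrable lborel {a..b} (\<lambda>x. f (Complex x y))"
      by (rule borel_integrable_atLeastAtMost'[simplified])
    then show ?thesis by (metis set_borel_integral_eq_integral integrable_integral)
  qed
  have v: "((\<lambda>s. f (Complex x s)) has_integral (LINT s:{c..d}|lborel. f (Complex x s))) {c..d}"
    if "x = a \<or> x = b" for x
  proof -
    have "continuous_on {c..d} (\<lambda>s. f (Complex x s))"
      by (rule continuous_on_compose2[OF cont])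
        (use that in \<open>auto simp: Complex_eq intro!: continuous_intros\<close>)
    then have "set_integrable lborel {c..d} (\<lambda>s. f (Complex x s))"
      by (rule borel_integrable_atLeastAtMost'[simplified])
    then show ?thesis by (metis set_borel_integral_eq_integral integrable_integral)
  qed
  have 1: "(f has_contour_integral (LINT x:{a..b}|lborel. f (Complex x c))) (linepath (Complex a c) (Complex b c))"
    using h[of c] ab by (subst has_contour_integral_linepath_same_Im_iff) auto
  have "(f has_contour_integral (LINT x:{a..b}|lborel. f (Complex x d))) (linepath (Complex a d) (Complex b d))"
    using h[of d] ab by (subst has_contour_integral_linepath_same_Im_iff) auto
  then have 3: "(f has_contour_integral - (LINT x:{a..b}|lborel. f (Complex x d))) (linepath (Complex b d) (Complex a d))"
    using has_contour_integral_reversepath by fastforce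
  have 2: "(f has_contour_integral (\<i> * (LINT s:{c..d}|lborel. f (Complex b s)))) (linepath (Complex b c) (Complex b d))"
    using v[of b] ab by (subst has_contour_integral_linepath_same_Re_iff) auto
  have "(f has_contour_integral (\<i> * (LINT s:{c..d}|lborel. f (Complex a s)))) (linepath (Complex a c) (Complex a d))"
    using v[of a] ab by (subst has_contour_integral_linepath_same_Re_iff) auto
  then have 4: "(f has_contour_integral - (\<i> * (LINT s:{c..d}|lborel. f (Complex a s)))) (linepath (Complex a d) (Complex a c))"
    using has_contour_integral_reversepath by fastforce
  have "(f has_contour_integral ((LINT x:{a..b}|lborel. f (Complex x c)) + (\<i> * (LINT s:{c..d}|lborel. f (Complex b s)) +
      (- (LINT x:{a..b}|lborel. f (Complex x d)) + - (\<i> * (LINT s:{c..d}|lborel. f (Complex a s)))))))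
      (rectpath (Complex a c) (Complex b d))"
    unfolding rectpath_def Let_def complex.sel
    by (intro has_contour_integral_join 1 2 3 4) (auto intro!: valid_path_join)
  from has_contour_integral_unique[OF I this] show ?thesis by (simp add: algebra_simps)
qed

section \<open>Cauchy's formula for a function of the Hardy class, on levels and on the real
  line\<close>

locale hardy_function =
  fixes F :: "complex \<Rightarrow> complex" and C :: real
  assumes hol: "F holomorphic_on {z. Im z > 0}"
    and square_integrable: "y > 0 \<Longrightarrow> (\<lambda>x. F (Complex x y)) \<in> square_integrable"
    and norm_le: "y > 0 \<Longrightarrow> norm (abs_L2 (\<lambda>x. F (Complex x y))) \<le> C"
begin

text \<open>
  Makes the vertical sides of a rectangle contour tend to zero along a sequence, so that no pointwise
  bound on \<open>F\<close> is needed.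
\<close>

lemma vertical_integrals_finite:
  fixes l :: complex
  assumes "0 < y" "y < Y"
  defines "A \<equiv> {p. \<bar>Re l\<bar> + 1 \<le> \<bar>fst p\<bar> \<and> y \<le> snd p \<and> snd p \<le> Y}"
  defines "g \<equiv> \<lambda>p. indicator A p *\<^sub>R (F (Complex (fst p) (snd p)) / (Complex (fst p) (snd p) - l))"
  shows "(\<integral>\<^sup>+x. (\<integral>\<^sup>+s. ennreal (cmod (g (x, s))) \<partial>lborel) \<partial>lborel) < \<infinity>"
    and "g \<in> borel_measurable borel"
proof -
  \<comment> \<open>A comparison point that does not depend on the height: on \<open>A\<close> the
    distance from \<open>x\<close> to \<open>Re l\<close> is at least \<open>1\<close>, so
    \<open>cmod (of_real x - m)\<close> is at most twice
    \<open>cmod (Complex x s - l)\<close>.\<close>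
  define m where "m = Complex (Re l) 1"
  have m: "Im m \<noteq> 0" by (simp add: m_def)
  have A: "closed A"
    unfolding A_def by (intro closed_Collect_conj closed_Collect_le continuous_intros)
  show g [measurable]: "g \<in> borel_measurable borel"
    unfolding g_def
  proof (rule borel_measurable_continuous_on_indicator)
    show "A \<in> sets borel" using A by simp
    show "continuous_on A (\<lambda>p. F (Complex (fst p) (snd p)) / (Complex (fst p) (snd p) - l))"
    proof (intro continuous_on_divide continuous_on_diff continuous_on_const)
      show "continuous_on A (\<lambda>p. F (Complex (fst p) (snd p)))"
        by (rule continuous_on_compose2[OF holomorphic_on_imp_continuous_on[OF hol]])
          (use assms in \<open>auto simp: A_def Complex_eq intro!: continuous_intros\<close>)
      show "continuous_on A (\<lambda>p. Complex (fst p) (snd p))"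
        by (auto simp: Complex_eq intro!: continuous_intros)
      show "\<forall>p\<in>A. Complex (fst p) (snd p) - l \<noteq> 0"
        by (auto simp: A_def complex_eq_iff)
    qed
  qed
  have bd: "cmod (g (x, s)) \<le> indicator {y..Y} s * (2 * cmod (F (Complex x s) * kern m x))" for x s
  proof (cases "(x, s) \<in> A")
    case True
    then have x: "1 \<le> \<bar>x - Re l\<bar>" by (auto simp: A_def)
    then have nz: "of_real x - m \<noteq> 0" "Complex x s - l \<noteq> 0" by (auto simp: m_def complex_eq_iff)
    have "cmod (of_real x - m) \<le> \<bar>Re (of_real x - m)\<bar> + \<bar>Im (of_real x - m)\<bar>"
      by (rule cmod_le)
    also have "\<dots> \<le> 2 * \<bar>Re (Complex x s - l)\<bar>" using x by (simp add: m_def)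
    also have "\<dots> \<le> 2 * cmod (Complex x s - l)" using abs_Re_le_cmod[of "Complex x s - l"] by simp
    finally have "1 / cmod (Complex x s - l) \<le> 2 * (1 / cmod (of_real x - m))"
      using nz by (simp add: divide_simps)
    then have "cmod (F (Complex x s)) * (1 / cmod (Complex x s - l)) \<le>
        cmod (F (Complex x s)) * (2 * (1 / cmod (of_real x - m)))"
      by (rule mult_left_mono) simp
    moreover have "s \<in> {y..Y}" using True by (simp add: A_def)
    ultimately show ?thesis using True by (simp add: g_def kern_def norm_mult norm_divide mult.commute)
  qed (simp add: g_def)
  have inner: "(\<integral>\<^sup>+x. ennreal (cmod (g (x, s))) \<partial>lborel) \<le>
      ennreal (2 * (C * norm (abs_L2 (kern m)))) * indicator {y..Y} s" for s
  proof (cases "s \<in> {y..Y}")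
    case True
    then have s: "s > 0" using assms by simp
    note F = square_integrable[OF s]
    have i: "integrable lborel (\<lambda>x. F (Complex x s) * kern m x)"
      using F m by (rule mult_kern_integrable)
    have "(\<integral>\<^sup>+x. ennreal (cmod (g (x, s))) \<partial>lborel) \<le>
        (\<integral>\<^sup>+x. ennreal (2 * cmod (F (Complex x s) * kern m x)) \<partial>lborel)"
      using bd[of _ s] True by (intro nn_integral_mono ennreal_leI) auto
    also have "\<dots> = ennreal (LINT x|lborel. 2 * cmod (F (Complex x s) * kern m x))"
      using i by (intro nn_integral_eq_integral) auto
    also have "\<dots> \<le> ennreal (2 * (norm (abs_L2 (\<lambda>x. F (Complex x s))) * norm (abs_L2 (kern m))))"
      using Cauchy_Schwarz_LINT_norm[OF F kern_square_integrable[OF m]]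
      by (intro ennreal_leI) (simp add: norm_abs_L2[OF F] norm_abs_L2[OF kern_square_integrable[OF m]])
    also have "\<dots> \<le> ennreal (2 * (C * norm (abs_L2 (kern m))))"
      using norm_le[OF s] by (intro ennreal_leI mult_left_mono mult_right_mono) auto
    finally show ?thesis using True by simp
  next
    case False
    then have "cmod (g (x, s)) = 0" for x by (auto simp: g_def A_def)
    then show ?thesis by (simp add: False)
  qed
  \<comment> \<open>Cauchy-Schwarz works along horizontal lines, whereas the claim integrates over
    vertical segments first; Tonelli exchanges the two.\<close>
  have "(\<lambda>p. ennreal (cmod (g p))) \<in> borel_measurable (lborel \<Otimes>\<^sub>M lborel)"
    unfolding lborel_prod by measurable
  then have "(\<integral>\<^sup>+x. (\<integral>\<^sup>+s. ennreal (cmod (g (x, s))) \<partial>lborel) \<partial>lborel) =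
      (\<integral>\<^sup>+s. (\<integral>\<^sup>+x. ennreal (cmod (g (x, s))) \<partial>lborel) \<partial>lborel)"
    by (rule lborel_pair.Fubini[symmetric])
  also have "\<dots> \<le> (\<integral>\<^sup>+s. ennreal (2 * (C * norm (abs_L2 (kern m)))) * indicator {y..Y} s \<partial>lborel)"
    by (intro nn_integral_mono inner)
  also have "\<dots> = ennreal (2 * (C * norm (abs_L2 (kern m)))) * ennreal (Y - y)"
    using assms by (simp add: nn_integral_cmult_indicator)
  also have "\<dots> < \<infinity>" by (simp add: ennreal_mult_less_top)
  finally show "(\<integral>\<^sup>+x. (\<integral>\<^sup>+s. ennreal (cmod (g (x, s))) \<partial>lborel) \<partial>lborel) < \<infinity>" .
qed

text \<open>Cauchy's theorem on rectangles of growing width. The horizontal sides converge, so the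
  vertical contribution \<open>V R\<close> has some limit \<open>L\<close>. Its modulus is bounded
  by a function of \<open>R\<close> with finite integral, which is incompatible with
  \<open>L \<noteq> 0\<close>. The arguments are shifted because at height \<open>s\<close> the
  Cauchy kernel for \<open>l\<close> is the real-line kernel for \<open>l - \<i> s\<close>.\<close>

lemma cauchy_strip:
  assumes y: "0 < y" "y < Y" and l: "Im l \<noteq> y" "Im l < Y"
  shows "cauchy (\<lambda>x. F (Complex x y)) (l - \<i> * of_real y) - cauchy (\<lambda>x. F (Complex x Y)) (l - \<i> * of_real Y)
    = (if Im l > y then 2 * of_real pi * \<i> * F l else 0)" (is "?Iy - ?IY = ?c")
proof -
  define f where "f z = F z / (z - l)" for z
  define R0 where "R0 = \<bar>Re l\<bar> + 1"
  have R0: "R0 > 0" by (simp add: R0_def)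
  have fk: "f (Complex x s) = F (Complex x s) * kern (l - \<i> * of_real s) x" for x s
    by (simp add: f_def kern_def Complex_eq algebra_simps)
  have fcont: "continuous_on S f" if "S \<subseteq> {z. Im z > 0} - {l}" for S
    unfolding f_def
    by (intro continuous_intros holomorphic_on_imp_continuous_on[OF holomorphic_on_subset[OF hol]])
      (use that in auto)
  have sub: "path_image (rectpath (Complex (- R) y) (Complex R Y)) \<subseteq> {z. Im z > 0} - {l}" if "R \<ge> R0" for R
    using that y l R0 by (subst path_image_rectpath) (auto simp: R0_def)
  define V where "V R = \<i> * ((LINT s:{y..Y}|lborel. f (Complex R s)) - (LINT s:{y..Y}|lborel. f (Complex (- R) s)))" for R
  have rect: "?c = (LINT x:{-R..R}|lborel. f (Complex x y)) - (LINT x:{-R..R}|lborel. f (Complex x Y)) + V R"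
    if R: "R \<ge> R0" for R
    unfolding V_def
  proof (rule contour_integral_rectpath_eq)
    show "continuous_on (path_image (rectpath (Complex (- R) y) (Complex R Y))) f"
      by (rule fcont[OF sub[OF R]])
    show "- R < R" "y < Y" using R R0 y by auto
    show "(f has_contour_integral ?c) (rectpath (Complex (- R) y) (Complex R Y))"
    proof (cases "Im l > y")
      case True
      have cv: "convex {z. Im z > 0}" by (rule convex_halfspace_Im_gt)
      have op: "open {z. Im z > 0}" by (rule open_halfspace_Im_gt)
      have "winding_number (rectpath (Complex (- R) y) (Complex R Y)) l = 1"
        using True l R by (intro winding_number_rectpath) (auto simp: in_box_complex_iff R0_def)
      moreover have "((\<lambda>w. F w / (w - l)) has_contour_integral
          (2 * pi * \<i> * winding_number (rectpath (Complex (- R) y) (Complex R Y)) l * F l))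
          (rectpath (Complex (- R) y) (Complex R Y))"
        by (rule Cauchy_integral_formula_convex_simple[OF cv hol])
          (use True y sub[OF R] in \<open>auto simp: interior_open[OF op]\<close>)
      ultimately show ?thesis using True by (simp add: f_def[abs_def])
    next
      case False
      \<comment> \<open>A convex region that contains the rectangle and avoids the pole
        \<open>l\<close>, which lies below the rectangle in this case.\<close>
      define S where "S = {z. Im z > 0} \<inter> {z. Im z > Im l}"
      have "convex S" unfolding S_def by (intro convex_Int convex_halfspace_Im_gt)
      have "f holomorphic_on S"
        unfolding f_def S_def
        by (intro holomorphic_intros holomorphic_on_subset[OF hol]) auto
      have "(f has_contour_integral 0) (rectpath (Complex (- R) y) (Complex R Y))"
        by (rule Cauchy_theorem_convex_simple[OF \<open>f holomorphic_on S\<close> \<open>convex S\<close>])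
          (use False y l R R0 in \<open>auto simp: S_def path_image_rectpath\<close>)
      then show ?thesis using False by simp
    qed
  qed
  have Ilim: "((\<lambda>R. LINT x:{-R..R}|lborel. f (Complex x s)) \<longlongrightarrow> cauchy (\<lambda>x. F (Complex x s)) (l - \<i> * of_real s)) at_top"
    if "s > 0" "Im l \<noteq> s" for s
    unfolding cauchy_def fk
    by (rule set_LINT_symmetric_tendsto) (use square_integrable[OF that(1)] that(2) in auto)
  define L where "L = ?c - (?Iy - ?IY)"
  have Vlim: "(V \<longlongrightarrow> L) at_top"
  proof (rule tendsto_cong[THEN iffD1])
    show "((\<lambda>R. ?c - ((LINT x:{-R..R}|lborel. f (Complex x y)) - (LINT x:{-R..R}|lborel. f (Complex x Y)))) \<longlongrightarrow> L) at_top"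
      unfolding L_def using y l by (intro tendsto_intros Ilim) auto
    show "\<forall>\<^sub>F R in at_top. ?c - ((LINT x:{-R..R}|lborel. f (Complex x y)) - (LINT x:{-R..R}|lborel. f (Complex x Y))) = V R"
      using eventually_ge_at_top[of R0]
    proof eventually_elim
      case (elim R)
      show ?case unfolding rect[OF elim] by simp
    qed
  qed
  define A where "A = {p. \<bar>Re l\<bar> + 1 \<le> \<bar>fst p\<bar> \<and> y \<le> snd p \<and> snd p \<le> Y}"
  define g where "g = (\<lambda>p. indicator A p *\<^sub>R (F (Complex (fst p) (snd p)) / (Complex (fst p) (snd p) - l)))"
  define k where "k x = (\<integral>\<^sup>+s. ennreal (cmod (g (x, s))) \<partial>lborel)" for x
  have kfin: "(\<integral>\<^sup>+x. k x \<partial>lborel) < \<infinity>" and g [measurable]: "g \<in> borel_measurable borel"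
    unfolding k_def g_def A_def using vertical_integrals_finite[OF y, of l] by simp_all
  have [measurable]: "g \<in> borel_measurable (borel \<Otimes>\<^sub>M borel)"
    using g by (simp add: borel_prod)
  have k [measurable]: "k \<in> borel_measurable borel"
    unfolding k_def by measurable
  have Vk: "ennreal (cmod (V R)) \<le> k R + k (- R)" if R: "R \<ge> R0" for R
  proof -
    have bd: "ennreal (cmod (LINT s:{y..Y}|lborel. f (Complex x s))) \<le> k x" if "\<bar>x\<bar> \<ge> R0" for x
    proof -
      have "continuous_on {y..Y} (\<lambda>s. f (Complex x s))"
        by (rule continuous_on_compose2[OF fcont[of "{z. Im z > 0} - {l}"]])
          (use that y in \<open>auto simp: Complex_eq R0_def intro!: continuous_intros\<close>)
      then have i: "set_integrable lborel {y..Y} (\<lambda>s. f (Complex x s))"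
        by (rule borel_integrable_atLeastAtMost'[simplified])
      have "ennreal (cmod (LINT s:{y..Y}|lborel. f (Complex x s))) \<le>
          (\<integral>\<^sup>+s. ennreal (cmod (indicator {y..Y} s *\<^sub>R f (Complex x s))) \<partial>lborel)"
        using i unfolding set_lebesgue_integral_def set_integrable_def
        by (rule integral_norm_bound_ennreal)
      also have "\<dots> = k x"
        unfolding k_def using that
        by (intro nn_integral_cong) (auto simp: g_def A_def f_def R0_def indicator_def)
      finally show ?thesis .
    qed
    have "cmod (V R) \<le> cmod (LINT s:{y..Y}|lborel. f (Complex R s)) + cmod (LINT s:{y..Y}|lborel. f (Complex (- R) s))"
      unfolding V_def by (simp add: norm_mult norm_triangle_ineq4)
    then have "ennreal (cmod (V R)) \<le> ennreal (cmod (LINT s:{y..Y}|lborel. f (Complex R s)))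
        + ennreal (cmod (LINT s:{y..Y}|lborel. f (Complex (- R) s)))"
      by (simp flip: ennreal_plus)
    also have "\<dots> \<le> k R + k (- R)"
      using R R0 by (intro add_mono bd) auto
    finally show ?thesis .
  qed
  have "L = 0"
  proof (rule ccontr)
    assume "L \<noteq> 0"
    have "((\<lambda>R. cmod (V R)) \<longlongrightarrow> cmod L) at_top" by (intro tendsto_norm Vlim)
    moreover have "cmod L / 2 < cmod L" using \<open>L \<noteq> 0\<close> by simp
    ultimately have "\<forall>\<^sub>F R in at_top. cmod L / 2 < cmod (V R)" by (rule order_tendstoD)
    then obtain R1 where R1: "\<And>R. R \<ge> R1 \<Longrightarrow> cmod L / 2 < cmod (V R)"
      by (auto simp: eventually_at_top_linorder)
    define R2 where "R2 = max R0 R1"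
    have "ennreal (cmod L / 2) * emeasure lborel {R2..} = (\<integral>\<^sup>+R. ennreal (cmod L / 2) * indicator {R2..} R \<partial>lborel)"
      by (simp add: nn_integral_cmult_indicator)
    also have "\<dots> \<le> (\<integral>\<^sup>+R. k R + k (- R) \<partial>lborel)"
    proof (rule nn_integral_mono)
      fix R
      show "ennreal (cmod L / 2) * indicator {R2..} R \<le> k R + k (- R)"
      proof (cases "R \<ge> R2")
        case True
        then have "ennreal (cmod L / 2) \<le> ennreal (cmod (V R))"
          using R1[of R] by (intro ennreal_leI) (simp add: R2_def)
        also have "\<dots> \<le> k R + k (- R)" using True by (intro Vk) (simp add: R2_def)
        finally show ?thesis using True by simp
      qed simp
    qed
    also have "\<dots> = (\<integral>\<^sup>+R. k R \<partial>lborel) + (\<integral>\<^sup>+R. k (- R) \<partial>lborel)"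
      by (rule nn_integral_add) measurable
    also have "(\<integral>\<^sup>+R. k (- R) \<partial>lborel) = (\<integral>\<^sup>+R. k R \<partial>lborel)"
      using nn_integral_real_affine[OF k, of "-1" 0] by simp
    also have "(\<integral>\<^sup>+R. k R \<partial>lborel) + (\<integral>\<^sup>+R. k R \<partial>lborel) < \<infinity>"
      using kfin by simp
    finally have "ennreal (cmod L / 2) * emeasure lborel {R2..} < \<infinity>" .
    moreover have "emeasure lborel {R2..} = \<infinity>"
    proof (rule ccontr)
      assume "emeasure lborel {R2..} \<noteq> \<infinity>"
      then obtain r where r: "0 \<le> r" "emeasure lborel {R2..} = ennreal r"
        by (metis ennreal_cases infinity_ennreal_def)
      have "emeasure lborel {R2..R2 + (r + 1)} \<le> emeasure lborel {R2..}"
        by (intro emeasure_mono) auto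
      then have "ennreal (r + 1) \<le> ennreal r" using r by simp
      then show False using r by simp
    qed
    ultimately show False using \<open>L \<noteq> 0\<close> by (simp add: ennreal_mult_eq_top_iff)
  qed
  then show ?thesis by (simp add: L_def)
qed

text \<open>Let \<open>Y\<close> tend to infinity in the strip formula: the norms of the levels stay
  below \<open>C\<close>, while the norm of the kernel at distance \<open>Y - Im l\<close> from the
  real axis tends to zero.\<close>

lemma cauchy_level:
  assumes y: "0 < y" and m: "Im m \<noteq> 0"
  shows "cauchy (\<lambda>x. F (Complex x y)) m = (if Im m > 0 then 2 * of_real pi * \<i> * F (m + \<i> * of_real y) else 0)"
    (is "?I = ?c")
proof -
  define l where "l = m + \<i> * of_real y"
  have "((\<lambda>Y. cauchy (\<lambda>x. F (Complex x Y)) (l - \<i> * of_real Y)) \<longlongrightarrow> 0) at_top"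
  proof (rule Lim_null_comparison)
    show "\<forall>\<^sub>F Y in at_top. norm (cauchy (\<lambda>x. F (Complex x Y)) (l - \<i> * of_real Y)) \<le> C * sqrt (pi / (Y - Im l))"
      using eventually_gt_at_top[of "max 0 (Im l)"]
    proof eventually_elim
      case (elim Y)
      then have Y: "Y > 0" "Y > Im l" by auto
      have "norm (cauchy (\<lambda>x. F (Complex x Y)) (l - \<i> * of_real Y)) \<le>
          norm (abs_L2 (\<lambda>x. F (Complex x Y))) * sqrt (pi / \<bar>Im (l - \<i> * of_real Y)\<bar>)"
        using Y by (intro cauchy_bound square_integrable) auto
      also have "\<dots> \<le> C * sqrt (pi / \<bar>Im (l - \<i> * of_real Y)\<bar>)"
        by (intro mult_right_mono norm_le Y) simp
      finally show ?case using Y by simp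
    qed
    have "((\<lambda>Y. sqrt (pi / (Y - Im l))) \<longlongrightarrow> 0) at_top" by real_asymp
    from tendsto_mult_right_zero[OF this, of C]
    show "((\<lambda>Y. C * sqrt (pi / (Y - Im l))) \<longlongrightarrow> 0) at_top" .
  qed
  then have lim: "((\<lambda>Y. ?I - cauchy (\<lambda>x. F (Complex x Y)) (l - \<i> * of_real Y)) \<longlongrightarrow> ?I - 0) at_top"
    by (intro tendsto_intros)
  have ev: "\<forall>\<^sub>F Y in at_top. ?I - cauchy (\<lambda>x. F (Complex x Y)) (l - \<i> * of_real Y) = ?c"
    using eventually_gt_at_top[of "max y (Im l)"]
  proof eventually_elim
    case (elim Y)
    then show ?case using cauchy_strip[OF y, of Y l] m by (simp add: l_def)
  qed
  have "((\<lambda>Y::real. ?c) \<longlongrightarrow> ?I - 0) at_top"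
    by (rule tendsto_cong[THEN iffD1, OF ev lim])
  then show ?thesis by (subst (asm) tendsto_const_iff) auto
qed

lemma levels_weakly_convergent:
  assumes h: "h \<in> square_integrable"
    and lim: "AE x in lborel. ((\<lambda>y. F (Complex x y)) \<longlongrightarrow> h x) (at_right 0)"
    and g: "g \<in> square_integrable"
  shows "(\<lambda>n. LINT x|lborel. F (Complex x (1 / real (Suc n))) * g x) \<longlonglongrightarrow> (LINT x|lborel. h x * g x)"
proof (rule weakly_convergent_of_bounded_AE[OF _ _ h g])
  show "AE x in lborel. (\<lambda>n. F (Complex x (1 / real (Suc n)))) \<longlonglongrightarrow> h x"
    using lim
  proof eventually_elim
    case (elim x)
    have "filterlim (\<lambda>n. 1 / real (Suc n)) (at_right 0) sequentially"
      by real_asymp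
    from filterlim_compose[OF elim this] show ?case .
  qed
  show "norm (abs_L2 (\<lambda>x. F (Complex x (1 / real (Suc n))))) \<le> C" for n
    by (rule norm_le) simp
qed (rule square_integrable, simp)

text \<open>\<open>kern m\<close> is an admissible test function for the weak convergence of the
  levels, so the formula for positive heights passes to the limit; above the axis, continuity of
  \<open>F\<close> at \<open>m\<close> handles the other side.\<close>

lemma cauchy_boundary:
  assumes h: "h \<in> square_integrable"
    and lim: "AE x in lborel. ((\<lambda>y. F (Complex x y)) \<longlongrightarrow> h x) (at_right 0)"
    and m: "Im m \<noteq> 0"
  shows "cauchy h m = (if Im m > 0 then 2 * of_real pi * \<i> * F m else 0)"
proof -
  have 1: "(\<lambda>n. cauchy (\<lambda>x. F (Complex x (1 / real (Suc n)))) m) \<longlonglongrightarrow> cauchy h m"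
    unfolding cauchy_def by (rule levels_weakly_convergent[OF h lim kern_square_integrable[OF m]])
  show ?thesis
  proof (cases "Im m > 0")
    case True
    have "(\<lambda>n. m + \<i> * of_real (1 / real (Suc n))) \<longlonglongrightarrow> m + \<i> * of_real 0"
      by (intro tendsto_intros) real_asymp
    moreover have "isCont F (m + \<i> * of_real 0)"
      using hol True open_halfspace_Im_gt[of 0]
      by simp (metis continuous_on_eq_continuous_at holomorphic_on_imp_continuous_on mem_Collect_eq)
    ultimately have "(\<lambda>n. F (m + \<i> * of_real (1 / real (Suc n)))) \<longlonglongrightarrow> F (m + \<i> * of_real 0)"
      by (rule isCont_tendsto_compose[rotated])
    then have "(\<lambda>n. 2 * of_real pi * \<i> * F (m + \<i> * of_real (1 / real (Suc n)))) \<longlonglongrightarrow> 2 * of_real pi * \<i> * F m"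
      by (intro tendsto_intros) simp
    moreover have "(\<lambda>n. cauchy (\<lambda>x. F (Complex x (1 / real (Suc n)))) m) =
        (\<lambda>n. 2 * of_real pi * \<i> * F (m + \<i> * of_real (1 / real (Suc n))))"
      using cauchy_level[of "1 / real (Suc _)" m] True by auto
    ultimately have "cauchy h m = 2 * of_real pi * \<i> * F m"
      using LIMSEQ_unique[OF 1] by simp
    then show ?thesis using True by simp
  next
    case False
    then have "cauchy (\<lambda>x. F (Complex x (1 / real (Suc n)))) m = 0" for n
      using cauchy_level[of "1 / real (Suc n)" m] m by simp
    with 1 False show ?thesis by (simp add: LIMSEQ_const_iff)
  qed
qed

end

section \<open>Multiplicativity and injectivity of the Cauchy transform\<close>

lemma nn_integral_inverse_quadratic:
  assumes "y \<noteq> (0::real)"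
  shows "(\<integral>\<^sup>+x. ennreal (1 / ((x - t)\<^sup>2 + y\<^sup>2)) \<partial>lborel) = ennreal (pi / \<bar>y\<bar>)"
  using has_bochner_integral_inverse_quadratic[OF assms, of t]
  by (subst nn_integral_eq_integral) (auto simp: has_bochner_integral_iff)

text \<open>A form of Schur's test: the product of the moduli is at most the sum of their squares,
  and the quadratic kernel has the same finite mass \<open>pi / \<bar>y\<bar>\<close> in either
  variable.\<close>

lemma integrable_quadratic_kernel:
  fixes M :: "real \<times> real \<Rightarrow> complex"
  assumes g: "g \<in> square_integrable" and h: "h \<in> square_integrable" and y: "y \<noteq> 0"
    and M: "M \<in> borel_measurable borel"
    and bd: "\<And>x t. cmod (M (x, t)) \<le> c * (cmod (g x) * cmod (h t) / ((t - x)\<^sup>2 + y\<^sup>2))"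
  shows "integrable (lborel \<Otimes>\<^sub>M lborel) M"
proof -
  note [measurable] = g[THEN square_integrable_measurable] h[THEN square_integrable_measurable]
  have fin: "(\<integral>\<^sup>+x. ennreal ((cmod (f x))\<^sup>2) \<partial>lborel) < \<infinity>" if "f \<in> square_integrable" for f
    using square_integrable_norm_sq[OF that] by (subst nn_integral_eq_integral) auto
  let ?q = "\<lambda>x t. ennreal (1 / ((t - x)\<^sup>2 + y\<^sup>2))"
  have 1: "(\<integral>\<^sup>+x. (\<integral>\<^sup>+t. ennreal ((cmod (g x))\<^sup>2) * ?q x t \<partial>lborel) \<partial>lborel) < \<infinity>"
    using fin[OF g] by (simp add: nn_integral_cmult nn_integral_inverse_quadratic[OF y]
        nn_integral_multc ennreal_mult_less_top)
  have "(\<lambda>(x, t). ennreal ((cmod (h t))\<^sup>2) * ?q x t) \<in> borel_measurable (lborel \<Otimes>\<^sub>M lborel)"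
    by measurable
  then have "(\<integral>\<^sup>+x. (\<integral>\<^sup>+t. ennreal ((cmod (h t))\<^sup>2) * ?q x t \<partial>lborel) \<partial>lborel) =
     (\<integral>\<^sup>+t. (\<integral>\<^sup>+x. ennreal ((cmod (h t))\<^sup>2) * ?q x t \<partial>lborel) \<partial>lborel)"
    by (rule lborel_pair.Fubini'[symmetric])
  also have "\<dots> = (\<integral>\<^sup>+t. (\<integral>\<^sup>+x. ennreal ((cmod (h t))\<^sup>2) * ennreal (1 / ((x - t)\<^sup>2 + y\<^sup>2)) \<partial>lborel) \<partial>lborel)"
    by (simp add: power2_commute)
  also have "\<dots> < \<infinity>"
    using fin[OF h] by (simp add: nn_integral_cmult nn_integral_inverse_quadratic[OF y]
        nn_integral_multc ennreal_mult_less_top)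
  finally have 2: "(\<integral>\<^sup>+x. (\<integral>\<^sup>+t. ennreal ((cmod (h t))\<^sup>2) * ?q x t \<partial>lborel) \<partial>lborel) < \<infinity>" .
  have pt: "ennreal (cmod (M (x, t))) \<le>
      ennreal \<bar>c\<bar> * (ennreal ((cmod (g x))\<^sup>2) * ?q x t + ennreal ((cmod (h t))\<^sup>2) * ?q x t)" for x t
  proof -
    have "cmod (g x) * cmod (h t) \<le> (cmod (g x))\<^sup>2 + (cmod (h t))\<^sup>2"
      using sum_squares_bound[of "cmod (g x)" "cmod (h t)"]
        mult_nonneg_nonneg[OF norm_ge_zero[of "g x"] norm_ge_zero[of "h t"]] by linarith
    then have q: "cmod (g x) * cmod (h t) / ((t - x)\<^sup>2 + y\<^sup>2) \<le> ((cmod (g x))\<^sup>2 + (cmod (h t))\<^sup>2) / ((t - x)\<^sup>2 + y\<^sup>2)"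
      by (rule divide_right_mono) simp
    have "cmod (M (x, t)) \<le> \<bar>c\<bar> * (cmod (g x) * cmod (h t) / ((t - x)\<^sup>2 + y\<^sup>2))"
      by (rule order_trans[OF bd], rule mult_right_mono) auto
    also have "\<dots> \<le> \<bar>c\<bar> * (((cmod (g x))\<^sup>2 + (cmod (h t))\<^sup>2) / ((t - x)\<^sup>2 + y\<^sup>2))"
      by (rule mult_left_mono[OF q]) simp
    finally have "cmod (M (x, t)) \<le> \<bar>c\<bar> * ((cmod (g x))\<^sup>2 * (1 / ((t - x)\<^sup>2 + y\<^sup>2)) + (cmod (h t))\<^sup>2 * (1 / ((t - x)\<^sup>2 + y\<^sup>2)))"
      by (simp add: add_divide_distrib)
    then show ?thesis
      by (simp add: ennreal_mult[symmetric] ennreal_plus[symmetric] del: ennreal_plus)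
  qed
  show ?thesis
  proof (rule integrableI_bounded)
    show "M \<in> borel_measurable (lborel \<Otimes>\<^sub>M lborel)"
      using M by (simp add: lborel_prod)
    then have "(\<integral>\<^sup>+p. ennreal (cmod (M p)) \<partial>(lborel \<Otimes>\<^sub>M lborel)) =
       (\<integral>\<^sup>+x. (\<integral>\<^sup>+t. ennreal (cmod (M (x, t))) \<partial>lborel) \<partial>lborel)"
      by (subst lborel.nn_integral_fst[symmetric]) auto
    also have "\<dots> \<le> (\<integral>\<^sup>+x. (\<integral>\<^sup>+t. ennreal \<bar>c\<bar> * (ennreal ((cmod (g x))\<^sup>2) * ?q x t + ennreal ((cmod (h t))\<^sup>2) * ?q x t) \<partial>lborel) \<partial>lborel)"
      by (intro nn_integral_mono pt)
    also have "\<dots> = ennreal \<bar>c\<bar> * ((\<integral>\<^sup>+x. (\<integral>\<^sup>+t. ennreal ((cmod (g x))\<^sup>2) * ?q x t \<partial>lborel) \<partial>lborel) +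
        (\<integral>\<^sup>+x. (\<integral>\<^sup>+t. ennreal ((cmod (h t))\<^sup>2) * ?q x t \<partial>lborel) \<partial>lborel))"
    proof -
      have "(\<integral>\<^sup>+t. ennreal \<bar>c\<bar> * (ennreal ((cmod (g x))\<^sup>2) * ?q x t + ennreal ((cmod (h t))\<^sup>2) * ?q x t) \<partial>lborel) =
        ennreal \<bar>c\<bar> * ((\<integral>\<^sup>+t. ennreal ((cmod (g x))\<^sup>2) * ?q x t \<partial>lborel) + (\<integral>\<^sup>+t. ennreal ((cmod (h t))\<^sup>2) * ?q x t \<partial>lborel))" for x
        by (subst nn_integral_cmult, measurable) (subst nn_integral_add, measurable)
      then show ?thesis
        by (simp only:) (subst nn_integral_cmult, measurable, subst nn_integral_add, measurable)
    qed
    also have "\<dots> < \<infinity>"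
      using 1 2 by (simp add: ennreal_mult_less_top)
    finally show "(\<integral>\<^sup>+p. ennreal (cmod (M p)) \<partial>(lborel \<Otimes>\<^sub>M lborel)) < \<infinity>" .
  qed
qed

context hardy_function
begin

text \<open>
  Fubini applied to the Cauchy representation of \<open>F\<close>. The Cauchy kernel itself is not absolutely
  integrable against \<open>g\<close> and \<open>h\<close>, but the difference of the kernels for two levels is.
\<close>

lemma annihilated_levels_const:
  assumes h: "h \<in> square_integrable"
    and lim: "AE x in lborel. ((\<lambda>y. F (Complex x y)) \<longlongrightarrow> h x) (at_right 0)"
    and g: "g \<in> square_integrable" "\<And>m. Im m < 0 \<Longrightarrow> cauchy g m = 0"
    and y: "0 < y" "y \<le> Y"
  shows "(LINT x|lborel. F (Complex x y) * g x) = (LINT x|lborel. F (Complex x Y) * g x)"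
proof -
  note [measurable] = g(1)[THEN square_integrable_measurable] h[THEN square_integrable_measurable]
  have Y: "0 < Y" using y by simp
  let ?D = "\<lambda>x t. kern (Complex x y) t - kern (Complex x Y) t"
  let ?M = "\<lambda>x t. g x * h t * ?D x t"
  \<comment> \<open>Exchanging the two real variables reflects the pole into the lower half-plane,
    where \<open>cauchy g\<close> vanishes.\<close>
  have swap: "kern (Complex x s) t = - kern (Complex t (- s)) x" if "s \<noteq> 0" for x t s
  proof -
    have eq: "of_real t - Complex x s = - (of_real x - Complex t (- s))"
      by (simp add: complex_eq_iff)
    show ?thesis by (simp only: kern_def eq divide_minus_right)
  qed
  have int: "integrable (lborel \<Otimes>\<^sub>M lborel) (\<lambda>(x, t). ?M x t)"
  proof (rule integrable_quadratic_kernel[OF g(1) h, of y _ "Y - y"])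
    show "(\<lambda>(x, t). ?M x t) \<in> borel_measurable borel"
      unfolding kern_def Complex_eq borel_prod[symmetric] by measurable
    show "cmod (case (x, t) of (x, t) \<Rightarrow> ?M x t) \<le> (Y - y) * (cmod (g x) * cmod (h t) / ((t - x)\<^sup>2 + y\<^sup>2))" for x t
    proof -
      have "cmod (kern (Complex x Y) t) \<le> cmod (kern (Complex x y) t)"
      proof (rule power2_le_imp_le)
        have "y\<^sup>2 \<le> Y\<^sup>2" using y by (intro power_mono) auto
        then show "(cmod (kern (Complex x Y) t))\<^sup>2 \<le> (cmod (kern (Complex x y) t))\<^sup>2"
          unfolding cmod_kern_sq using y by (intro divide_left_mono) (auto intro!: mult_pos_pos add_nonneg_pos)
      qed simp
      then have "cmod (kern (Complex x y) t) * cmod (kern (Complex x Y) t) \<le> (cmod (kern (Complex x y) t))\<^sup>2"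
        unfolding power2_eq_square by (rule mult_left_mono) simp
      also have "\<dots> = 1 / ((t - x)\<^sup>2 + y\<^sup>2)" by (simp add: cmod_kern_sq)
      finally have k: "cmod (kern (Complex x y) t) * cmod (kern (Complex x Y) t) \<le> 1 / ((t - x)\<^sup>2 + y\<^sup>2)" .
      have "Complex x y - Complex x Y = \<i> * of_real (y - Y)" by (simp add: complex_eq_iff)
      then have "cmod (?D x t) = (Y - y) * (cmod (kern (Complex x y) t) * cmod (kern (Complex x Y) t))"
        using y Y by (simp add: kern_diff norm_mult del: of_real_diff)
      also have "\<dots> \<le> (Y - y) * (1 / ((t - x)\<^sup>2 + y\<^sup>2))" using y by (intro mult_left_mono k) simp
      finally have "cmod (g x) * cmod (h t) * cmod (?D x t) \<le> cmod (g x) * cmod (h t) * ((Y - y) * (1 / ((t - x)\<^sup>2 + y\<^sup>2)))"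
        by (rule mult_left_mono) simp
      then show ?thesis by (simp add: norm_mult mult_ac)
    qed
  qed (use y in auto)
  have inner1: "(LINT t|lborel. ?M x t) = 2 * of_real pi * \<i> * (F (Complex x y) * g x - F (Complex x Y) * g x)" for x
  proof -
    have "(LINT t|lborel. ?M x t) = (LINT t|lborel. g x * (h t * kern (Complex x y) t - h t * kern (Complex x Y) t))"
      by (rule Bochner_Integration.integral_cong) (simp_all add: algebra_simps)
    also have "\<dots> = g x * (cauchy h (Complex x y) - cauchy h (Complex x Y))"
      unfolding cauchy_def integral_mult_right_zero using h y Y
      by (subst Bochner_Integration.integral_diff) (auto intro: mult_kern_integrable)
    also have "\<dots> = g x * (2 * of_real pi * \<i> * F (Complex x y) - 2 * of_real pi * \<i> * F (Complex x Y))"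
      using y Y cauchy_boundary[OF h lim] by simp
    finally show ?thesis by (simp add: algebra_simps)
  qed
  have inner2: "(LINT x|lborel. ?M x t) = 0" for t
  proof -
    have "(LINT x|lborel. ?M x t) = (LINT x|lborel. h t * (g x * kern (Complex t (- Y)) x - g x * kern (Complex t (- y)) x))"
    proof (rule Bochner_Integration.integral_cong)
      fix x
      have "kern (Complex x y) t = - kern (Complex t (- y)) x" "kern (Complex x Y) t = - kern (Complex t (- Y)) x"
        using y Y by (auto intro: swap)
      then show "?M x t = h t * (g x * kern (Complex t (- Y)) x - g x * kern (Complex t (- y)) x)"
        by (simp only:) (simp add: algebra_simps)
    qed simp
    also have "\<dots> = h t * (cauchy g (Complex t (- Y)) - cauchy g (Complex t (- y)))"
      unfolding cauchy_def integral_mult_right_zero using g(1) y Y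
      by (subst Bochner_Integration.integral_diff) (auto intro: mult_kern_integrable)
    also have "\<dots> = 0" using g(2) y Y by simp
    finally show ?thesis .
  qed
  have "(LINT x|lborel. (LINT t|lborel. ?M x t)) = (LINT t|lborel. (LINT x|lborel. ?M x t))"
    using lborel_pair.Fubini_integral[OF int] by simp
  then have "(LINT x|lborel. F (Complex x y) * g x - F (Complex x Y) * g x) = 0"
    by (simp add: inner1 inner2)
  moreover have "(LINT x|lborel. F (Complex x y) * g x - F (Complex x Y) * g x) =
      (LINT x|lborel. F (Complex x y) * g x) - (LINT x|lborel. F (Complex x Y) * g x)"
    using y Y g(1) by (intro Bochner_Integration.integral_diff square_integrable_mult square_integrable) auto
  ultimately show ?thesis by simp
qed

text \<open>Morally \<open>h * g\<close> is the boundary value of an integrable Hardy function,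
  whose integral vanishes. The pairing of \<open>g\<close> with the level at height \<open>y\<close>
  is independent of \<open>y\<close>; for small heights it tends to the pairing with
  \<open>h\<close>, for large heights to zero, because \<open>F\<close> decays pointwise like the
  inverse square root of the height.\<close>

lemma annihilated:
  assumes h: "h \<in> square_integrable"
    and lim: "AE x in lborel. ((\<lambda>y. F (Complex x y)) \<longlongrightarrow> h x) (at_right 0)"
    and g: "g \<in> square_integrable" "\<And>m. Im m < 0 \<Longrightarrow> cauchy g m = 0"
  shows "(LINT x|lborel. h x * g x) = 0"
proof -
  have "(\<lambda>n. LINT x|lborel. F (Complex x (1 / real (Suc n))) * g x) \<longlonglongrightarrow> (LINT x|lborel. h x * g x)"
    by (rule levels_weakly_convergent[OF h lim g(1)])
  moreover have "(LINT x|lborel. F (Complex x (1 / real (Suc n))) * g x) = (LINT x|lborel. F (Complex x 1) * g x)" for n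
    by (rule annihilated_levels_const[OF h lim g]) auto
  ultimately have 1: "(LINT x|lborel. F (Complex x 1) * g x) = (LINT x|lborel. h x * g x)"
    by (simp add: LIMSEQ_const_iff)
  have "(\<lambda>n. LINT x|lborel. F (Complex x (real (Suc n))) * g x) \<longlonglongrightarrow> (LINT x|lborel. 0 * g x)"
  proof (rule weakly_convergent_of_bounded_AE[OF _ _ _ g(1)])
    show "norm (abs_L2 (\<lambda>x. F (Complex x (real (Suc n))))) \<le> C" for n by (rule norm_le) simp
    show "AE x in lborel. (\<lambda>n. F (Complex x (real (Suc n)))) \<longlonglongrightarrow> 0"
    proof (rule AE_I2, rule Lim_null_comparison)
      fix x
      show "\<forall>\<^sub>F n in sequentially. norm (F (Complex x (real (Suc n)))) \<le> norm (abs_L2 h) * sqrt (pi / real (Suc n))"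
      proof (rule always_eventually, rule allI)
        fix n
        have "cmod (2 * of_real pi * \<i>) * cmod (F (Complex x (real (Suc n)))) = cmod (cauchy h (Complex x (real (Suc n))))"
          by (subst cauchy_boundary[OF h lim]) (auto simp: norm_mult)
        also have "\<dots> \<le> norm (abs_L2 h) * sqrt (pi / \<bar>Im (Complex x (real (Suc n)))\<bar>)"
          by (rule cauchy_bound[OF h]) simp
        finally have "2 * pi * cmod (F (Complex x (real (Suc n)))) \<le> norm (abs_L2 h) * sqrt (pi / real (Suc n))"
          by (simp add: norm_mult)
        moreover have "1 * cmod (F (Complex x (real (Suc n)))) \<le> 2 * pi * cmod (F (Complex x (real (Suc n))))"
          using pi_gt3 by (intro mult_right_mono) auto
        ultimately show "norm (F (Complex x (real (Suc n)))) \<le> norm (abs_L2 h) * sqrt (pi / real (Suc n))" by linarith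
      qed
      have "(\<lambda>n. sqrt (pi / real (Suc n))) \<longlonglongrightarrow> 0" by real_asymp
      from tendsto_mult_right_zero[OF this, of "norm (abs_L2 h)"]
      show "(\<lambda>n. norm (abs_L2 h) * sqrt (pi / real (Suc n))) \<longlonglongrightarrow> 0" .
    qed
    show "(\<lambda>x. F (Complex x (real (Suc n)))) \<in> square_integrable" for n
      by (rule square_integrable) simp
  qed (simp add: square_integrable_def)
  moreover have "(LINT x|lborel. F (Complex x (real (Suc n))) * g x) = (LINT x|lborel. F (Complex x 1) * g x)" for n
    by (rule annihilated_levels_const[OF h lim g, symmetric]) auto
  ultimately have "(LINT x|lborel. F (Complex x 1) * g x) = 0"
    by (simp add: LIMSEQ_const_iff)
  with 1 show ?thesis by simp
qed

lemma cauchy_mult: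
  assumes h: "h \<in> square_integrable"
    and lim: "AE x in lborel. ((\<lambda>y. F (Complex x y)) \<longlongrightarrow> h x) (at_right 0)"
    and g: "g \<in> square_integrable" "\<And>m. Im m < 0 \<Longrightarrow> cauchy g m = 0"
  shows "Im m < 0 \<Longrightarrow> cauchy (\<lambda>x. h x * g x) m = 0"
    and "Im m > 0 \<Longrightarrow> 2 * of_real pi * \<i> * cauchy (\<lambda>x. h x * g x) m = cauchy h m * cauchy g m"
\<comment> \<open>apply \<open>annihilated\<close> to \<open>g / (x - m)\<close>, and to \<open>(g - G) / (x - m)\<close> for \<open>G\<close> the value at \<open>m\<close> of the extension of \<open>g\<close>\<close>
proof -
  assume m: "Im m < 0"
  have gk: "(\<lambda>x. g x * kern m x) \<in> square_integrable" using g(1) m by auto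
  have "cauchy (\<lambda>x. g x * kern m x) n = 0" if n: "Im n < 0" for n
  proof (cases "n = m")
    case True
    \<comment> \<open>Partial fractions say nothing at \<open>n = m\<close>; there the value is the
      derivative of \<open>cauchy g\<close>, which is zero throughout the lower half-plane.\<close>
    have "((\<lambda>z. 0) has_field_derivative cauchy (\<lambda>x. g x * kern m x) m) (at m)"
    proof (rule has_field_derivative_transform_within_open)
      show "(cauchy g has_field_derivative cauchy (\<lambda>x. g x * kern m x) m) (at m)"
        using m by (intro cauchy_has_field_derivative g) simp
      show "open {z. Im z < 0}" by (rule open_halfspace_Im_lt)
    qed (use m g(2) in auto)
    then have "cauchy (\<lambda>x. g x * kern m x) m = 0"
      using DERIV_const DERIV_unique by blast
    with True show ?thesis by simp
  next
    case False
    have "(m - n) * cauchy (\<lambda>x. g x * kern m x) n = 0"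
      using cauchy_mult_kern[OF g(1), of m n] m n g(2) by simp
    with False show ?thesis by simp
  qed
  from annihilated[OF h lim gk this] show "cauchy (\<lambda>x. h x * g x) m = 0"
    by (simp add: cauchy_def mult.assoc)
next
  assume m: "Im m > 0"
  define G where "G = cauchy g m / (2 * of_real pi * \<i>)"
  have gk: "(\<lambda>x. g x * kern m x) \<in> square_integrable" using g(1) m by auto
  have k: "kern m \<in> square_integrable" using m by auto
  have Gk: "(\<lambda>x. G * kern m x) \<in> square_integrable" using k by (rule square_integrable_scale)
  have sq: "(\<lambda>x. g x * kern m x - G * kern m x) \<in> square_integrable"
    by (rule square_integrable_diff[OF gk Gk])
  have "cauchy (\<lambda>x. g x * kern m x - G * kern m x) n = 0" if n: "Im n < 0" for n
  proof -
    have kn: "kern n \<in> square_integrable" using n by auto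
    have "cauchy (\<lambda>x. g x * kern m x - G * kern m x) n =
        (LINT x|lborel. g x * kern m x * kern n x - G * (kern m x * kern n x))"
      unfolding cauchy_def by (rule Bochner_Integration.integral_cong) (simp_all add: algebra_simps)
    also have "\<dots> = cauchy (\<lambda>x. g x * kern m x) n - G * (LINT x|lborel. kern m x * kern n x)"
      unfolding cauchy_def
      by (subst Bochner_Integration.integral_diff)
        (auto intro!: integrable_mult_right square_integrable_mult gk k kn)
    finally have eq: "cauchy (\<lambda>x. g x * kern m x - G * kern m x) n =
        cauchy (\<lambda>x. g x * kern m x) n - G * (LINT x|lborel. kern m x * kern n x)" .
    have "(m - n) * cauchy (\<lambda>x. g x * kern m x - G * kern m x) n =
        (m - n) * cauchy (\<lambda>x. g x * kern m x) n - G * ((m - n) * (LINT x|lborel. kern m x * kern n x))"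
      unfolding eq by (simp add: algebra_simps)
    \<comment> \<open>\<open>m\<close> and \<open>n\<close> lie in opposite half-planes, so the two
      kernels contribute the full \<open>2 \<pi> \<i>\<close>, and \<open>G\<close> is chosen to
      cancel exactly this.\<close>
    also have "\<dots> = cauchy g m - G * (2 * of_real pi * \<i>)"
    proof -
      have "(m - n) * cauchy (\<lambda>x. g x * kern m x) n = cauchy g m"
        using cauchy_mult_kern[OF g(1), of m n] m n g(2) by simp
      moreover have "(m - n) * (LINT x|lborel. kern m x * kern n x) = 2 * of_real pi * \<i>"
        using LINT_kern_mult_kern[of m n] m n by simp
      ultimately show ?thesis by (simp only:)
    qed
    also have "\<dots> = 0" by (simp add: G_def)
    finally show ?thesis using m n by auto
  qed
  from annihilated[OF h lim sq this]
  have "(LINT x|lborel. h x * (g x * kern m x) - G * (h x * kern m x)) = 0"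
    by (simp add: algebra_simps)
  moreover have "(LINT x|lborel. h x * (g x * kern m x) - G * (h x * kern m x)) =
      (LINT x|lborel. h x * (g x * kern m x)) - G * (LINT x|lborel. h x * kern m x)"
    by (subst Bochner_Integration.integral_diff)
      (auto intro!: integrable_mult_right square_integrable_mult gk k h)
  ultimately have "cauchy (\<lambda>x. h x * g x) m = G * cauchy h m"
    by (simp add: cauchy_def mult.assoc)
  then show "2 * of_real pi * \<i> * cauchy (\<lambda>x. h x * g x) m = cauchy h m * cauchy g m"
    by (simp add: G_def)
qed

end

text \<open>The jump of the transform between \<open>t + \<i> e\<close> and
  \<open>t - \<i> e\<close> is \<open>2 \<i>\<close> times the integral of \<open>f\<close> against
  the kernel \<open>e / ((t - x)\<^sup>2 + e\<^sup>2)\<close>. Integrating over \<open>t\<close> in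
  \<open>{a..b}\<close> and exchanging the integrals moves the smoothing from \<open>f\<close> to
  the indicator, where the limit is explicit. Hence \<open>f\<close> has zero integral over every
  interval.\<close>

lemma cauchy_injective:
  assumes f: "f \<in> square_integrable" and z: "\<And>m. Im m \<noteq> 0 \<Longrightarrow> cauchy f m = 0"
  shows "AE x in lborel. f x = 0"
proof -
  note [measurable] = f[THEN square_integrable_measurable]
  have main: "(LINT x:{a..b}|lborel. f x) = 0" if ab: "a \<le> b" for a b
  proof -
    \<comment> \<open>\<open>T n\<close> is \<open>\<pi>\<close> times the Poisson extension of the indicator of \<open>{a..b}\<close> at height \<open>1 / (n + 1)\<close>\<close>
    define T where "T n x = arctan ((b - x) * real (Suc n)) - arctan ((a - x) * real (Suc n))" for n x
    have Tint: "has_bochner_integral lborel (\<lambda>t. indicator {a..b} t * (1 / real (Suc n) / ((t - x)\<^sup>2 + (1 / real (Suc n))\<^sup>2))) (T n x)" for n x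
    proof -
      have "has_bochner_integral lborel (\<lambda>t. indicator {a..b} t *\<^sub>R (1 / real (Suc n) / ((t - x)\<^sup>2 + (1 / real (Suc n))\<^sup>2)))
        (arctan ((b - x) * real (Suc n)) - arctan ((a - x) * real (Suc n)))"
      proof (rule has_bochner_integral_FTC_Icc[OF ab])
        fix t :: real
        define N where "N = real (Suc n)"
        have N: "N > 0" by (simp add: N_def)
        have "1 / N / ((t - x)\<^sup>2 + (1 / N)\<^sup>2) = N / (1 + ((t - x) * N)\<^sup>2)"
          using N by (simp add: field_simps power2_eq_square)
        then have "((\<lambda>t. arctan ((t - x) * N)) has_real_derivative 1 / N / ((t - x)\<^sup>2 + (1 / N)\<^sup>2)) (at t within {a..b})"
          by (auto intro!: derivative_eq_intros simp: divide_inverse)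
        then show "((\<lambda>t. arctan ((t - x) * real (Suc n))) has_vector_derivative 1 / real (Suc n) / ((t - x)\<^sup>2 + (1 / real (Suc n))\<^sup>2)) (at t within {a..b})"
          by (simp add: has_real_derivative_iff_has_vector_derivative N_def)
      next
        have "(t - x)\<^sup>2 + (1 / real (Suc n))\<^sup>2 \<noteq> 0" for t :: real
          by (simp add: add_nonneg_eq_0_iff)
        then show "continuous_on {a..b} (\<lambda>t. 1 / real (Suc n) / ((t - x)\<^sup>2 + (1 / real (Suc n))\<^sup>2))"
          by (intro continuous_intros) auto
      qed
      then show ?thesis by (simp add: T_def)
    qed
    have T0: "0 \<le> T n x" for n x
      using ab by (simp add: T_def arctan_le_iff mult_right_mono)
    have Tpi: "T n x \<le> pi" for n x
      using arctan_ubound[of "(b - x) * real (Suc n)"] arctan_lbound[of "(a - x) * real (Suc n)"]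
      by (simp add: T_def)
    have [measurable]: "T n \<in> borel_measurable borel" for n
      unfolding T_def by measurable
    have Tnn: "(\<integral>\<^sup>+x. ennreal (T n x) \<partial>lborel) = ennreal (pi * (b - a))" for n
    proof -
      define e where "e = 1 / real (Suc n)"
      have e: "e > 0" by (simp add: e_def)
      let ?q = "\<lambda>x t. ennreal e * ennreal (1 / ((x - t)\<^sup>2 + e\<^sup>2))"
      have "ennreal (T n x) = (\<integral>\<^sup>+t. indicator {a..b} t * ?q x t \<partial>lborel)" for x
      proof -
        have "(\<integral>\<^sup>+t. indicator {a..b} t * ?q x t \<partial>lborel) =
            (\<integral>\<^sup>+t. ennreal (indicator {a..b} t * (e / ((t - x)\<^sup>2 + e\<^sup>2))) \<partial>lborel)"
          using e by (intro nn_integral_cong) (auto simp: indicator_def ennreal_mult[symmetric] power2_commute)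
        also have "\<dots> = ennreal (T n x)"
          using Tint[of n x, folded e_def] e
          by (subst nn_integral_eq_integral) (auto simp: has_bochner_integral_iff)
        finally show ?thesis by simp
      qed
      then have "(\<integral>\<^sup>+x. ennreal (T n x) \<partial>lborel) = (\<integral>\<^sup>+x. (\<integral>\<^sup>+t. indicator {a..b} t * ?q x t \<partial>lborel) \<partial>lborel)"
        by simp
      also have "\<dots> = (\<integral>\<^sup>+t. (\<integral>\<^sup>+x. indicator {a..b} t * ?q x t \<partial>lborel) \<partial>lborel)"
        by (rule lborel_pair.Fubini'[symmetric, of "\<lambda>x t. indicator {a..b} t * ?q x t"]) measurable
      also have "\<dots> = (\<integral>\<^sup>+t. ennreal pi * indicator {a..b} t \<partial>lborel)"
      proof (rule nn_integral_cong)
        fix t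
        have "(\<integral>\<^sup>+x. ?q x t \<partial>lborel) = ennreal e * (\<integral>\<^sup>+x. ennreal (1 / ((x - t)\<^sup>2 + e\<^sup>2)) \<partial>lborel)"
          by (rule nn_integral_cmult) measurable
        also have "\<dots> = ennreal e * ennreal (pi / \<bar>e\<bar>)"
          using e by (subst nn_integral_inverse_quadratic) auto
        also have "\<dots> = ennreal pi"
          using e by (simp add: ennreal_mult[symmetric])
        finally have "(\<integral>\<^sup>+x. ?q x t \<partial>lborel) = ennreal pi" .
        moreover have "(\<integral>\<^sup>+x. indicator {a..b} t * ?q x t \<partial>lborel) = indicator {a..b} t * (\<integral>\<^sup>+x. ?q x t \<partial>lborel)"
          by (rule nn_integral_cmult) measurable
        ultimately show "(\<integral>\<^sup>+x. indicator {a..b} t * ?q x t \<partial>lborel) = ennreal pi * indicator {a..b} t"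
          by (simp only: mult.commute)
      qed
      also have "\<dots> = ennreal (pi * (b - a))"
        using ab by (simp add: nn_integral_cmult_indicator ennreal_mult)
      finally show ?thesis .
    qed
    \<comment> \<open>Since \<open>T n x\<close> lies between \<open>0\<close> and
      \<open>pi\<close>, its square is at most \<open>pi * T n x\<close>; the total mass
      \<open>pi * (b - a)\<close> therefore bounds the norm uniformly in \<open>n\<close>.\<close>
    have Tsq: "(\<lambda>x. of_real (T n x)) \<in> square_integrable"
      and Tnorm: "norm (abs_L2 (\<lambda>x. of_real (T n x))) \<le> sqrt (pi * (pi * (b - a)))" for n
    proof -
      have le: "(cmod (of_real (T n x)))\<^sup>2 \<le> pi * T n x" for x
        using mult_right_mono[OF Tpi T0, of n x n x] by (simp add: power2_eq_square)
      have iT: "integrable lborel (T n)"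
        using T0 by (intro integrableI_nonneg) (auto simp: Tnn)
      have LT: "(LINT x|lborel. T n x) = pi * (b - a)"
        using T0 ab by (subst integral_eq_nn_integral) (auto simp: Tnn)
      have i: "integrable lborel (\<lambda>x. (cmod (of_real (T n x)))\<^sup>2)"
        by (rule Bochner_Integration.integrable_bound[of _ "\<lambda>x. pi * T n x"]) (use le iT T0 in auto)
      then show sq: "(\<lambda>x. of_real (T n x)) \<in> square_integrable" by (simp add: square_integrable_def)
      have "(LINT x|lborel. (cmod (of_real (T n x)))\<^sup>2) \<le> (LINT x|lborel. pi * T n x)"
        by (intro integral_mono i le) (use iT in auto)
      then show "norm (abs_L2 (\<lambda>x. of_real (T n x))) \<le> sqrt (pi * (pi * (b - a)))"
        unfolding norm_abs_L2[OF sq] by (intro real_sqrt_le_mono) (simp add: LT)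
    qed
    define h :: "real \<Rightarrow> complex" where "h x = of_real (indicator {a..b} x * pi)" for x
    have "(\<lambda>x. of_real (indicator {a..b} x)) = (\<lambda>x. indicator {a..b} x :: complex)"
      by (auto simp: indicator_def fun_eq_iff)
    then have isq: "(\<lambda>x. of_real (indicator {a..b} x)) \<in> square_integrable"
      using square_integrable_indicator_Icc[of a b] by simp
    have hsq: "h \<in> square_integrable"
      using square_integrable_scale[OF isq, of "of_real pi"] by (simp add: h_def[abs_def] mult.commute)
    have conv: "(\<lambda>n. LINT x|lborel. of_real (T n x) * f x) \<longlonglongrightarrow> (LINT x|lborel. h x * f x)"
    proof (rule weakly_convergent_of_bounded_AE[OF Tsq Tnorm hsq f])
      \<comment> \<open>At the two end points the limit of \<open>T n\<close> differs from
        \<open>h\<close>.\<close>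
      have "AE x in lborel. x \<noteq> a \<and> x \<noteq> b"
        using AE_lborel_singleton[of a] AE_lborel_singleton[of b] by eventually_elim simp
      then show "AE x in lborel. (\<lambda>n. of_real (T n x) :: complex) \<longlonglongrightarrow> h x"
      proof eventually_elim
        case (elim x)
        have p: "(\<lambda>n. arctan (c * real (Suc n))) \<longlonglongrightarrow> pi / 2" if "c > 0" for c
          using that by real_asymp
        have q: "(\<lambda>n. arctan (c * real (Suc n))) \<longlonglongrightarrow> - (pi / 2)" if "c < 0" for c
          using that by real_asymp
        consider "x < a" | "a < x" "x < b" | "b < x" using elim by fastforce
        then have "(\<lambda>n. T n x) \<longlonglongrightarrow> indicator {a..b} x * pi"
        proof cases
          case 1
          then have "(\<lambda>n. T n x) \<longlonglongrightarrow> pi / 2 - pi / 2"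
            unfolding T_def using ab by (intro tendsto_diff p) auto
          then show ?thesis using 1 by simp
        next
          case 2
          then have "(\<lambda>n. T n x) \<longlonglongrightarrow> pi / 2 - - (pi / 2)"
            unfolding T_def by (intro tendsto_diff p q) auto
          then show ?thesis using 2 by simp
        next
          case 3
          then have "(\<lambda>n. T n x) \<longlonglongrightarrow> - (pi / 2) - - (pi / 2)"
            unfolding T_def using ab by (intro tendsto_diff q) auto
          then show ?thesis using 3 by simp
        qed
        then show ?case unfolding h_def by (rule tendsto_of_real)
      qed
    qed
    have zero: "(LINT x|lborel. of_real (T n x) * f x) = 0" for n
    proof -
      define e where "e = 1 / real (Suc n)"
      have e: "e > 0" by (simp add: e_def)
      let ?M = "\<lambda>x t. f x * of_real (indicator {a..b} t * (e / ((t - x)\<^sup>2 + e\<^sup>2)))"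
      have int: "integrable (lborel \<Otimes>\<^sub>M lborel) (\<lambda>(x, t). ?M x t)"
      proof (rule integrable_quadratic_kernel[OF f isq, of e _ e])
        show "(\<lambda>(x, t). ?M x t) \<in> borel_measurable borel"
          unfolding borel_prod[symmetric] by measurable
        show "cmod (case (x, t) of (x, t) \<Rightarrow> ?M x t) \<le> e * (cmod (f x) * cmod (of_real (indicator {a..b} t)) / ((t - x)\<^sup>2 + e\<^sup>2))" for x t
          using e by (auto simp: norm_mult norm_divide indicator_def mult.commute simp flip: of_real_power of_real_diff of_real_add)
      qed (use e in auto)
      have i1: "(LINT t|lborel. ?M x t) = of_real (T n x) * f x" for x
        using Tint[of n x] by (simp add: has_bochner_integral_iff e_def mult.commute del: of_real_mult of_real_divide)
      have i2: "(LINT x|lborel. ?M x t) = 0" for t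
      proof -
        have k: "kern (Complex t e) x - kern (Complex t (- e)) x = 2 * \<i> * of_real (e / ((t - x)\<^sup>2 + e\<^sup>2))" for x
        proof -
          have "Complex t e - Complex t (- e) = 2 * \<i> * of_real e" by (simp add: complex_eq_iff)
          moreover have "kern (Complex t e) x * kern (Complex t (- e)) x = of_real (1 / ((t - x)\<^sup>2 + e\<^sup>2))"
          proof -
            have "(of_real x - Complex t e) * (of_real x - Complex t (- e)) = of_real ((t - x)\<^sup>2 + e\<^sup>2)"
              by (simp add: complex_eq_iff power2_eq_square algebra_simps)
            then show ?thesis by (simp add: kern_def flip: times_divide_times_eq)
          qed
          ultimately show ?thesis using e by (simp add: kern_diff)
        qed
        have "2 * \<i> * (LINT x|lborel. ?M x t) =
            (LINT x|lborel. of_real (indicator {a..b} t) * (f x * kern (Complex t e) x - f x * kern (Complex t (- e)) x))"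
          unfolding right_diff_distrib[symmetric] k integral_mult_right_zero[symmetric]
          by (rule Bochner_Integration.integral_cong) simp_all
        also have "\<dots> = of_real (indicator {a..b} t) * (cauchy f (Complex t e) - cauchy f (Complex t (- e)))"
          unfolding cauchy_def integral_mult_right_zero using e f
          by (subst Bochner_Integration.integral_diff) (auto intro: mult_kern_integrable)
        also have "\<dots> = 0" using z e by simp
        finally show ?thesis by simp
      qed
      have "(LINT x|lborel. (LINT t|lborel. ?M x t)) = (LINT t|lborel. (LINT x|lborel. ?M x t))"
        using lborel_pair.Fubini_integral[OF int] by simp
      then show ?thesis by (simp only: i1 i2) simp
    qed
    have "(LINT x|lborel. h x * f x) = 0"
      using conv by (simp add: zero LIMSEQ_const_iff)
    moreover have "(LINT x|lborel. h x * f x) = of_real pi * (LINT x:{a..b}|lborel. f x)"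
      unfolding set_lebesgue_integral_def integral_mult_right_zero[symmetric]
      by (rule Bochner_Integration.integral_cong) (auto simp: h_def indicator_def)
    ultimately show ?thesis by simp
  qed
  \<comment> \<open>Square-integrability gives integrability only on bounded sets, so the criterion
    on intervals is applied to truncations of \<open>f\<close>.\<close>
  have "AE x in lborel. indicator {- real n..real n} x * f x = 0" for n
  proof (rule integral_interval_zero_imp_AE_zero)
    let ?i = "\<lambda>x. indicator {- real n..real n} x :: complex"
    show "integrable lborel (\<lambda>x. ?i x * f x)"
      by (rule square_integrable_mult[OF square_integrable_indicator_Icc f])
    fix a b :: real
    have "(LINT x:{a..b}|lborel. ?i x * f x) = (LINT x:{max a (- real n)..min b (real n)}|lborel. f x)"
      unfolding set_lebesgue_integral_def
      by (rule Bochner_Integration.integral_cong) (auto simp: indicator_def)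
    also have "\<dots> = 0"
    proof (cases "max a (- real n) \<le> min b (real n)")
      case True
      then show ?thesis by (rule main)
    next
      case False
      then have "{max a (- real n)..min b (real n)} = {}" by simp
      then show ?thesis by (simp only:) (simp add: set_lebesgue_integral_def)
    qed
    finally show "(LINT x:{a..b}|lborel. ?i x * f x) = 0" .
  qed
  then have "AE x in lborel. \<forall>n. indicator {- real n..real n} x * f x = 0"
    unfolding AE_all_countable by blast
  then show ?thesis
  proof eventually_elim
    case (elim x)
    obtain n where "\<bar>x\<bar> \<le> real n" using real_arch_simple by blast
    then have "x \<in> {- real n..real n}" by auto
    with elim[rule_format, of n] show ?case by simp
  qed
qed

section \<open>Boundary values and the maximal operator\<close>

definition kern_L2 :: "complex \<Rightarrow> L2" where
  "kern_L2 l = abs_L2 (kern l)"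

text \<open>The resolvent at \<open>l\<close> of multiplication by the independent variable.\<close>

definition mult_kern :: "complex \<Rightarrow> L2 \<Rightarrow> L2" where
  "mult_kern l s = abs_L2 (\<lambda>x. rep_L2 s x * kern l x)"

lemma rep_kern_L2: "Im l \<noteq> 0 \<Longrightarrow> AE x in lborel. rep_L2 (kern_L2 l) x = kern l x"
  unfolding kern_L2_def by (intro rep_abs_L2) auto

lemma rep_mult_kern: "Im l \<noteq> 0 \<Longrightarrow> AE x in lborel. rep_L2 (mult_kern l s) x = rep_L2 s x * kern l x"
  unfolding mult_kern_def by (intro rep_abs_L2) auto

lemma mult_kern_add_scale:
  assumes "Im l \<noteq> 0"
  shows "mult_kern l (s + a *\<^sub>C t) = mult_kern l s + a *\<^sub>C mult_kern l t"
  using rep_mult_kern[OF assms, of "s + a *\<^sub>C t"] rep_mult_kern[OF assms, of s] rep_mult_kern[OF assms, of t]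
    rep_add[of s "a *\<^sub>C t"] rep_scale[of a t] rep_add[of "mult_kern l s" "a *\<^sub>C mult_kern l t"]
    rep_scale[of a "mult_kern l t"]
  by (intro L2_eqI, eventually_elim) (simp add: algebra_simps)

lemma norm_mult_kern:
  assumes "Im l \<noteq> 0"
  shows "norm (mult_kern l s) \<le> norm s / \<bar>Im l\<bar>"
proof -
  have sq: "(\<lambda>x. rep_L2 s x * kern l x) \<in> square_integrable" using assms by auto
  have "(norm (mult_kern l s))\<^sup>2 = (LINT x|lborel. (cmod (rep_L2 s x * kern l x))\<^sup>2)"
    unfolding mult_kern_def by (rule norm_abs_L2_sq[OF sq])
  also have "\<dots> \<le> (LINT x|lborel. (1 / \<bar>Im l\<bar>)\<^sup>2 * (cmod (rep_L2 s x))\<^sup>2)"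
  proof (rule integral_mono)
    fix x
    have "(cmod (kern l x))\<^sup>2 \<le> (1 / \<bar>Im l\<bar>)\<^sup>2"
      by (intro power_mono cmod_kern_le assms) auto
    from mult_left_mono[OF this, of "(cmod (rep_L2 s x))\<^sup>2"]
    show "(cmod (rep_L2 s x * kern l x))\<^sup>2 \<le> (1 / \<bar>Im l\<bar>)\<^sup>2 * (cmod (rep_L2 s x))\<^sup>2"
      by (simp add: norm_mult power_mult_distrib mult.commute)
  qed (use sq square_integrable_norm_sq[OF rep_L2_square_integrable[of s]] in \<open>auto simp: square_integrable_def\<close>)
  also have "\<dots> = (1 / \<bar>Im l\<bar>)\<^sup>2 * (norm s)\<^sup>2"
    using norm_abs_L2_sq[OF rep_L2_square_integrable[of s]] by simp
  also have "\<dots> = (norm s / \<bar>Im l\<bar>)\<^sup>2" by (simp add: power_divide)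
  finally show ?thesis by (rule power2_le_imp_le) simp
qed

text \<open>A relational form of \<open>\<Gamma>\<^sub>1 u = a\<close> and
  \<open>\<Gamma>\<^sub>2 u = c\<close> that includes the existence of both values, so that
  linearity carries no side conditions about \<open>Lim\<close> and \<open>THE\<close>.\<close>

definition has_boundary_values :: "L2 \<Rightarrow> complex \<Rightarrow> complex \<Rightarrow> bool" where
  "has_boundary_values u a c \<longleftrightarrow> (\<lambda>x. of_real x * rep_L2 u x - c) \<in> square_integrable \<and> (sym_integral u \<longlongrightarrow> a) at_top"

lemma square_integrable_const_iff: "(\<lambda>x. c) \<in> square_integrable \<longleftrightarrow> c = 0"
proof
  assume "(\<lambda>x. c) \<in> square_integrable"
  then have "integrable lborel (\<lambda>x::real. (cmod c)\<^sup>2)" by (simp add: square_integrable_def)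
  then have "(\<integral>\<^sup>+x. ennreal ((cmod c)\<^sup>2) \<partial>(lborel :: real measure)) < \<infinity>"
    by (simp add: integrable_iff_bounded)
  then show "c = 0" by (simp add: ennreal_mult_less_top)
qed (simp add: square_integrable_def)

lemma multiplier_unique:
  assumes "(\<lambda>x. f x - c) \<in> square_integrable" "(\<lambda>x. f x - d) \<in> square_integrable"
  shows "c = d"
  using square_integrable_diff[OF assms(2,1)] by (simp add: square_integrable_const_iff)

lemma has_boundary_valuesD:
  assumes "has_boundary_values u a c"
  shows "u \<in> max_dom" "\<Gamma>\<^sub>1 u = a" "\<Gamma>\<^sub>2 u = c"
proof -
  show "u \<in> max_dom" using assms by (auto simp: has_boundary_values_def max_dom_def)
  show "\<Gamma>\<^sub>1 u = a" using assms by (simp add: has_boundary_values_def \<Gamma>\<^sub>1_def tendsto_Lim)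
  show "\<Gamma>\<^sub>2 u = c"
    unfolding \<Gamma>\<^sub>2_def using assms multiplier_unique[of "\<lambda>x. of_real x * rep_L2 u x"]
    by (intro the_equality) (auto simp: has_boundary_values_def)
qed

lemma rep_set_integrable: "set_integrable lborel {-R..R} (rep_L2 u)"
proof -
  from square_integrable_mult[OF square_integrable_indicator_Icc rep_L2_square_integrable[of u]]
  show ?thesis unfolding set_integrable_def
    by (rule Bochner_Integration.integrable_cong[THEN iffD1, rotated -1]) (auto simp: indicator_def)
qed

lemma sym_integral_cong:
  assumes "AE x in lborel. rep_L2 u x = f x" "f \<in> borel_measurable borel"
  shows "sym_integral u R = (LINT x:{-R..R}|lborel. f x)"
  unfolding sym_integral_def set_lebesgue_integral_def
  using assms square_integrable_measurable[OF rep_L2_square_integrable[of u]]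
  by (intro integral_cong_AE) (auto elim: AE_mp)

lemma has_boundary_values_add_scale:
  assumes u: "has_boundary_values u a c" and v: "has_boundary_values v a' c'"
  shows "has_boundary_values (u + k *\<^sub>C v) (a + k * a') (c + k * c')"
  unfolding has_boundary_values_def
proof
  have rep: "AE x in lborel. rep_L2 (u + k *\<^sub>C v) x = rep_L2 u x + k * rep_L2 v x"
    using rep_add[of u "k *\<^sub>C v"] rep_scale[of k v] by eventually_elim simp
  note [measurable] = square_integrable_measurable[OF rep_L2_square_integrable]
  show "(\<lambda>x. of_real x * rep_L2 (u + k *\<^sub>C v) x - (c + k * c')) \<in> square_integrable"
  proof (rule square_integrable_cong_AE)
    show "(\<lambda>x. (of_real x * rep_L2 u x - c) + k * (of_real x * rep_L2 v x - c')) \<in> square_integrable"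
      using u v by (intro square_integrable_add square_integrable_scale) (auto simp: has_boundary_values_def)
    show "AE x in lborel. of_real x * rep_L2 (u + k *\<^sub>C v) x - (c + k * c') =
        (of_real x * rep_L2 u x - c) + k * (of_real x * rep_L2 v x - c')"
      using rep by eventually_elim (simp add: algebra_simps)
  qed measurable
  have "sym_integral (u + k *\<^sub>C v) R = sym_integral u R + k * sym_integral v R" for R
  proof -
    have "sym_integral (u + k *\<^sub>C v) R = (LINT x:{-R..R}|lborel. rep_L2 u x + k * rep_L2 v x)"
      by (rule sym_integral_cong[OF rep]) measurable
    also have "\<dots> = sym_integral u R + k * sym_integral v R"
      unfolding sym_integral_def
      by (subst set_integral_add) (auto intro!: rep_set_integrable set_integrable_mult_right)
    finally show ?thesis .
  qed
  then have "sym_integral (u + k *\<^sub>C v) = (\<lambda>R. sym_integral u R + k * sym_integral v R)" by (rule ext)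
  then show "(sym_integral (u + k *\<^sub>C v) \<longlongrightarrow> a + k * a') at_top"
    using u v unfolding has_boundary_values_def by (simp add: tendsto_add tendsto_mult_left)
qed

lemma mult_kern_eq:
  assumes "Im l \<noteq> 0"
  shows "of_real x * kern l x = 1 + l * kern l x"
  using kern_denom_nonzero[OF assms, of x] by (simp add: kern_def field_simps)

lemma has_boundary_values_kern:
  assumes l: "Im l \<noteq> 0"
  shows "has_boundary_values (kern_L2 l) (of_real (sgn (Im l) * pi) * \<i>) 1"
  unfolding has_boundary_values_def
proof
  note [measurable] = square_integrable_measurable[OF rep_L2_square_integrable]
  show "(\<lambda>x. of_real x * rep_L2 (kern_L2 l) x - 1) \<in> square_integrable"
  proof (rule square_integrable_cong_AE)
    show "(\<lambda>x. l * kern l x) \<in> square_integrable" using l by (intro square_integrable_scale) auto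
    show "AE x in lborel. of_real x * rep_L2 (kern_L2 l) x - 1 = l * kern l x"
      using rep_kern_L2[OF l] by eventually_elim (simp add: mult_kern_eq[OF l])
  qed measurable
  have "sym_integral (kern_L2 l) = (\<lambda>R. LINT x:{-R..R}|lborel. kern l x)"
    by (rule ext, rule sym_integral_cong[OF rep_kern_L2[OF l]]) measurable
  then show "(sym_integral (kern_L2 l) \<longlongrightarrow> of_real (sgn (Im l) * pi) * \<i>) at_top"
    using kern_symmetric_tendsto[OF l] by simp
qed

lemma has_boundary_values_mult_kern:
  assumes l: "Im l \<noteq> 0"
  shows "has_boundary_values (mult_kern l s) (cauchy (rep_L2 s) l) 0"
  unfolding has_boundary_values_def
proof
  note [measurable] = square_integrable_measurable[OF rep_L2_square_integrable]
  show "(\<lambda>x. of_real x * rep_L2 (mult_kern l s) x - 0) \<in> square_integrable"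
  proof (rule square_integrable_cong_AE)
    show "(\<lambda>x. rep_L2 s x + l * (rep_L2 s x * kern l x)) \<in> square_integrable"
      using l by (intro square_integrable_add square_integrable_scale) auto
    show "AE x in lborel. of_real x * rep_L2 (mult_kern l s) x - 0 = rep_L2 s x + l * (rep_L2 s x * kern l x)"
      using rep_mult_kern[OF l, of s]
    proof eventually_elim
      case (elim x)
      have "of_real x * (rep_L2 s x * kern l x) = rep_L2 s x * (of_real x * kern l x)" by simp
      with elim show ?case by (simp only: mult_kern_eq[OF l]) (simp add: algebra_simps)
    qed
  qed measurable
  have "sym_integral (mult_kern l s) = (\<lambda>R. LINT x:{-R..R}|lborel. rep_L2 s x * kern l x)"
    by (rule ext, rule sym_integral_cong[OF rep_mult_kern[OF l]]) measurable
  then show "(sym_integral (mult_kern l s) \<longlongrightarrow> cauchy (rep_L2 s) l) at_top"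
    using set_LINT_symmetric_tendsto[OF mult_kern_integrable[OF rep_L2_square_integrable[of s] l]]
    by (simp add: cauchy_def)
qed

definition mult_x :: "L2 \<Rightarrow> complex \<Rightarrow> L2" where
  "mult_x u c = abs_L2 (\<lambda>x. of_real x * rep_L2 u x - c)"

text \<open>Divide \<open>(x - l) u = (x u - c - l u) + c\<close> by \<open>x - l\<close>. Both
  summands have explicit boundary values.\<close>

lemma max_dom_decomp:
  assumes u: "(\<lambda>x. of_real x * rep_L2 u x - c) \<in> square_integrable" and l: "Im l \<noteq> 0"
  shows "u = mult_kern l (mult_x u c - l *\<^sub>C u) + c *\<^sub>C kern_L2 l"
  using rep_abs_L2[OF u] rep_mult_kern[OF l, of "mult_x u c - l *\<^sub>C u"] rep_diff[of "mult_x u c" "l *\<^sub>C u"]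
    rep_scale[of l u] rep_add[of "mult_kern l (mult_x u c - l *\<^sub>C u)" "c *\<^sub>C kern_L2 l"]
    rep_scale[of c "kern_L2 l"] rep_kern_L2[OF l]
proof (intro L2_eqI, eventually_elim)
  case (elim x)
  have "rep_L2 (mult_kern l (mult_x u c - l *\<^sub>C u) + c *\<^sub>C kern_L2 l) x =
      (of_real x * rep_L2 u x - c - l * rep_L2 u x) * kern l x + c * kern l x"
    using elim by (simp add: mult_x_def)
  also have "\<dots> = rep_L2 u x * (of_real x * kern l x - l * kern l x)"
    by (simp add: algebra_simps)
  finally show ?case by (simp add: mult_kern_eq[OF l])
qed

text \<open>Membership in \<open>max_dom\<close> asks only for the constant \<open>c\<close>.
  Convergence of the symmetric integrals follows from the decomposition at any non-real point, here
  \<open>\<i>\<close>.\<close>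

lemma max_dom_boundary_values: "u \<in> max_dom \<Longrightarrow> has_boundary_values u (\<Gamma>\<^sub>1 u) (\<Gamma>\<^sub>2 u)"
proof -
  assume "u \<in> max_dom"
  then obtain c where c: "(\<lambda>x. of_real x * rep_L2 u x - c) \<in> square_integrable"
    by (auto simp: max_dom_def)
  have "\<exists>a. has_boundary_values u a c"
    using has_boundary_values_add_scale[OF has_boundary_values_mult_kern has_boundary_values_kern, of \<i> \<i> "mult_x u c - \<i> *\<^sub>C u" c] max_dom_decomp[OF c, of \<i>]
    by auto
  then show ?thesis using has_boundary_valuesD(2,3) by blast
qed

lemma mult_x_decomp:
  assumes l: "Im l \<noteq> 0"
  shows "mult_x (mult_kern l t + c *\<^sub>C kern_L2 l) c = t + l *\<^sub>C (mult_kern l t + c *\<^sub>C kern_L2 l)"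
  unfolding mult_x_def
proof (rule abs_L2_eqI)
  let ?u = "mult_kern l t + c *\<^sub>C kern_L2 l"
  have "has_boundary_values ?u (cauchy (rep_L2 t) l + c * (of_real (sgn (Im l) * pi) * \<i>)) (0 + c * 1)"
    by (intro has_boundary_values_add_scale has_boundary_values_mult_kern has_boundary_values_kern l)
  then show "(\<lambda>x. of_real x * rep_L2 ?u x - c) \<in> square_integrable"
    by (simp add: has_boundary_values_def)
  show "AE x in lborel. of_real x * rep_L2 ?u x - c = rep_L2 (t + l *\<^sub>C ?u) x"
    using rep_add[of t "l *\<^sub>C ?u"] rep_scale[of l ?u] rep_add[of "mult_kern l t" "c *\<^sub>C kern_L2 l"]
      rep_scale[of c "kern_L2 l"] rep_kern_L2[OF l] rep_mult_kern[OF l, of t]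
  proof eventually_elim
    case (elim x)
    then have u: "rep_L2 ?u x = (rep_L2 t x + c) * kern l x" by (simp add: algebra_simps)
    have "of_real x * ((rep_L2 t x + c) * kern l x) = (rep_L2 t x + c) * (of_real x * kern l x)" by simp
    also have "\<dots> = (rep_L2 t x + c) * (1 + l * kern l x)" by (simp only: mult_kern_eq[OF l])
    finally show ?case using elim(1,2) by (simp add: u algebra_simps)
  qed
qed

lemma friedrichs_dom_iff: "f \<in> friedrichs_dom \<longleftrightarrow> has_boundary_values f 0 0"
  by (simp add: friedrichs_dom_def has_boundary_values_def)

text \<open>Green's identity. The two integrands differ by \<open>cnj c * f\<close>, which is
  integrable as a difference of integrable functions; its integral is therefore the principal value,
  and that is zero by the boundary condition on \<open>f\<close>.\<close>

lemma cinner_mult_x: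
  assumes f: "has_boundary_values f 0 0" and u: "(\<lambda>x. of_real x * rep_L2 u x - c) \<in> square_integrable"
  shows "cinner (mult_x f 0) u = cinner f (mult_x u c)"
proof -
  have xf: "(\<lambda>x. of_real x * rep_L2 f x) \<in> square_integrable" using f by (simp add: has_boundary_values_def)
  have 1: "cinner (mult_x f 0) u = (LINT x|lborel. (of_real x * rep_L2 f x) * cnj (rep_L2 u x))"
    using cinner_abs[OF xf rep_L2_square_integrable[of u]] by (simp add: mult_x_def)
  have 2: "cinner f (mult_x u c) = (LINT x|lborel. rep_L2 f x * cnj (of_real x * rep_L2 u x - c))"
    using cinner_abs[OF rep_L2_square_integrable[of f] u] by (simp add: mult_x_def)
  have i1: "integrable lborel (\<lambda>x. (of_real x * rep_L2 f x) * cnj (rep_L2 u x))"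
    by (intro square_integrable_mult xf square_integrable_cnj) simp
  have i2: "integrable lborel (\<lambda>x. rep_L2 f x * cnj (of_real x * rep_L2 u x - c))"
    by (intro square_integrable_mult square_integrable_cnj[OF u]) simp
  have eq: "(of_real x * rep_L2 f x) * cnj (rep_L2 u x) - rep_L2 f x * cnj (of_real x * rep_L2 u x - c) = cnj c * rep_L2 f x" for x
    by (simp add: algebra_simps)
  have i3: "integrable lborel (\<lambda>x. cnj c * rep_L2 f x)"
    using Bochner_Integration.integrable_diff[OF i1 i2] by (simp only: eq)
  have "((\<lambda>R. LINT x:{-R..R}|lborel. cnj c * rep_L2 f x) \<longlongrightarrow> (LINT x|lborel. cnj c * rep_L2 f x)) at_top"
    by (rule set_LINT_symmetric_tendsto[OF i3])
  moreover have "((\<lambda>R. LINT x:{-R..R}|lborel. cnj c * rep_L2 f x) \<longlongrightarrow> 0) at_top"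
  proof -
    have "((\<lambda>R. cnj c * sym_integral f R) \<longlongrightarrow> cnj c * 0) at_top"
      using f by (intro tendsto_intros) (simp add: has_boundary_values_def)
    then show ?thesis by (simp add: sym_integral_def)
  qed
  ultimately have z: "(LINT x|lborel. cnj c * rep_L2 f x) = 0"
    using tendsto_unique trivial_limit_at_top_linorder by blast
  have "cinner (mult_x f 0) u - cinner f (mult_x u c) = 0"
    unfolding 1 2 Bochner_Integration.integral_diff[OF i1 i2, symmetric] eq by (rule z)
  then show ?thesis by simp
qed

lemma cinner_kern_L2:
  assumes "Im l \<noteq> 0"
  shows "cinner (kern_L2 l) g = cauchy (\<lambda>x. cnj (rep_L2 g x)) l"
  using cinner_abs[OF kern_square_integrable[OF assms] rep_L2_square_integrable[of g]]
  by (simp add: kern_L2_def cauchy_def mult.commute)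

lemma cinner_mult_kern:
  assumes "Im l \<noteq> 0"
  shows "cinner (mult_kern l s) g = cauchy (\<lambda>x. rep_L2 s x * cnj (rep_L2 g x)) l"
  using cinner_abs[OF mult_kern_square_integrable[OF rep_L2_square_integrable[of s] assms] rep_L2_square_integrable[of g]]
  by (simp add: mult_kern_def cauchy_def mult_ac)

lemma cauchy_tendsto_zero:
  assumes f: "f \<in> square_integrable" and s: "s \<noteq> 0"
  shows "((\<lambda>y. cauchy f (Complex 0 (s * y))) \<longlongrightarrow> 0) at_top"
proof (rule Lim_null_comparison)
  show "\<forall>\<^sub>F y in at_top. norm (cauchy f (Complex 0 (s * y))) \<le> norm (abs_L2 f) * sqrt (pi / (\<bar>s\<bar> * y))"
    using eventually_gt_at_top[of 0]
  proof eventually_elim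
    case (elim y)
    then show ?case using cauchy_bound[OF f, of "Complex 0 (s * y)"] s by (simp add: abs_mult)
  qed
  have "\<bar>s\<bar> > 0" using s by simp
  then have "((\<lambda>y. sqrt (pi / (\<bar>s\<bar> * y))) \<longlongrightarrow> 0) at_top" by real_asymp
  from tendsto_mult_right_zero[OF this, of "norm (abs_L2 f)"]
  show "((\<lambda>y. norm (abs_L2 f) * sqrt (pi / (\<bar>s\<bar> * y))) \<longlongrightarrow> 0) at_top" .
qed

lemma L2_eq_zeroI:
  assumes "\<And>l. Im l \<noteq> 0 \<Longrightarrow> cauchy (rep_L2 w) l = 0"
  shows "w = 0"
  using cauchy_injective[OF rep_L2_square_integrable assms] rep_zero
  by (intro L2_eqI) auto

text \<open>Two kernels from the same half-plane have equal boundary values, so their difference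
  lies in the domain. The transform of the conjugate of \<open>w\<close> is thus constant on each
  half-plane; it tends to zero along the imaginary axis, and injectivity of the transform
  finishes.\<close>

lemma friedrichs_dom_dense:
  assumes w: "\<And>f. f \<in> friedrichs_dom \<Longrightarrow> cinner f w = 0"
  shows "w = 0"
proof -
  let ?w = "\<lambda>x. cnj (rep_L2 w x)"
  have wsq: "?w \<in> square_integrable" by (intro square_integrable_cnj) simp
  have same: "cauchy ?w l = cauchy ?w m" if "Im l \<noteq> 0" "Im m \<noteq> 0" "sgn (Im l) = sgn (Im m)" for l m
  proof -
    have "has_boundary_values (kern_L2 l + (-1) *\<^sub>C kern_L2 m) (of_real (sgn (Im l) * pi) * \<i> + (-1) * (of_real (sgn (Im m) * pi) * \<i>)) (1 + (-1) * 1)"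
      by (intro has_boundary_values_add_scale has_boundary_values_kern that)
    then have "kern_L2 l + (-1) *\<^sub>C kern_L2 m \<in> friedrichs_dom"
      using that by (simp add: friedrichs_dom_iff)
    from w[OF this] have "cinner (kern_L2 l) w = cinner (kern_L2 m) w"
      by (simp only: cinner_simps) simp
    then show ?thesis using that by (simp add: cinner_kern_L2)
  qed
  have z: "cauchy ?w l = 0" if "Im l \<noteq> 0" for l
  proof -
    have "((\<lambda>y. cauchy ?w (Complex 0 (sgn (Im l) * y))) \<longlongrightarrow> 0) at_top"
      using that by (intro cauchy_tendsto_zero wsq) (simp add: sgn_eq_0_iff)
    then have "((\<lambda>y::real. cauchy ?w l) \<longlongrightarrow> 0) at_top"
    proof (rule tendsto_cong[THEN iffD1, rotated])
      show "\<forall>\<^sub>F y in at_top. cauchy ?w (Complex 0 (sgn (Im l) * y)) = cauchy ?w l"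
        using eventually_gt_at_top[of 0]
        by eventually_elim (rule same, use that in \<open>auto simp: sgn_mult sgn_eq_0_iff\<close>)
    qed
    then show ?thesis by (simp add: tendsto_const_iff)
  qed
  show ?thesis
  proof (rule L2_eq_zeroI)
    fix l :: complex assume "Im l \<noteq> 0"
    then have "cauchy ?w (cnj l) = 0" by (intro z) simp
    then show "cauchy (rep_L2 w) l = 0" by (simp add: cauchy_cnj)
  qed
qed

text \<open>Green's identity turns the defining condition of the adjoint into orthogonality of one
  vector to \<open>friedrichs_dom\<close>, and density makes that vector zero. The rank-one term
  changes sides with \<open>\<phi>\<close> and \<open>\<psi>\<close> exchanged.\<close>

lemma max_op_iff:
  assumes u: "has_boundary_values u a c"
  shows "(u, v) \<in> max_op \<phi> \<psi> \<longleftrightarrow> v = mult_x u c + cinner u \<phi> *\<^sub>C \<psi>"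
proof -
  have uc: "(\<lambda>x. of_real x * rep_L2 u x - c) \<in> square_integrable" using u by (simp add: has_boundary_values_def)
  have "(u, v) \<in> max_op \<phi> \<psi> \<longleftrightarrow>
      (\<forall>f\<in>friedrichs_dom. cinner (mult_x f 0 + cinner f \<psi> *\<^sub>C \<phi>) u = cinner f v)"
    by (auto simp: max_op_def adjoint_op_def friedrichs_def mult_x_def)
  also have "\<dots> \<longleftrightarrow> (\<forall>f\<in>friedrichs_dom. cinner f (mult_x u c + cinner u \<phi> *\<^sub>C \<psi> - v) = 0)"
  proof (intro ball_cong refl)
    fix f assume "f \<in> friedrichs_dom"
    then have "cinner (mult_x f 0 + cinner f \<psi> *\<^sub>C \<phi>) u = cinner f (mult_x u c) + cinner f \<psi> * cinner \<phi> u"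
      by (simp add: cinner_simps cinner_mult_x[OF _ uc] friedrichs_dom_iff)
    moreover have "cinner f (mult_x u c + cinner u \<phi> *\<^sub>C \<psi> - v) =
        cinner f (mult_x u c) + cnj (cinner u \<phi>) * cinner f \<psi> - cinner f v"
      by (simp add: cinner_simps)
    moreover have "cnj (cinner u \<phi>) = cinner \<phi> u" by (rule cinner_commute[symmetric])
    ultimately show "cinner (mult_x f 0 + cinner f \<psi> *\<^sub>C \<phi>) u = cinner f v \<longleftrightarrow>
        cinner f (mult_x u c + cinner u \<phi> *\<^sub>C \<psi> - v) = 0"
      by (simp only: mult.commute right_minus_eq)
  qed
  also have "\<dots> \<longleftrightarrow> mult_x u c + cinner u \<phi> *\<^sub>C \<psi> - v = 0"
  proof
    assume "mult_x u c + cinner u \<phi> *\<^sub>C \<psi> - v = 0"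
    moreover have "cinner f 0 = 0" for f using cinner_scale_right[of f 0 0] by simp
    ultimately show "\<forall>f\<in>friedrichs_dom. cinner f (mult_x u c + cinner u \<phi> *\<^sub>C \<psi> - v) = 0" by simp
  next
    assume "\<forall>f\<in>friedrichs_dom. cinner f (mult_x u c + cinner u \<phi> *\<^sub>C \<psi> - v) = 0"
    then show "mult_x u c + cinner u \<phi> *\<^sub>C \<psi> - v = 0" by (intro friedrichs_dom_dense) blast
  qed
  finally show ?thesis by auto
qed

section \<open>The operator \<open>A_B\<close>, its solution operator and the vectors orthogonal to
  \<open>\<S>\<^sub>B\<close>\<close>

lemma max_op_add_scale:
  assumes "(u, v) \<in> max_op \<phi> \<psi>" "(u', v') \<in> max_op \<phi> \<psi>"
  shows "(u + k *\<^sub>C u', v + k *\<^sub>C v') \<in> max_op \<phi> \<psi>"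
  using assms by (fastforce simp: max_op_def adjoint_op_def cinner_simps)

lemma A_op_iff: "(u, v) \<in> A_op \<phi> \<psi> B \<longleftrightarrow> (\<exists>c. has_boundary_values u (B * c) c \<and> (u, v) \<in> max_op \<phi> \<psi>)"
proof
  assume "(u, v) \<in> A_op \<phi> \<psi> B"
  then have "u \<in> max_dom" "\<Gamma>\<^sub>1 u = B * \<Gamma>\<^sub>2 u" "(u, v) \<in> max_op \<phi> \<psi>"
    by (auto simp: A_op_def)
  then show "\<exists>c. has_boundary_values u (B * c) c \<and> (u, v) \<in> max_op \<phi> \<psi>"
    using max_dom_boundary_values[of u] by metis
next
  assume "\<exists>c. has_boundary_values u (B * c) c \<and> (u, v) \<in> max_op \<phi> \<psi>"
  then obtain c where c: "has_boundary_values u (B * c) c" and uv: "(u, v) \<in> max_op \<phi> \<psi>" by blast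
  show "(u, v) \<in> A_op \<phi> \<psi> B"
    unfolding A_op_def using has_boundary_valuesD[OF c] uv by simp
qed

text \<open>Only uniqueness is at stake in the definite description: the difference of two solutions
  satisfies the homogeneous boundary condition, hence is annihilated by \<open>A_B - m\<close>, and
  \<open>m\<close> is in the resolvent set.\<close>

lemma solution_opI:
  assumes m: "m \<in> resolvent_set (A_op \<phi> \<psi> B)"
    and w: "has_boundary_values w a c" "(w, m *\<^sub>C w) \<in> max_op \<phi> \<psi>"
  shows "solution_op \<phi> \<psi> B m (a - B * c) = w"
  unfolding solution_op_def
proof (rule the_equality)
  show "w \<in> max_dom \<and> (w, m *\<^sub>C w) \<in> max_op \<phi> \<psi> \<and> \<Gamma>\<^sub>1 w - B * \<Gamma>\<^sub>2 w = a - B * c"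
    using w has_boundary_valuesD[OF w(1)] by simp
  fix u assume u: "u \<in> max_dom \<and> (u, m *\<^sub>C u) \<in> max_op \<phi> \<psi> \<and> \<Gamma>\<^sub>1 u - B * \<Gamma>\<^sub>2 u = a - B * c"
  then have bu: "has_boundary_values u (\<Gamma>\<^sub>1 u) (\<Gamma>\<^sub>2 u)" using max_dom_boundary_values by blast
  have "has_boundary_values (u + (-1) *\<^sub>C w) (\<Gamma>\<^sub>1 u + (-1) * a) (\<Gamma>\<^sub>2 u + (-1) * c)"
    by (rule has_boundary_values_add_scale[OF bu w(1)])
  moreover have "\<Gamma>\<^sub>1 u + (-1) * a = B * (\<Gamma>\<^sub>2 u + (-1) * c)" using u by (simp add: algebra_simps)
  ultimately have "has_boundary_values (u - w) (B * (\<Gamma>\<^sub>2 u + (-1) * c)) (\<Gamma>\<^sub>2 u + (-1) * c)" by simp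
  moreover have "(u + (-1) *\<^sub>C w, m *\<^sub>C u + (-1) *\<^sub>C (m *\<^sub>C w)) \<in> max_op \<phi> \<psi>"
    using u w by (intro max_op_add_scale) auto
  ultimately have "(u - w, 0 + m *\<^sub>C (u - w)) \<in> A_op \<phi> \<psi> B"
    unfolding A_op_iff by (intro exI conjI) (assumption, simp add: L2.scale_right_diff_distrib)
  moreover have "(0, 0 + m *\<^sub>C 0) \<in> A_op \<phi> \<psi> B"
  proof -
    have "has_boundary_values (w + (-1) *\<^sub>C w) (a + (-1) * a) (c + (-1) * c)"
      by (intro has_boundary_values_add_scale w)
    then have "has_boundary_values 0 (B * 0) 0" by simp
    moreover have "(0, 0) \<in> max_op \<phi> \<psi>"
      using max_op_add_scale[OF w(2) w(2), of "-1"] by simp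
    ultimately show ?thesis unfolding A_op_iff by (intro exI[of _ 0]) simp
  qed
  ultimately have "u - w = 0"
    using m unfolding resolvent_set_def by blast
  then show "u = w" by simp
qed

text \<open>Change of base point. Adding \<open>m - d\<close> times the resolvent of
  \<open>w\<close> at \<open>m\<close> turns \<open>w\<close> into the solution \<open>w0\<close> at
  \<open>m\<close> with the same boundary datum. Conversely \<open>w - w0\<close> is
  \<open>d - m\<close> times the resolvent of \<open>w0\<close> at \<open>d\<close>, hence an
  element of \<open>\<S>\<^sub>B\<close>, to which \<open>g\<close> is orthogonal.\<close>

lemma orth_S_space_kernel:
  assumes m: "m \<in> resolvent_set (A_op \<phi> \<psi> B)" and d: "d \<in> resolvent_set (A_op \<phi> \<psi> B)"
    and g: "g \<in> orth (S_space \<phi> \<psi> B m)"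
    and w: "has_boundary_values w a c" "(w, d *\<^sub>C w) \<in> max_op \<phi> \<psi>"
  shows "cinner g w = cinner g (solution_op \<phi> \<psi> B m (a - B * c))"
proof -
  obtain r0 where r0: "(r0, w + m *\<^sub>C r0) \<in> A_op \<phi> \<psi> B"
    using m unfolding resolvent_set_def by blast
  then obtain c0 where c0: "has_boundary_values r0 (B * c0) c0" "(r0, w + m *\<^sub>C r0) \<in> max_op \<phi> \<psi>"
    by (auto simp: A_op_iff)
  define w0 where "w0 = w + (m - d) *\<^sub>C r0"
  have bw0: "has_boundary_values w0 (a + (m - d) * (B * c0)) (c + (m - d) * c0)"
    unfolding w0_def by (intro has_boundary_values_add_scale w c0)
  have "(w0, d *\<^sub>C w + (m - d) *\<^sub>C (w + m *\<^sub>C r0)) \<in> max_op \<phi> \<psi>"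
    unfolding w0_def by (intro max_op_add_scale w c0)
  moreover have "d *\<^sub>C w + (m - d) *\<^sub>C (w + m *\<^sub>C r0) = m *\<^sub>C w0"
    by (simp add: w0_def L2.scale_right_distrib L2.scale_left_diff_distrib algebra_simps)
  ultimately have mw0: "(w0, m *\<^sub>C w0) \<in> max_op \<phi> \<psi>" by simp
  have sol: "solution_op \<phi> \<psi> B m (a - B * c) = w0"
    using solution_opI[OF m bw0 mw0] by (simp add: algebra_simps)
  show ?thesis
  proof (cases "d = m")
    case True
    then show ?thesis using sol by (simp add: w0_def)
  next
    case False
    define k where "k = 1 / (d - m)"
    define r where "r = 0 + k *\<^sub>C (w + (-1) *\<^sub>C w0)"
    have k: "k * (d - m) = 1" using False by (simp add: k_def)
    have z: "has_boundary_values 0 0 0" "(0, 0) \<in> max_op \<phi> \<psi>"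
      using has_boundary_values_add_scale[OF w(1) w(1), of "-1"] max_op_add_scale[OF w(2) w(2), of "-1"] by simp_all
    have "has_boundary_values r (0 + k * (a + (-1) * (a + (m - d) * (B * c0)))) (0 + k * (c + (-1) * (c + (m - d) * c0)))"
      unfolding r_def by (intro has_boundary_values_add_scale w bw0 z)
    then have br: "has_boundary_values r (B * (k * (d - m) * c0)) (k * (d - m) * c0)"
      by (simp add: algebra_simps)
    have "(r, 0 + k *\<^sub>C (d *\<^sub>C w + (-1) *\<^sub>C (m *\<^sub>C w0))) \<in> max_op \<phi> \<psi>"
      unfolding r_def by (intro max_op_add_scale w mw0 z)
    moreover have "0 + k *\<^sub>C (d *\<^sub>C w + (-1) *\<^sub>C (m *\<^sub>C w0)) = (k * (d - m)) *\<^sub>C w0 + d *\<^sub>C r"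
      by (simp add: r_def L2.scale_right_distrib L2.scale_left_diff_distrib algebra_simps)
    ultimately have "(r, w0 + d *\<^sub>C r) \<in> max_op \<phi> \<psi>" by (simp add: k)
    then have r: "(r, w0 + d *\<^sub>C r) \<in> A_op \<phi> \<psi> B" using br by (auto simp: A_op_iff)
    have "resolvent (A_op \<phi> \<psi> B) d w0 = r"
      unfolding resolvent_def using d r unfolding resolvent_set_def by (intro the1_equality) auto
    then have "r \<in> S_space \<phi> \<psi> B m"
      unfolding S_space_def using d sol by (intro L2.span_base) (auto intro!: rev_image_eqI)
    then have "cinner g r = 0" using g by (simp add: orth_def)
    then have "cnj k * (cinner g w - cinner g w0) = 0"
      by (simp add: r_def cinner_simps)
    moreover have "k \<noteq> 0" using k by auto
    ultimately show ?thesis by (simp add: sol)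
  qed
qed

section \<open>The resolvent of the Friedrichs model\<close>

locale friedrichs_point =
  fixes \<phi> \<psi> :: L2 and B l :: complex
  assumes l: "Im l \<noteq> 0"
begin

definition p where "p = cinner (mult_kern l \<psi>) \<phi>"
definition q where "q = cinner (kern_L2 l) \<phi>"
definition r where "r = cauchy (rep_L2 \<psi>) l"
definition \<sigma> :: complex where "\<sigma> = of_real (sgn (Im l) * pi) * \<i>"
definition det where "det = (B - \<sigma>) * (1 + p) + q * r"
text \<open>Cramer's rule for \<open>(1 + p) * k - q * c = cinner (mult_kern l s) \<phi>\<close> and
  \<open>r * k + (B - \<sigma>) * c = cauchy (rep_L2 s) l\<close>, where \<open>k\<close> stands for
  \<open>cinner u \<phi>\<close> and \<open>c\<close> for \<open>\<Gamma>\<^sub>2 u\<close>. The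
  first equation is the pairing of \<open>u\<close> with \<open>\<phi>\<close>, the second the
  boundary condition.\<close>

definition coeff1 where
  "coeff1 s = ((B - \<sigma>) * cinner (mult_kern l s) \<phi> + q * cauchy (rep_L2 s) l) / det"
definition coeff2 where
  "coeff2 s = ((1 + p) * cauchy (rep_L2 s) l - r * cinner (mult_kern l s) \<phi>) / det"
definition sol where
  "sol s = (mult_kern l s + (- coeff1 s) *\<^sub>C mult_kern l \<psi>) + coeff2 s *\<^sub>C kern_L2 l"

lemma has_boundary_values_general:
  "has_boundary_values ((mult_kern l s + (- k) *\<^sub>C mult_kern l \<psi>) + c *\<^sub>C kern_L2 l)
    (cauchy (rep_L2 s) l - k * r + c * \<sigma>) c"
  using has_boundary_values_add_scale[OF has_boundary_values_add_scale[OF has_boundary_values_mult_kern[OF l, of s] has_boundary_values_mult_kern[OF l, of \<psi>], of "- k"] has_boundary_values_kern[OF l], of c]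
  by (simp add: r_def \<sigma>_def)

lemma cinner_general:
  "cinner ((mult_kern l s + (- k) *\<^sub>C mult_kern l \<psi>) + c *\<^sub>C kern_L2 l) \<phi> =
    cinner (mult_kern l s) \<phi> - k * p + c * q"
  by (simp add: cinner_simps p_def q_def)

lemma mult_x_general:
  "mult_x ((mult_kern l s + (- k) *\<^sub>C mult_kern l \<psi>) + c *\<^sub>C kern_L2 l) c =
    s + (- k) *\<^sub>C \<psi> + l *\<^sub>C ((mult_kern l s + (- k) *\<^sub>C mult_kern l \<psi>) + c *\<^sub>C kern_L2 l)"
  using mult_x_decomp[OF l, of "s + (- k) *\<^sub>C \<psi>" c] by (simp only: mult_kern_add_scale[OF l])

text \<open>For \<open>s = 0\<close> the choice \<open>k = q\<close>, \<open>c = 1 + p\<close>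
  solves the pairing equation whatever \<open>B\<close> is. The boundary equation then fails by the
  determinant: \<open>\<Gamma>\<^sub>1 w - B * \<Gamma>\<^sub>2 w = - det\<close>.\<close>

lemma kernel_element:
  defines "w \<equiv> (1 + p) *\<^sub>C kern_L2 l - q *\<^sub>C mult_kern l \<psi>"
  shows "has_boundary_values w (\<sigma> * (1 + p) - q * r) (1 + p)" and "(w, l *\<^sub>C w) \<in> max_op \<phi> \<psi>"
proof -
  have mk0: "mult_kern l 0 = 0"
    using mult_kern_add_scale[OF l, of 0 "-1" 0] by simp
  have w: "w = (mult_kern l 0 + (- q) *\<^sub>C mult_kern l \<psi>) + (1 + p) *\<^sub>C kern_L2 l"
    by (simp add: w_def mk0)
  have c0: "cauchy (rep_L2 0) l = 0"
    using has_boundary_valuesD(2)[OF has_boundary_values_mult_kern[OF l, of 0]] has_boundary_valuesD(2)[OF has_boundary_values_add_scale[OF has_boundary_values_mult_kern[OF l, of 0] has_boundary_values_mult_kern[OF l, of 0], of "-1"]]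
    by (simp add: mk0)
  have "has_boundary_values w (cauchy (rep_L2 0) l - q * r + (1 + p) * \<sigma>) (1 + p)"
    unfolding w by (rule has_boundary_values_general)
  moreover have "cauchy (rep_L2 0) l - q * r + (1 + p) * \<sigma> = \<sigma> * (1 + p) - q * r"
    by (simp add: c0 mult.commute)
  ultimately show b: "has_boundary_values w (\<sigma> * (1 + p) - q * r) (1 + p)" by (simp only:)
  have ci: "cinner w \<phi> = q"
  proof -
    have "cinner (mult_kern l 0) \<phi> = 0" using cinner_scale_left[of 0 0 \<phi>] by (simp add: mk0)
    then show ?thesis
      unfolding w cinner_general by (simp add: algebra_simps)
  qed
  have "mult_x w (1 + p) = 0 + (- q) *\<^sub>C \<psi> + l *\<^sub>C w"
    unfolding w by (rule mult_x_general)
  then show "(w, l *\<^sub>C w) \<in> max_op \<phi> \<psi>"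
    unfolding max_op_iff[OF b] ci by simp
qed

text \<open>Decomposing \<open>u\<close> at \<open>l\<close> leaves only the two scalars
  \<open>cinner u \<phi>\<close> and \<open>\<Gamma>\<^sub>2 u\<close> unknown; the linear system
  determines them, and its solution conversely yields an element of the graph.\<close>

lemma A_op_resolvent_eq:
  assumes det: "det \<noteq> 0"
  shows "(u, s + l *\<^sub>C u) \<in> A_op \<phi> \<psi> B \<longleftrightarrow> u = sol s"
proof
  assume "(u, s + l *\<^sub>C u) \<in> A_op \<phi> \<psi> B"
  then obtain c where b: "has_boundary_values u (B * c) c" and m: "(u, s + l *\<^sub>C u) \<in> max_op \<phi> \<psi>"
    by (auto simp: A_op_iff)
  define k where "k = cinner u \<phi>"
  have "s + l *\<^sub>C u = mult_x u c + k *\<^sub>C \<psi>" using m unfolding max_op_iff[OF b] k_def .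
  then have "mult_x u c - l *\<^sub>C u = s - k *\<^sub>C \<psi>" by (simp add: algebra_simps)
  then have "mult_x u c - l *\<^sub>C u = s + (- k) *\<^sub>C \<psi>" by simp
  then have "u = mult_kern l (s + (- k) *\<^sub>C \<psi>) + c *\<^sub>C kern_L2 l"
    using max_dom_decomp[of u c l] b l unfolding has_boundary_values_def by simp
  then have u: "u = (mult_kern l s + (- k) *\<^sub>C mult_kern l \<psi>) + c *\<^sub>C kern_L2 l"
    by (simp only: mult_kern_add_scale[OF l])
  have "cinner u \<phi> = cinner (mult_kern l s) \<phi> - k * p + c * q"
    unfolding u by (rule cinner_general)
  then have k: "k = cinner (mult_kern l s) \<phi> - k * p + c * q"
    by (simp only: k_def)
  have "B * c = cauchy (rep_L2 s) l - k * r + c * \<sigma>"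
    using has_boundary_valuesD(2)[OF b] has_boundary_valuesD(2)[OF has_boundary_values_general[of s k c]] by (simp only: u[symmetric])
  then have c: "cauchy (rep_L2 s) l = k * r + (B - \<sigma>) * c" by (simp add: algebra_simps)
  have k: "cinner (mult_kern l s) \<phi> = (1 + p) * k - q * c"
    using k by (simp add: algebra_simps)
  have "coeff1 s = k"
    unfolding coeff1_def c k using det by (simp add: field_simps) (simp add: det_def algebra_simps)
  moreover have "coeff2 s = c"
    unfolding coeff2_def c k using det by (simp add: field_simps) (simp add: det_def algebra_simps)
  ultimately show "u = sol s" by (simp add: sol_def u)
next
  assume u: "u = sol s"
  have eq1: "(1 + p) * coeff1 s - q * coeff2 s = cinner (mult_kern l s) \<phi>"
  proof -
    have "((1 + p) * coeff1 s - q * coeff2 s) * det = cinner (mult_kern l s) \<phi> * det"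
      using det by (simp add: coeff1_def coeff2_def left_diff_distrib) (simp add: det_def algebra_simps)
    then show ?thesis using det by simp
  qed
  have eq2: "r * coeff1 s + (B - \<sigma>) * coeff2 s = cauchy (rep_L2 s) l"
  proof -
    have "(r * coeff1 s + (B - \<sigma>) * coeff2 s) * det = cauchy (rep_L2 s) l * det"
      using det by (simp add: coeff1_def coeff2_def distrib_right) (simp add: det_def algebra_simps)
    then show ?thesis using det by simp
  qed
  have "cauchy (rep_L2 s) l - coeff1 s * r + coeff2 s * \<sigma> = B * coeff2 s"
    unfolding eq2[symmetric] by (simp add: algebra_simps)
  then have b: "has_boundary_values u (B * coeff2 s) (coeff2 s)"
    using has_boundary_values_general[of s "coeff1 s" "coeff2 s"] by (simp add: u sol_def)
  have "cinner u \<phi> = coeff1 s"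
    unfolding u sol_def cinner_general eq1[symmetric] by (simp add: algebra_simps)
  moreover have "mult_x u (coeff2 s) = s + (- coeff1 s) *\<^sub>C \<psi> + l *\<^sub>C u"
    unfolding u sol_def by (rule mult_x_general)
  ultimately have "(u, s + l *\<^sub>C u) \<in> max_op \<phi> \<psi>"
    unfolding max_op_iff[OF b] by simp
  with b show "(u, s + l *\<^sub>C u) \<in> A_op \<phi> \<psi> B" by (auto simp: A_op_iff)
qed

text \<open>\<open>mult_kern l\<close>, the pairing with \<open>\<phi>\<close> and the Cauchy
  transform at \<open>l\<close> are all bounded in \<open>s\<close>, hence so are both coefficients
  and \<open>sol\<close>.\<close>

lemma resolvent_setI:
  assumes det: "det \<noteq> 0"
  shows "l \<in> resolvent_set (A_op \<phi> \<psi> B)"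
proof -
  define K1 where "K1 = norm \<phi> / \<bar>Im l\<bar>"
  define K2 where "K2 = sqrt (pi / \<bar>Im l\<bar>)"
  have a: "cmod (cinner (mult_kern l s) \<phi>) \<le> K1 * norm s" for s
  proof -
    have "cmod (cinner (mult_kern l s) \<phi>) \<le> norm (mult_kern l s) * norm \<phi>" by (rule cinner_bound)
    also have "\<dots> \<le> norm s / \<bar>Im l\<bar> * norm \<phi>" by (intro mult_right_mono norm_mult_kern l) simp
    finally show ?thesis by (simp add: K1_def mult.commute)
  qed
  have b: "cmod (cauchy (rep_L2 s) l) \<le> K2 * norm s" for s
    using cauchy_bound[OF rep_L2_square_integrable[of s] l] by (simp add: K2_def mult.commute)
  define K3 where "K3 = (cmod (B - \<sigma>) * K1 + cmod q * K2) / cmod det"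
  define K4 where "K4 = (cmod (1 + p) * K2 + cmod r * K1) / cmod det"
  have c1: "cmod (coeff1 s) \<le> K3 * norm s" for s
  proof -
    have "cmod ((B - \<sigma>) * cinner (mult_kern l s) \<phi> + q * cauchy (rep_L2 s) l) \<le>
        cmod (B - \<sigma>) * cmod (cinner (mult_kern l s) \<phi>) + cmod q * cmod (cauchy (rep_L2 s) l)"
      using norm_triangle_ineq by (metis norm_mult)
    also have "\<dots> \<le> cmod (B - \<sigma>) * (K1 * norm s) + cmod q * (K2 * norm s)"
      by (intro add_mono mult_left_mono a b) auto
    finally have "cmod ((B - \<sigma>) * cinner (mult_kern l s) \<phi> + q * cauchy (rep_L2 s) l) / cmod det \<le>
        (cmod (B - \<sigma>) * (K1 * norm s) + cmod q * (K2 * norm s)) / cmod det"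
      by (rule divide_right_mono) simp
    then show ?thesis by (simp add: coeff1_def K3_def norm_divide algebra_simps add_divide_distrib)
  qed
  have c2: "cmod (coeff2 s) \<le> K4 * norm s" for s
  proof -
    have "cmod ((1 + p) * cauchy (rep_L2 s) l - r * cinner (mult_kern l s) \<phi>) \<le>
        cmod (1 + p) * cmod (cauchy (rep_L2 s) l) + cmod r * cmod (cinner (mult_kern l s) \<phi>)"
      using norm_triangle_ineq4 by (metis norm_mult)
    also have "\<dots> \<le> cmod (1 + p) * (K2 * norm s) + cmod r * (K1 * norm s)"
      by (intro add_mono mult_left_mono a b) auto
    finally have "cmod ((1 + p) * cauchy (rep_L2 s) l - r * cinner (mult_kern l s) \<phi>) / cmod det \<le>
        (cmod (1 + p) * (K2 * norm s) + cmod r * (K1 * norm s)) / cmod det"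
      by (rule divide_right_mono) simp
    then show ?thesis by (simp add: coeff2_def K4_def norm_divide algebra_simps add_divide_distrib)
  qed
  have "norm (sol s) \<le> (1 / \<bar>Im l\<bar> + K3 * norm (mult_kern l \<psi>) + K4 * norm (kern_L2 l)) * norm s" for s
  proof -
    have "norm (sol s) \<le> norm (mult_kern l s) + norm ((- coeff1 s) *\<^sub>C mult_kern l \<psi>) + norm (coeff2 s *\<^sub>C kern_L2 l)"
      unfolding sol_def by (rule norm_triangle_le, rule add_right_mono, rule norm_triangle_ineq)
    also have "\<dots> \<le> norm s / \<bar>Im l\<bar> + K3 * norm s * norm (mult_kern l \<psi>) + K4 * norm s * norm (kern_L2 l)"
      unfolding norm_scaleC norm_minus_cancel
      by (intro add_mono mult_right_mono norm_mult_kern[OF l] c1 c2) auto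
    finally show ?thesis by (simp add: algebra_simps)
  qed
  then have "\<forall>s u. u = sol s \<longrightarrow> norm u \<le> (1 / \<bar>Im l\<bar> + K3 * norm (mult_kern l \<psi>) + K4 * norm (kern_L2 l)) * norm s"
    by simp
  then have "\<exists>K. \<forall>s u. u = sol s \<longrightarrow> norm u \<le> K * norm s" by (rule exI)
  then show ?thesis
    unfolding resolvent_set_def mem_Collect_eq A_op_resolvent_eq[OF det] by simp
qed

end

lemma orth_S_space_kernel_identity:
  assumes m: "m \<in> resolvent_set (A_op \<phi> \<psi> B)" and g: "g \<in> orth (S_space \<phi> \<psi> B m)"
    and l: "Im l \<noteq> 0" and det: "friedrichs_point.det \<phi> \<psi> B l \<noteq> 0"
  shows "(1 + cauchy (\<lambda>x. rep_L2 \<psi> x * cnj (rep_L2 \<phi> x)) l) * cauchy (\<lambda>x. cnj (rep_L2 g x)) l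
    - cauchy (\<lambda>x. cnj (rep_L2 \<phi> x)) l * cauchy (\<lambda>x. rep_L2 \<psi> x * cnj (rep_L2 g x)) l
    = - friedrichs_point.det \<phi> \<psi> B l * cinner (solution_op \<phi> \<psi> B m 1) g"
proof -
  interpret friedrichs_point \<phi> \<psi> B l by unfold_locales (rule l)
  define w where "w = (1 + p) *\<^sub>C kern_L2 l - q *\<^sub>C mult_kern l \<psi>"
  have bw: "has_boundary_values w (\<sigma> * (1 + p) - q * r) (1 + p)" and kw: "(w, l *\<^sub>C w) \<in> max_op \<phi> \<psi>"
    unfolding w_def by (rule kernel_element)+
  \<comment> \<open>The boundary datum of \<open>w\<close> is \<open>- det\<close>; this factor
    rescales it to \<open>1\<close>.\<close>
  define k where "k = - 1 / det"
  have z: "has_boundary_values 0 0 0" "(0, 0) \<in> max_op \<phi> \<psi>"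
    using has_boundary_values_add_scale[OF bw bw, of "-1"] max_op_add_scale[OF kw kw, of "-1"] by simp_all
  have b: "has_boundary_values (0 + k *\<^sub>C w) (0 + k * (\<sigma> * (1 + p) - q * r)) (0 + k * (1 + p))"
    by (intro has_boundary_values_add_scale z bw)
  have "(0 + k *\<^sub>C w, 0 + k *\<^sub>C (l *\<^sub>C w)) \<in> max_op \<phi> \<psi>"
    by (intro max_op_add_scale z kw)
  then have kk: "(0 + k *\<^sub>C w, l *\<^sub>C (0 + k *\<^sub>C w)) \<in> max_op \<phi> \<psi>"
    by (simp add: mult.commute)
  have kd: "k * det = - 1" using det by (simp add: k_def)
  have "(0 + k * (\<sigma> * (1 + p) - q * r)) - B * (0 + k * (1 + p)) = - (k * det)"
    by (simp add: det_def algebra_simps)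
  then have one: "(0 + k * (\<sigma> * (1 + p) - q * r)) - B * (0 + k * (1 + p)) = 1"
    using kd by simp
  have "cinner g (0 + k *\<^sub>C w) = cinner g (solution_op \<phi> \<psi> B m 1)"
    using orth_S_space_kernel[OF m resolvent_setI[OF det] g b kk] by (simp only: one)
  then have "cnj (cinner g (k *\<^sub>C w)) = cnj (cinner g (solution_op \<phi> \<psi> B m 1))" by simp
  then have "cinner (k *\<^sub>C w) g = cinner (solution_op \<phi> \<psi> B m 1) g"
    by (simp only: cinner_commute[symmetric])
  then have "k * cinner w g = cinner (solution_op \<phi> \<psi> B m 1) g" by (simp add: cinner_simps)
  then have "(k * det) * cinner w g = det * cinner (solution_op \<phi> \<psi> B m 1) g" by simp
  then have "- cinner w g = det * cinner (solution_op \<phi> \<psi> B m 1) g" unfolding kd by simp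
  then have "cinner w g = - det * cinner (solution_op \<phi> \<psi> B m 1) g"
    by (metis minus_minus mult_minus_left)
  moreover have "cinner w g = (1 + p) * cauchy (\<lambda>x. cnj (rep_L2 g x)) l - q * cauchy (\<lambda>x. rep_L2 \<psi> x * cnj (rep_L2 g x)) l"
    by (simp add: w_def cinner_simps cinner_kern_L2 cinner_mult_kern l)
  ultimately show ?thesis
    by (simp add: p_def q_def cinner_kern_L2 cinner_mult_kern l)
qed

text \<open>The determinant of the linear system in terms of Cauchy transforms, as one function of
  \<open>l\<close> that can be evaluated at several points at once.\<close>

definition friedrichs_det :: "L2 \<Rightarrow> L2 \<Rightarrow> complex \<Rightarrow> complex \<Rightarrow> complex" where
  "friedrichs_det \<phi> \<psi> B l = (B - of_real (sgn (Im l) * pi) * \<i>) * (1 + cauchy (\<lambda>x. rep_L2 \<psi> x * cnj (rep_L2 \<phi> x)) l)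
    + cauchy (\<lambda>x. cnj (rep_L2 \<phi> x)) l * cauchy (rep_L2 \<psi>) l"

lemma friedrichs_point_det: "Im l \<noteq> 0 \<Longrightarrow> friedrichs_point.det \<phi> \<psi> B l = friedrichs_det \<phi> \<psi> B l"
proof -
  assume l: "Im l \<noteq> 0"
  interpret friedrichs_point \<phi> \<psi> B l by unfold_locales (rule l)
  show ?thesis by (simp add: det_def friedrichs_det_def p_def q_def r_def \<sigma>_def cinner_kern_L2 cinner_mult_kern l)
qed

text \<open>The sign \<open>s\<close> selects the half-plane in which both transforms of the data
  vanish: \<open>- 1\<close> for \<open>\<S>\<^sub>B\<close> and \<open>1\<close> for the adjoint
  side, so that one proof serves both. The argument in that half-plane shows that the scalar
  \<open>\<kappa>\<close> is zero, and this gives the identity in the other half-plane too.\<close>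

lemma orth_S_space_identity:
  assumes m: "m \<in> resolvent_set (A_op \<phi> \<psi> B)" and g: "g \<in> orth (S_space \<phi> \<psi> B m)"
    and s: "s = 1 \<or> s = - 1" and B: "B \<noteq> of_real (s * pi) * \<i>"
    and triv: "\<And>l. sgn (Im l) = s \<Longrightarrow> cauchy (\<lambda>x. rep_L2 \<psi> x * cnj (rep_L2 \<phi> x)) l = 0"
      "\<And>l. sgn (Im l) = s \<Longrightarrow> cauchy (\<lambda>x. cnj (rep_L2 \<phi> x)) l = 0"
    and l: "Im l \<noteq> 0" and det: "friedrichs_det \<phi> \<psi> B l \<noteq> 0"
  shows "(1 + cauchy (\<lambda>x. rep_L2 \<psi> x * cnj (rep_L2 \<phi> x)) l) * cauchy (\<lambda>x. cnj (rep_L2 g x)) l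
    = cauchy (\<lambda>x. cnj (rep_L2 \<phi> x)) l * cauchy (\<lambda>x. rep_L2 \<psi> x * cnj (rep_L2 g x)) l"
proof -
  let ?g = "\<lambda>x. cnj (rep_L2 g x)"
  define \<kappa> where "\<kappa> = cinner (solution_op \<phi> \<psi> B m 1) g"
  have id: "(1 + cauchy (\<lambda>x. rep_L2 \<psi> x * cnj (rep_L2 \<phi> x)) n) * cauchy ?g n
    - cauchy (\<lambda>x. cnj (rep_L2 \<phi> x)) n * cauchy (\<lambda>x. rep_L2 \<psi> x * ?g x) n = - friedrichs_det \<phi> \<psi> B n * \<kappa>"
    if "Im n \<noteq> 0" "friedrichs_det \<phi> \<psi> B n \<noteq> 0" for n
    using orth_S_space_kernel_identity[OF m g that(1)] that by (simp add: friedrichs_point_det \<kappa>_def)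
  have "((\<lambda>y. cauchy ?g (Complex 0 (s * y))) \<longlongrightarrow> 0) at_top"
    using s by (intro cauchy_tendsto_zero square_integrable_cnj) auto
  then have "((\<lambda>y::real. - (B - of_real (s * pi) * \<i>) * \<kappa>) \<longlongrightarrow> 0) at_top"
  proof (rule tendsto_cong[THEN iffD1, rotated])
    show "\<forall>\<^sub>F y in at_top. cauchy ?g (Complex 0 (s * y)) = - (B - of_real (s * pi) * \<i>) * \<kappa>"
      using eventually_gt_at_top[of 0]
    proof eventually_elim
      case (elim y)
      have n: "sgn (Im (Complex 0 (s * y))) = s" using elim s by auto
      then have n0: "Im (Complex 0 (s * y)) \<noteq> 0" using elim s by auto
      have d: "friedrichs_det \<phi> \<psi> B (Complex 0 (s * y)) = B - of_real (s * pi) * \<i>"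
        unfolding friedrichs_det_def triv[OF n] n by simp
      show ?case using id[OF n0] B unfolding d triv[OF n] by simp
    qed
  qed
  then have "- (B - of_real (s * pi) * \<i>) * \<kappa> = 0"
    by (rule tendsto_unique[OF trivial_limit_at_top_linorder tendsto_const])
  moreover have "- (B - of_real (s * pi) * \<i>) \<noteq> 0"
    using B by (simp only: neg_equal_0_iff_equal right_minus_eq not_False_eq_True)
  ultimately have "\<kappa> = 0" by (simp only: mult_eq_0_iff simp_thms)
  with id[OF l det] show ?thesis by simp
qed

section \<open>Density of the detectable subspace\<close>

lemma holomorphic_mult_zero:
  assumes "f holomorphic_on S" "g holomorphic_on S" "open S" "connected S"
    and z: "\<And>x. x \<in> S \<Longrightarrow> f x * g x = 0"
  shows "(\<forall>x\<in>S. f x = 0) \<or> (\<forall>x\<in>S. g x = 0)"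
proof (rule disjCI)
  assume "\<not> (\<forall>x\<in>S. g x = 0)"
  then obtain a where a: "a \<in> S" "g a \<noteq> 0" by auto
  have "continuous_on S g" using assms(2) by (rule holomorphic_on_imp_continuous_on)
  then have o: "open (S \<inter> g -` (- {0}))"
    using assms(3) by (intro continuous_open_preimage) auto
  show "\<forall>x\<in>S. f x = 0"
  proof
    fix x assume x: "x \<in> S"
    show "f x = 0"
      by (rule analytic_continuation_open[OF o assms(3) _ assms(4) _ assms(1) holomorphic_on_const _ x])
        (use a z in auto)
  qed
qed

lemma hardy_space_imp_hardy_function:
  assumes "h \<in> hardy_space"
  obtains F C where "hardy_function F C"
    "AE x in lborel. ((\<lambda>y. F (Complex x y)) \<longlongrightarrow> rep_L2 h x) (at_right 0)"
proof -
  obtain F where F: "F \<in> hardy_class" and lim: "AE x in lborel. ((\<lambda>y. F (Complex x y)) \<longlongrightarrow> rep_L2 h x) (at_right 0)"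
    using assms by (auto simp: hardy_space_def)
  then obtain C where hol: "F holomorphic_on {z. Im z > 0}"
    and C: "\<And>y. y > 0 \<Longrightarrow> (\<lambda>x. F (Complex x y)) \<in> square_integrable"
      "\<And>y. y > 0 \<Longrightarrow> (LINT x|lborel. (cmod (F (Complex x y)))\<^sup>2) \<le> C"
    by (auto simp: hardy_class_def)
  have "hardy_function F (sqrt C)"
    by unfold_locales (use hol C in \<open>auto simp: norm_abs_L2\<close>)
  then show thesis using lim that by blast
qed

lemma hardy_space_cauchy_lower:
  assumes "h \<in> hardy_space" "Im l < 0"
  shows "cauchy (rep_L2 h) l = 0"
proof -
  obtain F C where "hardy_function F C" "AE x in lborel. ((\<lambda>y. F (Complex x y)) \<longlongrightarrow> rep_L2 h x) (at_right 0)"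
    using hardy_space_imp_hardy_function[OF assms(1)] .
  from hardy_function.cauchy_boundary[OF this(1) rep_L2_square_integrable this(2), of l] assms(2)
  show ?thesis by simp
qed

lemma hardy_space_cauchy_mult:
  assumes h: "h \<in> hardy_space" and g: "g \<in> square_integrable" "\<And>m. Im m < 0 \<Longrightarrow> cauchy g m = 0"
  shows "Im m < 0 \<Longrightarrow> cauchy (\<lambda>x. rep_L2 h x * g x) m = 0"
    and "Im m > 0 \<Longrightarrow> 2 * of_real pi * \<i> * cauchy (\<lambda>x. rep_L2 h x * g x) m = cauchy (rep_L2 h) m * cauchy g m"
proof -
  obtain F C where F: "hardy_function F C" "AE x in lborel. ((\<lambda>y. F (Complex x y)) \<longlongrightarrow> rep_L2 h x) (at_right 0)"
    using hardy_space_imp_hardy_function[OF h] .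
  note * = hardy_function.cauchy_mult[OF F(1) rep_L2_square_integrable F(2) g]
  show "Im m < 0 \<Longrightarrow> cauchy (\<lambda>x. rep_L2 h x * g x) m = 0" by (rule *(1))
  show "Im m > 0 \<Longrightarrow> 2 * of_real pi * \<i> * cauchy (\<lambda>x. rep_L2 h x * g x) m = cauchy (rep_L2 h) m * cauchy g m"
    by (rule *(2))
qed

text \<open>The common end of both sides. For \<open>\<S>\<^sub>B\<close> it is used with
  \<open>a\<close> the conjugate of \<open>\<phi>\<close>, \<open>b = \<psi>\<close> and the
  conjugate of the orthogonal vector; for the adjoint side with \<open>a\<close> and
  \<open>b\<close> exchanged, the same \<open>B\<close> and the vector itself.\<close>

lemma hardy_uniqueness:
  assumes a: "a \<in> hardy_space" and b: "b \<in> hardy_space"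
    and B: "B = of_real pi * \<i> \<Longrightarrow> a \<noteq> 0 \<and> b \<noteq> 0"
    and g: "\<And>l. Im l < 0 \<Longrightarrow> cauchy (rep_L2 g) l = 0"
    and id: "\<And>l. Im l > 0 \<Longrightarrow> (B - of_real pi * \<i>) * (1 + cauchy (\<lambda>x. rep_L2 b x * rep_L2 a x) l)
        + cauchy (rep_L2 a) l * cauchy (rep_L2 b) l \<noteq> 0 \<Longrightarrow>
      (1 + cauchy (\<lambda>x. rep_L2 b x * rep_L2 a x) l) * cauchy (rep_L2 g) l
        = cauchy (rep_L2 a) l * cauchy (\<lambda>x. rep_L2 b x * rep_L2 g x) l"
  shows "g = 0"
proof -
  let ?U = "{z. Im z > 0}"
  let ?A = "cauchy (rep_L2 a)" and ?B = "cauchy (rep_L2 b)" and ?G = "cauchy (rep_L2 g)"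
  have U: "open ?U" "connected ?U"
    by (auto intro: open_halfspace_Im_gt convex_connected convex_halfspace_Im_gt)
  have hol: "cauchy (rep_L2 u) holomorphic_on ?U" for u
    by (rule cauchy_holomorphic) auto
  have zero: "u = 0" if "u \<in> hardy_space" "\<And>l. Im l > 0 \<Longrightarrow> cauchy (rep_L2 u) l = 0" for u
    using that(2) hardy_space_cauchy_lower[OF that(1)]
    by (intro L2_eq_zeroI) (metis linorder_neqE)
  \<comment> \<open>The determinant in the upper half-plane with the transform of the product
    already replaced by the product of transforms, so that holomorphy is visible.\<close>
  define D where "D l = (B - of_real pi * \<i>) * (1 + ?B l * ?A l / (2 * of_real pi * \<i>)) + ?A l * ?B l" for l
  have ab: "cauchy (\<lambda>x. rep_L2 b x * rep_L2 a x) l = ?B l * ?A l / (2 * of_real pi * \<i>)" if "Im l > 0" for l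
    using hardy_space_cauchy_mult(2)[OF b rep_L2_square_integrable hardy_space_cauchy_lower[OF a] that]
    by (simp add: field_simps)
  have bg: "cauchy (\<lambda>x. rep_L2 b x * rep_L2 g x) l = ?B l * ?G l / (2 * of_real pi * \<i>)" if "Im l > 0" for l
    using hardy_space_cauchy_mult(2)[OF b rep_L2_square_integrable g that]
    by (simp add: field_simps)
  have "D l * ?G l = 0" if "l \<in> ?U" for l
  proof (cases "D l = 0")
    case False
    have l: "Im l > 0" using that by simp
    have "(1 + ?B l * ?A l / (2 * of_real pi * \<i>)) * ?G l = ?A l * (?B l * ?G l / (2 * of_real pi * \<i>))"
      using id[OF l] False unfolding ab[OF l] bg[OF l] D_def by blast
    \<comment> \<open>After expansion the terms with \<open>?A l * ?B l * ?G l\<close>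
      cancel.\<close>
    then have "?G l = 0" by (simp add: algebra_simps)
    then show ?thesis by simp
  qed simp
  moreover have "D holomorphic_on ?U"
    unfolding D_def by (intro holomorphic_intros hol) auto
  ultimately have "(\<forall>l\<in>?U. D l = 0) \<or> (\<forall>l\<in>?U. ?G l = 0)"
    using hol U by (intro holomorphic_mult_zero)
  moreover have "\<not> (\<forall>l\<in>?U. D l = 0)"
  proof
    assume D0: "\<forall>l\<in>?U. D l = 0"
    show False
    \<comment> \<open>In this case \<open>D\<close> reduces to \<open>?A l * ?B l\<close>, a product
      of two functions that are not identically zero. Otherwise \<open>D\<close> tends to
      \<open>B - \<pi> \<i>\<close>, which is not zero, along the imaginary axis.\<close>
    proof (cases "B = of_real pi * \<i>")
      case True
      then have "?A l * ?B l = 0" if "l \<in> ?U" for l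
        using D0 that by (simp add: D_def)
      then have "(\<forall>l\<in>?U. ?A l = 0) \<or> (\<forall>l\<in>?U. ?B l = 0)"
        using hol U by (intro holomorphic_mult_zero)
      then show False using B[OF True] zero[OF a] zero[OF b] by auto
    next
      case False
      have A0: "((\<lambda>y. ?A (Complex 0 (1 * y))) \<longlongrightarrow> 0) at_top" and B0: "((\<lambda>y. ?B (Complex 0 (1 * y))) \<longlongrightarrow> 0) at_top"
        by (intro cauchy_tendsto_zero; simp)+
      have "((\<lambda>y. D (Complex 0 (1 * y))) \<longlongrightarrow> (B - of_real pi * \<i>) * (1 + 0 * 0 / (2 * of_real pi * \<i>)) + 0 * 0) at_top"
        unfolding D_def by (intro tendsto_intros A0 B0) auto
      moreover have "\<forall>\<^sub>F y in at_top. D (Complex 0 (1 * y)) = 0"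
        using eventually_gt_at_top[of 0] by eventually_elim (use D0 in auto)
      ultimately have "((\<lambda>y::real. 0) \<longlongrightarrow> (B - of_real pi * \<i>) * (1 + 0 * 0 / (2 * of_real pi * \<i>)) + 0 * 0) at_top"
        by (rule tendsto_cong[THEN iffD1, rotated])
      then show False using False by (simp add: tendsto_const_iff)
    qed
  qed
  ultimately have G: "\<forall>l\<in>?U. ?G l = 0" by blast
  show "g = 0"
  proof (rule L2_eq_zeroI)
    fix l :: complex assume "Im l \<noteq> 0"
    then show "?G l = 0" using g[of l] G by (cases "Im l > 0") auto
  qed
qed

lemma edim_trivial: "V \<subseteq> {0} \<Longrightarrow> edim V = 0"
proof -
  assume V: "V \<subseteq> {0}"
  have "b = {}" if "b \<subseteq> V" "\<not> L2.dependent b" for b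
    using that V L2.dependent_zero by blast
  then have "{b. b \<subseteq> V \<and> finite b \<and> \<not> L2.dependent b} \<subseteq> {{}}" by auto
  then show ?thesis
    unfolding edim_def by (intro antisym SUP_least) (auto simp flip: zero_enat_def)
qed

lemma cauchy_rep_cnj: "cauchy (rep_L2 (cnj_L2 u)) l = cauchy (\<lambda>x. cnj (rep_L2 u x)) l"
  by (rule cauchy_cong_AE[OF _ _ rep_cnj]) (simp_all add: square_integrable_cnj)

lemma cauchy_mult_cong:
  assumes "AE x in lborel. rep_L2 a' x = a x" "a \<in> borel_measurable borel" "b \<in> borel_measurable borel"
  shows "cauchy (\<lambda>x. b x * rep_L2 a' x) l = cauchy (\<lambda>x. b x * a x) l"
  unfolding cauchy_def
proof (rule integral_cong_AE)
  note [measurable] = square_integrable_measurable[OF rep_L2_square_integrable] assms(2,3)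
  show "(\<lambda>x. b x * rep_L2 a' x * kern l x) \<in> borel_measurable lborel"
    "(\<lambda>x. b x * a x * kern l x) \<in> borel_measurable lborel" by measurable
qed (use assms(1) in \<open>eventually_elim, simp\<close>)

text \<open>The last assumption excludes a genuine exception. For \<open>B = \<pi> \<i>\<close> with
  \<open>\<phi> = 0\<close> or \<open>\<psi> = 0\<close> the determinant is zero throughout the
  upper half-plane and each \<open>l\<close> there is an eigenvalue with eigenfunction
  \<open>1 / (x - l)\<close>. Only the lower half-plane then contributes to
  \<open>\<S>\<^sub>B\<close>, which lies in the Hardy space and has infinite defect.\<close>

theorem theorem5p10:
  fixes \<phi> \<psi> :: L2 and B :: complex
  assumes "cnj_L2 \<phi> \<in> hardy_space" and "\<psi> \<in> hardy_space"
    and "B \<noteq> - (of_real pi * \<i>)"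
    and "B = of_real pi * \<i> \<Longrightarrow> \<phi> \<noteq> 0 \<and> \<psi> \<noteq> 0"
  shows "(\<forall>\<mu>\<^sub>0\<in>resolvent_set (A_op \<phi> \<psi> B). defect (S_space \<phi> \<psi> B \<mu>\<^sub>0) = 0) \<and>
    (\<forall>\<mu>\<in>resolvent_set (A_adj_op \<phi> \<psi> (cnj B)). defect (S_adj_space \<phi> \<psi> (cnj B) \<mu>) = 0)"
proof (intro conjI ballI)
  let ?a = "cnj_L2 \<phi>"
  note [measurable] = square_integrable_measurable[OF rep_L2_square_integrable]
    square_integrable_measurable[OF square_integrable_cnj[OF rep_L2_square_integrable]]
  have phi0: "\<phi> \<noteq> 0 \<Longrightarrow> ?a \<noteq> 0"
  proof
    assume "\<phi> \<noteq> 0" "?a = 0"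
    have "AE x in lborel. rep_L2 \<phi> x = rep_L2 0 x"
      using rep_cnj[of \<phi>] rep_zero unfolding \<open>?a = 0\<close> by eventually_elim simp
    then show False using \<open>\<phi> \<noteq> 0\<close> L2_eqI by blast
  qed
  have zz: "B = of_real pi * \<i> \<Longrightarrow> ?a \<noteq> 0 \<and> \<psi> \<noteq> 0" using assms(4) phi0 by blast
  have a_low: "cauchy (\<lambda>x. cnj (rep_L2 \<phi> x)) l = 0" if "Im l < 0" for l
    using hardy_space_cauchy_lower[OF assms(1) that] by (simp add: cauchy_rep_cnj)
  have pa: "cauchy (\<lambda>x. rep_L2 \<psi> x * rep_L2 ?a x) l = cauchy (\<lambda>x. rep_L2 \<psi> x * cnj (rep_L2 \<phi> x)) l" for l
    by (rule cauchy_mult_cong[OF rep_cnj]) measurable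
  have p_low: "cauchy (\<lambda>x. rep_L2 \<psi> x * cnj (rep_L2 \<phi> x)) l = 0" if "Im l < 0" for l
    using hardy_space_cauchy_mult(1)[OF assms(2) rep_L2_square_integrable hardy_space_cauchy_lower[OF assms(1)] that]
    by (simp add: pa)
  {
    fix m assume m: "m \<in> resolvent_set (A_op \<phi> \<psi> B)"
    have "g = 0" if g: "g \<in> orth (S_space \<phi> \<psi> B m)" for g
    proof -
      have id: "(1 + cauchy (\<lambda>x. rep_L2 \<psi> x * cnj (rep_L2 \<phi> x)) l) * cauchy (\<lambda>x. cnj (rep_L2 g x)) l
        = cauchy (\<lambda>x. cnj (rep_L2 \<phi> x)) l * cauchy (\<lambda>x. rep_L2 \<psi> x * cnj (rep_L2 g x)) l"
        if "Im l \<noteq> 0" "friedrichs_det \<phi> \<psi> B l \<noteq> 0" for l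
        by (rule orth_S_space_identity[OF m g, of "-1"])
          (use that assms(3) in \<open>auto simp: sgn_if a_low p_low split: if_splits\<close>)
      have pg: "cauchy (\<lambda>x. rep_L2 \<psi> x * rep_L2 (cnj_L2 g) x) l = cauchy (\<lambda>x. rep_L2 \<psi> x * cnj (rep_L2 g x)) l" for l
        by (rule cauchy_mult_cong[OF rep_cnj]) measurable
      have "cnj_L2 g = 0"
      proof (rule hardy_uniqueness[OF assms(1,2) zz])
        fix l :: complex assume l: "Im l < 0"
        have "friedrichs_det \<phi> \<psi> B l = B + of_real pi * \<i>"
          using l by (simp add: friedrichs_det_def a_low p_low)
        moreover have "B + of_real pi * \<i> \<noteq> 0" using assms(3) by (simp add: add_eq_0_iff2)
        ultimately show "cauchy (rep_L2 (cnj_L2 g)) l = 0"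
          using id[of l] l by (simp add: a_low p_low cauchy_rep_cnj)
      next
        fix l :: complex assume l: "Im l > 0"
          and d: "(B - of_real pi * \<i>) * (1 + cauchy (\<lambda>x. rep_L2 \<psi> x * rep_L2 ?a x) l)
            + cauchy (rep_L2 ?a) l * cauchy (rep_L2 \<psi>) l \<noteq> 0"
        have "friedrichs_det \<phi> \<psi> B l \<noteq> 0" using d l by (simp add: friedrichs_det_def pa cauchy_rep_cnj)
        then show "(1 + cauchy (\<lambda>x. rep_L2 \<psi> x * rep_L2 ?a x) l) * cauchy (rep_L2 (cnj_L2 g)) l
          = cauchy (rep_L2 ?a) l * cauchy (\<lambda>x. rep_L2 \<psi> x * rep_L2 (cnj_L2 g) x) l"
          using id[of l] l by (simp add: pa pg cauchy_rep_cnj)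
      qed
      then have "AE x in lborel. rep_L2 0 x = cnj (rep_L2 g x)"
        using rep_cnj[of g] by (simp only:)
      then have "AE x in lborel. rep_L2 g x = rep_L2 0 x"
        using rep_zero by eventually_elim (metis complex_cnj_zero_iff)
      then show "g = 0" by (rule L2_eqI)
    qed
    then show "defect (S_space \<phi> \<psi> B m) = 0"
      unfolding defect_def by (intro edim_trivial) blast
  next
    fix m assume "m \<in> resolvent_set (A_adj_op \<phi> \<psi> (cnj B))"
    then have m: "m \<in> resolvent_set (A_op \<psi> \<phi> (cnj B))" by (simp add: A_adj_op_def)
    \<comment> \<open>The transforms on the adjoint side at \<open>l\<close> are conjugates of the
      original ones at \<open>cnj l\<close>. The half-plane where they vanish is therefore the upper
      one, and the excluded value \<open>- \<pi> \<i>\<close> of \<open>B\<close> becomes the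
      excluded value \<open>\<pi> \<i>\<close> of \<open>cnj B\<close>. Conjugating the resulting
      identity back brings it into the form that \<open>hardy_uniqueness\<close> expects.\<close>
    have c1: "cauchy (\<lambda>x. rep_L2 \<phi> x * cnj (rep_L2 \<psi> x)) l = cnj (cauchy (\<lambda>x. rep_L2 \<psi> x * cnj (rep_L2 \<phi> x)) (cnj l))" for l
      unfolding cauchy_cnj[symmetric] by (simp add: mult.commute)
    have c2: "cauchy (\<lambda>x. cnj (rep_L2 \<psi> x)) l = cnj (cauchy (rep_L2 \<psi>) (cnj l))" for l
      by (rule cauchy_cnj)
    have c3: "cauchy (rep_L2 \<phi>) l = cnj (cauchy (\<lambda>x. cnj (rep_L2 \<phi> x)) (cnj l))" for l
      unfolding cauchy_cnj[symmetric] by simp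
    have psi_low: "cauchy (rep_L2 \<psi>) l = 0" if "Im l < 0" for l
      using hardy_space_cauchy_lower[OF assms(2) that] .
    have "g = 0" if g: "g \<in> orth (S_space \<psi> \<phi> (cnj B) m)" for g
    proof -
      have B': "cnj B \<noteq> of_real pi * \<i>"
        using assms(3) by (metis complex_cnj_cnj complex_cnj_complex_of_real complex_cnj_i complex_cnj_mult mult_minus_right)
      have id: "(1 + cauchy (\<lambda>x. rep_L2 \<phi> x * cnj (rep_L2 \<psi> x)) l) * cauchy (\<lambda>x. cnj (rep_L2 g x)) l
        = cauchy (\<lambda>x. cnj (rep_L2 \<psi> x)) l * cauchy (\<lambda>x. rep_L2 \<phi> x * cnj (rep_L2 g x)) l"
        if "Im l \<noteq> 0" "friedrichs_det \<psi> \<phi> (cnj B) l \<noteq> 0" for l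
        by (rule orth_S_space_identity[OF m g, of 1])
          (use that B' in \<open>auto simp: sgn_if c1 c2 p_low psi_low split: if_splits\<close>)
      have id': "(1 + cauchy (\<lambda>x. rep_L2 \<psi> x * cnj (rep_L2 \<phi> x)) l) * cauchy (rep_L2 g) l
        = cauchy (rep_L2 \<psi>) l * cauchy (\<lambda>x. cnj (rep_L2 \<phi> x) * rep_L2 g x) l"
        if "Im l \<noteq> 0" "friedrichs_det \<psi> \<phi> (cnj B) (cnj l) \<noteq> 0" for l
      proof -
        have g1: "cauchy (\<lambda>x. cnj (rep_L2 g x)) (cnj l) = cnj (cauchy (rep_L2 g) l)"
          by (simp add: cauchy_cnj)
        have g2: "cauchy (\<lambda>x. rep_L2 \<phi> x * cnj (rep_L2 g x)) (cnj l) = cnj (cauchy (\<lambda>x. cnj (rep_L2 \<phi> x) * rep_L2 g x) l)"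
          using cauchy_cnj[of "\<lambda>x. cnj (rep_L2 \<phi> x) * rep_L2 g x" "cnj l"] by simp
        have "cnj ((1 + cauchy (\<lambda>x. rep_L2 \<psi> x * cnj (rep_L2 \<phi> x)) l) * cauchy (rep_L2 g) l)
          = cnj (cauchy (rep_L2 \<psi>) l * cauchy (\<lambda>x. cnj (rep_L2 \<phi> x) * rep_L2 g x) l)"
          using id[of "cnj l"] that by (simp add: c1 c2 g1 g2)
        then show ?thesis by (simp only: complex_cnj_cancel_iff)
      qed
      have fd: "friedrichs_det \<psi> \<phi> (cnj B) (cnj l) = cnj ((B - of_real (sgn (Im l) * pi) * \<i>) *
          (1 + cauchy (\<lambda>x. rep_L2 \<psi> x * cnj (rep_L2 \<phi> x)) l) + cauchy (rep_L2 \<psi>) l * cauchy (\<lambda>x. cnj (rep_L2 \<phi> x)) l)" for l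
        by (simp add: friedrichs_det_def c1 c2 c3 sgn_minus)
      have pa': "cauchy (\<lambda>x. rep_L2 ?a x * rep_L2 \<psi> x) l = cauchy (\<lambda>x. rep_L2 \<psi> x * cnj (rep_L2 \<phi> x)) l" for l
        using pa[of l] by (simp add: mult.commute)
      have ag: "cauchy (\<lambda>x. rep_L2 ?a x * rep_L2 g x) l = cauchy (\<lambda>x. cnj (rep_L2 \<phi> x) * rep_L2 g x) l" for l
        using cauchy_mult_cong[OF rep_cnj[of \<phi>], of "rep_L2 g" l] by (simp add: mult.commute)
      show "g = 0"
      proof (rule hardy_uniqueness[OF assms(2,1)])
        show "\<psi> \<noteq> 0 \<and> ?a \<noteq> 0" if "B = of_real pi * \<i>" using zz[OF that] by simp
      next
        fix l :: complex assume l: "Im l < 0"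
        have "friedrichs_det \<psi> \<phi> (cnj B) (cnj l) = cnj (B + of_real pi * \<i>)"
          using l unfolding fd by (simp add: p_low psi_low)
        moreover have "B + of_real pi * \<i> \<noteq> 0" using assms(3) by (simp add: add_eq_0_iff2)
        ultimately have "friedrichs_det \<psi> \<phi> (cnj B) (cnj l) \<noteq> 0"
          by (simp only: complex_cnj_zero_iff not_False_eq_True)
        then show "cauchy (rep_L2 g) l = 0"
          using id'[of l] l by (simp add: psi_low p_low)
      next
        fix l :: complex assume l: "Im l > 0"
          and d: "(B - of_real pi * \<i>) * (1 + cauchy (\<lambda>x. rep_L2 ?a x * rep_L2 \<psi> x) l)
            + cauchy (rep_L2 \<psi>) l * cauchy (rep_L2 ?a) l \<noteq> 0"
        have "friedrichs_det \<psi> \<phi> (cnj B) (cnj l) \<noteq> 0"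
          unfolding fd complex_cnj_zero_iff using d l by (simp add: pa' cauchy_rep_cnj)
        then show "(1 + cauchy (\<lambda>x. rep_L2 ?a x * rep_L2 \<psi> x) l) * cauchy (rep_L2 g) l
          = cauchy (rep_L2 \<psi>) l * cauchy (\<lambda>x. rep_L2 ?a x * rep_L2 g x) l"
          using id'[of l] l by (simp add: pa' ag)
      qed
    qed
    then show "defect (S_adj_space \<phi> \<psi> (cnj B) m) = 0"
      unfolding defect_def S_adj_space_def by (intro edim_trivial) blast
  }
qed

end
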